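(* Assume that $\mathcal I$ is $\kappa$-uniformly convex for some $\kappa>0$. Then there exists a constant $C>0$, independent of $\tau$, such that for the affine interpolants $\tilde z_\tau:[0,T]\to\mathcal Z$ built from those iterates of the local incremental minimization scheme at which time progresses (defined in the context), $$\|z(t)-\tilde z_\tau(t)\|_{\mathcal Z}\le C\sqrt{\tau}\qquad\text{for all } t\in[0,T],$$ where $z\in C^{0,1}([0,T];\mathcal Z)$ is the unique differential solution of the rate-independent system.
   Context: Setting. Let $T>0$. $\mathcal X$ is a Banach space and $\mathcal Z,\mathcal V$ are Hilbert spaces (all real) with $\mathcal Z\hookrightarrow\mathcal V$ densely and compactly and $\mathcal V\hookrightarrow\mathcal X$ continuously; the embedding constant of $\mathcal Z\hookrightarrow\mathcal V$ is normalized to $1$, i.e. $\|v\|_{\mathcal V}\le\|v\|_{\mathcal Z}$. Energy: $\mathcal I:[0,T]\times\mathcal Z\to\mathbb R$, $\mathcal I(t,z)=\frac12\langle Az,z\rangle_{\mathcal Z^*,\mathcal Z}+\mathcal F(z)-\langle \ell(t),z\rangle_{\mathcal V^*,\mathcal V}$, where $A\in\mathcal L(\mathcal Z,\mathcal Z^* )$ is self-adjoint with $\langle Az,z\rangle\ge\alpha\|z\|_{\mathcal Z}^2$ for some $\alpha>0$; $\ell\in C^{0,1}([0,T];\mathcal V^* )$ with Lipschitz constant $|\ell|_{Lip}$; $\mathcal F\in C^2(\mathcal Z;\mathbb R)$, $\mathcal F\ge0$, $D_z\mathcal F\in C^1(\mathcal Z,\mathcal V^* )$ and $\|D_z^2\mathcal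 F(z)v\|_{\mathcal V^*}\le C_{\mathcal F}(1+\|z\|_{\mathcal Z}^q)\|v\|_{\mathcal Z}$ for some $q\ge1$. Moreover $\mathcal I(t,\cdot)\in C^{2,1}_{loc}(\mathcal Z;\mathbb R)$: for every $r>0$ there is $C(r)\ge0$ with $\langle[D_z^2\mathcal I(t,z_1)-D_z^2\mathcal I(t,z_2)]v,v\rangle_{\mathcal Z^*,\mathcal Z}\le C(r)\|z_1-z_2\|_{\mathcal Z}\|v\|_{\mathcal Z}^2$ for all $z_1,z_2\in B_{\mathcal Z}(0,r)$, $v\in\mathcal Z$. $\kappa$-uniform convexity: $\langle D_z^2\mathcal I(t,z)v,v\rangle_{\mathcal Z^*,\mathcal Z}\ge\kappa\|v\|_{\mathcal Z}^2$ for all $t\in[0,T]$, $z,v\in\mathcal Z$. Dissipation: $\mathcal R:\mathcal V\to[0,\infty)$ is lower semicontinuous, convex, positively homogeneous of degree one, and there are $\underline\rho,\overline\rho>0$ with $\underline\rho\|v\|_{\mathcal X}\le\mathcal R(v)\le\overline\rho\|v\|_{\mathcal V}$ for all $v\in\mathcal V$. For $w\in\mathcal Z$, $\xi\in\mathcal Z^*$, the inclusion $0\in\partial\mathcal R(w)+\xi$ means $\mathcal R(v)\ge\mathcal R(w)-\langle\xi,v-w\rangle_{\mathcal Z^*,\mathcal Z}$ for all $v\in\mathcal Z$ (equivalently, by density, $-\xi$ extends to an element of the subdifferential of $\mathcal R$ at $w$ in $\mathcal V^*$). Initial state: $z_0\in\mathcal Z$ with $0\in\partial\mathcal R(0)+D_z\mathcal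 I(0,z_0)$. Differential solution: $z\in W^{1,1}(0,T;\mathcal Z)$ with $z(0)=z_0$ and $0\in\partial\mathcal R(z'(t))+D_z\mathcal I(t,z(t))$ for almost all $t\in[0,T]$. Local incremental minimization scheme: for $\tau>0$ put $t_0=0$ and, for $k\ge1$, let $z_k\in\arg\min\{\mathcal I(t_{k-1},z)+\mathcal R(z-z_{k-1}):z\in\mathcal Z,\ \|z-z_{k-1}\|_{\mathcal V}\le\tau\}$ (an arbitrary minimizer) and $t_k=\min\{t_{k-1}+\tau-\|z_k-z_{k-1}\|_{\mathcal V},T\}$. The iterates depend on $\tau$. $N(\tau)$ is the smallest index with $t_{N(\tau)}=T$ (it is finite). The iteration is continued after $N(\tau)$ (with $t_k=T$), and $\hat N(\tau)$ is the smallest index $k>N(\tau)$ for which $z_k$ is locally stable, i.e. $0\in\partial\mathcal R(0)+D_z\mathcal I(T,z_k)$ (it is finite under $\kappa$-uniform convexity). Interpolant: let $\mathcal N(\tau)=\{k\in\{1,\dots,N(\tau)\}:t_k-t_{k-1}>0\}\cup\{0,\hat N(\tau)\}$ and enumerate its elements increasingly as $0=\mathfrak k(0)<\mathfrak k(1)<\dots<\mathfrak k(J)=\hat N(\tau)$; thus $\mathfrak k(J-1)=N(\tau)$. For $t\in[t_{\mathfrak k(j-1)},t_{\mathfrak k(j)})$, $1\le j\le J-1$, set $$\tilde z_\tau(t)=z_{\mathfrak k(j)}+\frac{t-t_{\mathfrak k(j-1)}}{t_{\mathfrak k(j)}-t_{\mathfrak k(j-1)}}\,(z_{\mathfrak k(j+1)}-z_{\mathfrak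 k(j)}),\qquad \tilde z_\tau(T)=z_{\hat N(\tau)}.$$ *)

theory Defs
  imports "HOL-Analysis.Analysis"
begin

definition fderiv ::
    "('a::real_normed_vector \<Rightarrow> 'b::real_normed_vector) \<Rightarrow> 'a \<Rightarrow> 'a \<Rightarrow>\<^sub>L 'b" where
  "fderiv f x = Blinfun (frechet_derivative f (at x))"

definition C1_map :: "('a::real_normed_vector \<Rightarrow> 'b::real_normed_vector) \<Rightarrow> bool" where
  "C1_map f \<longleftrightarrow> (\<forall>x. f differentiable (at x)) \<and> continuous_on UNIV (fderiv f)"

definition C2_map :: "('a::real_normed_vector \<Rightarrow> 'b::real_normed_vector) \<Rightarrow> bool" where
  "C2_map f \<longleftrightarrow> C1_map f \<and> C1_map (fderiv f)"

definition lower_semicont :: "('a::topological_space \<Rightarrow> real) \<Rightarrow> bool" where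
  "lower_semicont f \<longleftrightarrow> (\<forall>x. \<forall>c < f x. \<forall>\<^sub>F y in nhds x. c < f y)"

(* Embeddings are injective bounded linear maps; here \<open>i\<close> is the embedding of \<open>Z\<close> into \<open>V\<close>.
   Dual spaces are the spaces of bounded linear functionals with the operator norm. *)

definition dense_compact_embedding ::
    "('z::real_normed_vector \<Rightarrow>\<^sub>L 'v::real_normed_vector) \<Rightarrow> bool" where
  "dense_compact_embedding i \<longleftrightarrow>
     inj (blinfun_apply i) \<and> closure (range (blinfun_apply i)) = UNIV \<and>
     compact (closure (blinfun_apply i ` cball 0 1))"

definition energy ::
    "('z::real_normed_vector \<Rightarrow>\<^sub>L 'v::real_normed_vector) \<Rightarrow> ('z \<Rightarrow>\<^sub>L ('z \<Rightarrow>\<^sub>L real)) \<Rightarrow> ('z \<Rightarrow> real)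
      \<Rightarrow> (real \<Rightarrow> 'v \<Rightarrow>\<^sub>L real) \<Rightarrow> real \<Rightarrow> 'z \<Rightarrow> real" where
  "energy i A F ell t z = 1 / 2 * A z z + F z - ell t (i z)"

(* The inclusion of 0 in the sum of the subdifferential of \<open>R\<close> at \<open>w\<close> and \<open>\<xi>\<close>. *)

definition subdiff_incl ::
    "('z::real_normed_vector \<Rightarrow>\<^sub>L 'v::real_normed_vector) \<Rightarrow> ('v \<Rightarrow> real)
      \<Rightarrow> 'z \<Rightarrow> ('z \<Rightarrow>\<^sub>L real) \<Rightarrow> bool" where
  "subdiff_incl i R w \<xi> \<longleftrightarrow> (\<forall>v. R (i v) \<ge> R (i w) - \<xi> (v - w))"

(* Bochner integrability: strongly measurable with integrable norm.  The library's Bochner integral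
   is not used because it is restricted to second countable spaces. *)

definition bochner_integrable_on :: "(real \<Rightarrow> 'b::real_normed_vector) \<Rightarrow> real set \<Rightarrow> bool" where
  "bochner_integrable_on f S \<longleftrightarrow>
     (\<exists>s. (\<forall>n. simple_function (lebesgue_on S) (s n)) \<and>
          (AE t in lebesgue_on S. (\<lambda>n. s n t) \<longlonglongrightarrow> f t)) \<and>
     integrable (lebesgue_on S) (\<lambda>t. norm (f t))"

(* \<open>z\<close> is (the continuous representative of) an element of \<open>W\<^sup>1\<^sup>,\<^sup>1\<close> on \<open>(0,T)\<close> with weak derivative
   \<open>z'\<close>, i.e. an indefinite Bochner integral of \<open>z'\<close>.  For Bochner integrable functions with values
   in a Banach space the gauge integral \<open>has_integral\<close> is the Bochner integral. *)

definition W11_with_deriv :: "real \<Rightarrow> (real \<Rightarrow> 'b::real_normed_vector) \<Rightarrow> (real \<Rightarrow> 'b) \<Rightarrow> bool" where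
  "W11_with_deriv T z z' \<longleftrightarrow>
     bochner_integrable_on z' {0..T} \<and> (\<forall>t\<in>{0..T}. (z' has_integral (z t - z 0)) {0..t})"

definition differential_solution ::
    "real \<Rightarrow> ('z::real_normed_vector \<Rightarrow>\<^sub>L 'v::real_normed_vector) \<Rightarrow> (real \<Rightarrow> 'z \<Rightarrow> real)
      \<Rightarrow> ('v \<Rightarrow> real) \<Rightarrow> 'z \<Rightarrow> (real \<Rightarrow> 'z) \<Rightarrow> bool" where
  "differential_solution T i I R z0 z \<longleftrightarrow>
     z 0 = z0 \<and>
     (\<exists>z'. W11_with_deriv T z z' \<and>
           (AE t in lebesgue_on {0..T}. subdiff_incl i R (z' t) (fderiv (I t) (z t))))"

(* \<open>zs\<close> and \<open>ts\<close> are the iterates and times of one run of the scheme; past the first index with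
   \<open>ts k = T\<close> the recursion keeps \<open>ts k = T\<close>, because the increments are at most \<open>\<tau>\<close>. *)

definition local_min_scheme ::
    "real \<Rightarrow> ('z::real_normed_vector \<Rightarrow>\<^sub>L 'v::real_normed_vector) \<Rightarrow> (real \<Rightarrow> 'z \<Rightarrow> real)
      \<Rightarrow> ('v \<Rightarrow> real) \<Rightarrow> 'z \<Rightarrow> real \<Rightarrow> (nat \<Rightarrow> real) \<Rightarrow> (nat \<Rightarrow> 'z) \<Rightarrow> bool" where
  "local_min_scheme T i I R z0 \<tau> ts zs \<longleftrightarrow>
     ts 0 = 0 \<and> zs 0 = z0 \<and>
     (\<forall>k. is_arg_min (\<lambda>z. I (ts k) z + R (i (z - zs k)))
                     (\<lambda>z. norm (i (z - zs k)) \<le> \<tau>) (zs (Suc k)) \<and>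
          ts (Suc k) = min (ts k + \<tau> - norm (i (zs (Suc k) - zs k))) T)"

definition final_index :: "real \<Rightarrow> (nat \<Rightarrow> real) \<Rightarrow> nat" where
  "final_index T ts = (LEAST k. ts k = T)"

definition stable_index ::
    "real \<Rightarrow> ('z::real_normed_vector \<Rightarrow>\<^sub>L 'v::real_normed_vector) \<Rightarrow> (real \<Rightarrow> 'z \<Rightarrow> real)
      \<Rightarrow> ('v \<Rightarrow> real) \<Rightarrow> (nat \<Rightarrow> real) \<Rightarrow> (nat \<Rightarrow> 'z) \<Rightarrow> nat" where
  "stable_index T i I R ts zs =
     (LEAST k. final_index T ts < k \<and> subdiff_incl i R 0 (fderiv (I T) (zs k)))"

definition progress_indices :: "nat \<Rightarrow> nat \<Rightarrow> (nat \<Rightarrow> real) \<Rightarrow> nat set" where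
  "progress_indices N N' ts = {k \<in> {1..N}. ts k - ts (k - 1) > 0} \<union> {0, N'}"

definition affine_interpolant ::
    "real \<Rightarrow> ('z::real_normed_vector \<Rightarrow>\<^sub>L 'v::real_normed_vector) \<Rightarrow> (real \<Rightarrow> 'z \<Rightarrow> real)
      \<Rightarrow> ('v \<Rightarrow> real) \<Rightarrow> (nat \<Rightarrow> real) \<Rightarrow> (nat \<Rightarrow> 'z) \<Rightarrow> real \<Rightarrow> 'z" where
  "affine_interpolant T i I R ts zs t =
     (let N = final_index T ts;
          N' = stable_index T i I R ts zs;
          S = progress_indices N N' ts;
          J = card S - 1;
          \<kk> = (\<lambda>j. sorted_list_of_set S ! j)
      in if t = T then zs N'
         else let j = (THE j. 1 \<le> j \<and> j \<le> J - 1 \<and> ts (\<kk> (j - 1)) \<le> t \<and> t < ts (\<kk> j))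
              in zs (\<kk> j) + ((t - ts (\<kk> (j - 1))) / (ts (\<kk> j) - ts (\<kk> (j - 1))))
                              *\<^sub>R (zs (\<kk> (j + 1)) - zs (\<kk> j)))"

end

theory Submission
  imports Defs
begin

text \<open>
  Writing \<open>h t v = R v + \<langle>D I(t, u t), v\<rangle>\<close>, a curve \<open>u\<close> is a solution iff \<open>h t \<ge> 0\<close> (stability) and
  \<open>h t (u' t) \<le> 0\<close>.  If both hold up to \<open>\<epsilon>\<close> for two curves, testing one with the derivative of the
  other bounds \<open>\<langle>DI(t, u1) - DI(t, u2), u1' - u2'\<rangle>\<close> by a multiple of \<open>\<epsilon>\<close>.  Since the second derivative is
  symmetric and locally Lipschitz, Gronwall's inequality applies to
  \<open>\<gamma> = \<langle>DI(t, u1) - DI(t, u2), u1 - u2\<rangle> \<ge> \<kappa> \<parallel>u1 - u2\<parallel>\<^sup>2\<close>, and the distance is of order \<open>sqrt \<epsilon>\<close>.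

  For the scheme, the multipliers \<open>\<mu> k\<close> of the constraint satisfy
  \<open>\<kappa> \<parallel>z (k+1) - z k\<parallel> + \<mu> (k+1) \<le> \<mu> k + L (t k - t (k-1))\<close> and vanish whenever time progresses.
  Telescoping over the steps between two progress indices shows that the interpolant is Lipschitz
  with a constant independent of \<open>\<tau>\<close> and solves the problem up to a multiple of \<open>\<tau>\<close>.  The same estimate for
  unconstrained incremental minimizers gives a Cauchy sequence of interpolants and thereby the
  solution; its derivative is the almost everywhere limit of dyadic difference quotients, which
  converge in \<open>L\<^sup>2\<close> as a bounded martingale.
\<close>

section \<open>Gauge integrals of Banach space valued functions\<close>

text \<open>The central notion speaks of increments \<open>u b - u a\<close> and never of
  \<open>u'\<close>, so that piecewise affine curves, pointwise limits and W11 curves all fall under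
  one comparison. Increments are controlled by a function \<open>M\<close> rather than by a
  Lipschitz constant, because a competitor in the uniqueness claim is merely W11. Stability up to
  \<epsilon> is measured relative to the norm of the test vector; tested with an increment it costs
  \<epsilon> times the increment of \<open>M\<close>, which is the form that Gronwall's inequality
  needs. Two circumstances shape the discrete part. An iterate is computed with the load of the
  preceding time, so an iterate with zero multiplier is stable at that earlier time; this accounts
  for the index shift in the interpolant and for the extra last node. Moreover the constraint is
  posed in V while convexity acts in Z; the estimate of one step is divided by the V norm of the
  increment, which works because the embedding has norm at most one. The iterates and the
  constructed solution stay in one ball of radius \<open>norm z0 + L / \<kappa> * T\<close>, so the
  local constants of the energy do not see \<tau>.\<close>

lemma sublinear_integral_le:
  fixes f :: "real \<Rightarrow> 'a::real_normed_vector" and \<phi> :: "'a \<Rightarrow> real"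
  assumes sub: "\<And>x y. \<phi> (x + y) \<le> \<phi> x + \<phi> y"
    and hom: "\<And>c x. c \<ge> 0 \<Longrightarrow> \<phi> (c *\<^sub>R x) = c * \<phi> x"
    and bnd: "\<And>x. \<phi> x \<le> \<rho> * norm x"
    and f: "(f has_integral I) {a..b}" and \<psi>: "(\<psi> has_integral J) {a..b}"
    and N: "negligible N" and le: "\<And>x. x \<in> {a..b} - N \<Longrightarrow> \<phi> (f x) \<le> \<psi> x"
  shows "\<phi> I \<le> J"
proof -
  \<comment> \<open>Zeroing both functions on \<open>N\<close> makes the bound hold at every tag of
    a division, because \<open>\<phi> 0 = 0\<close>.\<close>
  define f' where "f' x = (if x \<in> N then 0 else f x)" for x
  define \<psi>' where "\<psi>' x = (if x \<in> N then 0 else \<psi> x)" for x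
  have \<phi>0: "\<phi> 0 = 0" using hom[of 0 0] by simp
  have f': "(f' has_integral I) {a..b}"
    by (rule has_integral_spike[OF N _ f]) (auto simp: f'_def)
  have \<psi>': "(\<psi>' has_integral J) {a..b}"
    by (rule has_integral_spike[OF N _ \<psi>]) (auto simp: \<psi>'_def)
  have le': "\<phi> (f' x) \<le> \<psi>' x" if "x \<in> {a..b}" for x
    using le[of x] that \<phi>0 by (auto simp: f'_def \<psi>'_def)
  have \<phi>_sum: "\<phi> (sum g A) \<le> (\<Sum>x\<in>A. \<phi> (g x))" if "finite A" for A :: "(real \<times> real set) set" and g
    using that by (induction A rule: finite_induct) (auto simp: \<phi>0 intro: order_trans[OF sub])
  show ?thesis
  proof (rule field_le_epsilon)
    fix e :: real assume e: "e > 0"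
    \<comment> \<open>The errors are \<open>\<bar>\<rho>\<bar> * d\<close> from the sum for
      \<open>f'\<close> and \<open>d\<close> from the sum for \<open>\<psi>'\<close>; together they
      make \<open>e\<close>.\<close>
    define d where "d = e / (\<bar>\<rho>\<bar> + 1)"
    have d: "d > 0" and d_e: "(\<bar>\<rho>\<bar> + 1) * d = e"
      using e by (auto simp: d_def)
    obtain \<gamma>1 where \<gamma>1: "gauge \<gamma>1 \<and> (\<forall>\<D>. \<D> tagged_division_of {a..b} \<and> \<gamma>1 fine \<D> \<longrightarrow>
        norm (sum (\<lambda>(x,k). measure lborel k *\<^sub>R f' x) \<D> - I) < d)"
      using has_integral_real[THEN iffD1, rule_format, OF f' d] by (rule exE)
    obtain \<gamma>2 where \<gamma>2: "gauge \<gamma>2 \<and> (\<forall>\<D>. \<D> tagged_division_of {a..b} \<and> \<gamma>2 fine \<D> \<longrightarrow>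
        norm (sum (\<lambda>(x,k). measure lborel k *\<^sub>R \<psi>' x) \<D> - J) < d)"
      using has_integral_real[THEN iffD1, rule_format, OF \<psi>' d] by (rule exE)
    obtain p where p: "p tagged_division_of {a..b}" "(\<lambda>x. \<gamma>1 x \<inter> \<gamma>2 x) fine p"
      using fine_division_exists_real[OF gauge_Int[OF \<gamma>1[THEN conjunct1] \<gamma>2[THEN conjunct1]]] by blast
    let ?S = "sum (\<lambda>(x,k). measure lborel k *\<^sub>R f' x) p"
    have fin: "finite p" using p(1) by blast
    have 1: "norm (?S - I) < d" and 2: "\<bar>sum (\<lambda>(x,k). measure lborel k * \<psi>' x) p - J\<bar> < d"
      using \<gamma>1[THEN conjunct2, rule_format, of p] \<gamma>2[THEN conjunct2, rule_format, of p] p by (auto simp: fine_Int)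
    \<comment> \<open>Sublinearity passes from single terms to the Riemann sum \<open>?S\<close>,
      and the linear bound makes the remainder small.\<close>
    have "\<phi> I \<le> \<phi> (I - ?S) + \<phi> ?S"
      using sub[of "I - ?S" ?S] by simp
    also have "\<phi> (I - ?S) \<le> \<bar>\<rho>\<bar> * d"
    proof -
      have "\<phi> (I - ?S) \<le> \<rho> * norm (I - ?S)" by (rule bnd)
      also have "\<dots> \<le> \<bar>\<rho>\<bar> * d"
        by (rule mult_mono) (use 1 in \<open>auto simp: norm_minus_commute\<close>)
      finally show ?thesis .
    qed
    also have "\<phi> ?S \<le> (\<Sum>(x,k)\<in>p. \<phi> (measure lborel k *\<^sub>R f' x))"
      using \<phi>_sum[OF fin, of "\<lambda>(x,k). measure lborel k *\<^sub>R f' x"] by (simp add: case_prod_unfold)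
    also have "\<dots> \<le> (\<Sum>(x,k)\<in>p. measure lborel k * \<psi>' x)"
    proof (rule sum_mono)
      fix y assume y: "y \<in> p"
      obtain x k where [simp]: "y = (x, k)" by fastforce
      have "x \<in> {a..b}" using tagged_division_ofD(2,3)[OF p(1), of x k] y by auto
      then show "(case y of (x, k) \<Rightarrow> \<phi> (measure lborel k *\<^sub>R f' x)) \<le> (case y of (x, k) \<Rightarrow> measure lborel k * \<psi>' x)"
        using le' by (simp add: hom mult_left_mono)
    qed
    also have "\<dots> \<le> J + d" using 2 by simp
    finally show "\<phi> I \<le> J + e" using d_e by (simp add: algebra_simps)
  qed
qed

text \<open>A Riemann sum of \<open>g\<close> differs from that of \<open>f n\<close> by at most the
  Riemann sum of \<open>norm (g - f n)\<close>, which is close to the small number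
  \<open>d n\<close>. Integrability of the limit is a conclusion here; the limit of the dyadic
  slopes gets its integral this way.\<close>

lemma has_integral_L1_limit:
  fixes f :: "nat \<Rightarrow> real \<Rightarrow> 'a::real_normed_vector"
  assumes f: "\<And>n. (f n has_integral I n) {a..b}" and I: "I \<longlonglongrightarrow> l"
    and d: "\<And>n. ((\<lambda>t. norm (g t - f n t)) has_integral d n) {a..b}" and d0: "d \<longlonglongrightarrow> 0"
  shows "(g has_integral l) {a..b}"
  unfolding has_integral_real
proof (intro allI impI)
  fix e :: real assume e: "e > 0"
  then have e4: "e / 4 > 0" by simp
  have "\<forall>\<^sub>F n in sequentially. norm (I n - l) < e / 4 \<and> norm (d n - 0) < e / 4"
    using tendstoD[OF I e4] tendstoD[OF d0 e4] by (intro eventually_conj) (simp_all add: dist_norm)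
  then obtain n where n: "norm (I n - l) < e / 4" "\<bar>d n\<bar> < e / 4"
    by (auto simp: eventually_sequentially)
  obtain \<gamma>1 where \<gamma>1: "gauge \<gamma>1 \<and> (\<forall>\<D>. \<D> tagged_division_of {a..b} \<and> \<gamma>1 fine \<D> \<longrightarrow>
        norm (sum (\<lambda>(x,k). measure lborel k *\<^sub>R f n x) \<D> - I n) < e / 4)"
      using has_integral_real[THEN iffD1, rule_format, OF f[of n] e4] by (rule exE)
  obtain \<gamma>2 where \<gamma>2: "gauge \<gamma>2 \<and> (\<forall>\<D>. \<D> tagged_division_of {a..b} \<and> \<gamma>2 fine \<D> \<longrightarrow>
        norm (sum (\<lambda>(x,k). measure lborel k *\<^sub>R norm (g x - f n x)) \<D> - d n) < e / 4)"
      using has_integral_real[THEN iffD1, rule_format, OF d[of n] e4] by (rule exE)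
  show "\<exists>\<gamma>. gauge \<gamma> \<and> (\<forall>\<D>. \<D> tagged_division_of {a..b} \<and> \<gamma> fine \<D> \<longrightarrow>
      norm (sum (\<lambda>(x,k). measure lborel k *\<^sub>R g x) \<D> - l) < e)"
  proof (intro exI conjI allI impI)
    show "gauge (\<lambda>x. \<gamma>1 x \<inter> \<gamma>2 x)" using \<gamma>1 \<gamma>2 by blast
    fix p assume p: "p tagged_division_of {a..b} \<and> (\<lambda>x. \<gamma>1 x \<inter> \<gamma>2 x) fine p"
    let ?S = "sum (\<lambda>(x,k). measure lborel k *\<^sub>R f n x) p" and ?G = "sum (\<lambda>(x,k). measure lborel k *\<^sub>R g x) p"
    have 1: "norm (?S - I n) < e / 4"
      using \<gamma>1[THEN conjunct2, rule_format, of p] p by (auto simp: fine_Int)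
    have 2: "\<bar>sum (\<lambda>(x,k). measure lborel k * norm (g x - f n x)) p - d n\<bar> < e / 4"
      using \<gamma>2[THEN conjunct2, rule_format, of p] p by (auto simp: fine_Int)
    have "?G - ?S = (\<Sum>(x,k)\<in>p. measure lborel k *\<^sub>R (g x - f n x))"
      by (simp add: case_prod_unfold scaleR_diff_right sum_subtractf)
    then have "norm (?G - ?S) \<le> (\<Sum>y\<in>p. norm (case y of (x,k) \<Rightarrow> measure lborel k *\<^sub>R (g x - f n x)))"
      by (simp only:) (rule norm_sum)
    also have "\<dots> = sum (\<lambda>(x,k). measure lborel k * norm (g x - f n x)) p"
      by (rule sum.cong) auto
    finally have 3: "norm (?G - ?S) < e / 2" using 2 n(2) by linarith
    have "norm (?G - l) \<le> norm (?G - ?S) + norm (?S - l)"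
      using norm_triangle_ineq[of "?G - ?S" "?S - l"] by simp
    also have "norm (?S - l) \<le> norm (?S - I n) + norm (I n - l)"
      using norm_triangle_ineq[of "?S - I n" "I n - l"] by simp
    finally show "norm (?G - l) < e" using 1 3 n(1) by linarith
  qed
qed

lemma has_integral_step_piece:
  fixes F :: "nat \<Rightarrow> 'a::real_normed_vector"
  assumes h: "h > 0" and s: "real n * h \<le> s" "s \<le> t" "t \<le> real (Suc n) * h"
  shows "((\<lambda>x. F (nat \<lfloor>x / h\<rfloor>)) has_integral (t - s) *\<^sub>R F n) {s..t}"
proof (rule has_integral_spike_finite[of "{real (Suc n) * h}" _ _ "\<lambda>_. F n"])
  show "((\<lambda>_. F n) has_integral (t - s) *\<^sub>R F n) {s..t}"
    using has_integral_const_real[of "F n" s t] s by simp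
  fix x assume x: "x \<in> {s..t} - {real (Suc n) * h}"
  then have "real n * h \<le> x" "x < real (Suc n) * h" using s by auto
  then have "real n \<le> x / h" "x / h < real n + 1"
    using h by (simp_all add: field_simps)
  then have "\<lfloor>x / h\<rfloor> = int n" by linarith
  then show "F (nat \<lfloor>x / h\<rfloor>) = F n" by simp
qed simp

lemma has_integral_step:
  fixes F :: "nat \<Rightarrow> 'a::banach"
  assumes h: "h > 0" and t: "real n * h \<le> t" "t \<le> real (Suc n) * h"
  shows "((\<lambda>x. F (nat \<lfloor>x / h\<rfloor>)) has_integral (\<Sum>k<n. h *\<^sub>R F k) + (t - real n * h) *\<^sub>R F n) {0..t}"
  using t
proof (induction n arbitrary: t)
  case 0
  then show ?case using has_integral_step_piece[of h 0 0 t F] h by simp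
next
  case (Suc n)
  have "((\<lambda>x. F (nat \<lfloor>x / h\<rfloor>)) has_integral (\<Sum>k<n. h *\<^sub>R F k) + (real (Suc n) * h - real n * h) *\<^sub>R F n)
      {0..real (Suc n) * h}"
    by (rule Suc.IH) (use h in \<open>auto simp: algebra_simps\<close>)
  then have 1: "((\<lambda>x. F (nat \<lfloor>x / h\<rfloor>)) has_integral (\<Sum>k<Suc n. h *\<^sub>R F k)) {0..real (Suc n) * h}"
    by (simp add: algebra_simps)
  have 2: "((\<lambda>x. F (nat \<lfloor>x / h\<rfloor>)) has_integral (t - real (Suc n) * h) *\<^sub>R F (Suc n)) {real (Suc n) * h..t}"
    by (rule has_integral_step_piece) (use Suc.prems h in auto)
  show ?case
    by (rule has_integral_combine[OF _ _ 1 2]) (use Suc.prems h in auto)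
qed

section \<open>Derivatives of Lipschitz curves in Hilbert spaces\<close>

definition dyadic_quotient :: "(real \<Rightarrow> 'a::real_normed_vector) \<Rightarrow> real \<Rightarrow> nat \<Rightarrow> nat \<Rightarrow> 'a" where
  "dyadic_quotient z T n k =
     (2 ^ n / T) *\<^sub>R (z (real (Suc k) * (T / 2 ^ n)) - z (real k * (T / 2 ^ n)))"

text \<open>This is the conditional expectation of the derivative with respect to the
  \<open>n\<close>-th dyadic partition of [0,T]. At \<open>t = T\<close> the index is
  \<open>2 ^ n\<close> and the cell lies to the right of \<open>T\<close>, hence the Lipschitz
  assumptions on \<open>UNIV\<close> below.\<close>

definition dyadic_slope :: "(real \<Rightarrow> 'a::real_normed_vector) \<Rightarrow> real \<Rightarrow> nat \<Rightarrow> real \<Rightarrow> 'a" where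
  "dyadic_slope z T n t = dyadic_quotient z T n (nat \<lfloor>t / (T / 2 ^ n)\<rfloor>)"

lemma dyadic_quotient_midpoint:
  assumes "T > 0"
  shows "dyadic_quotient z T n k =
    (1 / 2) *\<^sub>R (dyadic_quotient z T (Suc n) (2 * k) + dyadic_quotient z T (Suc n) (2 * k + 1))"
proof -
  have e: "real (2 * k) * (T / 2 ^ Suc n) = real k * (T / 2 ^ n)"
    "real (Suc (2 * k + 1)) * (T / 2 ^ Suc n) = real (Suc k) * (T / 2 ^ n)"
    "Suc (2 * k) = 2 * k + 1" "(1 / 2) * (2 ^ Suc n / T) = 2 ^ n / T"
    by (simp_all add: field_simps)
  show ?thesis
    unfolding dyadic_quotient_def scaleR_add_right[symmetric] scaleR_scaleR e by simp
qed

lemma norm_dyadic_quotient_le: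
  assumes "T > 0" "\<Lambda>-lipschitz_on UNIV z"
  shows "norm (dyadic_quotient z T n k) \<le> \<Lambda>"
proof -
  have "norm (z (real (Suc k) * (T / 2 ^ n)) - z (real k * (T / 2 ^ n))) \<le> \<Lambda> * \<bar>real (Suc k) * (T / 2 ^ n) - real k * (T / 2 ^ n)\<bar>"
    using lipschitz_onD[OF assms(2), of "real (Suc k) * (T / 2 ^ n)" "real k * (T / 2 ^ n)"]
    unfolding dist_norm real_norm_def by blast
  also have "real (Suc k) * (T / 2 ^ n) - real k * (T / 2 ^ n) = T / 2 ^ n"
    by (simp only: of_nat_Suc ring_distribs)
  also have "\<Lambda> * \<bar>T / 2 ^ n\<bar> = \<Lambda> * (T / 2 ^ n)" using assms(1) by simp
  finally have "2 ^ n / T * norm (z (real (Suc k) * (T / 2 ^ n)) - z (real k * (T / 2 ^ n))) \<le> 2 ^ n / T * (\<Lambda> * (T / 2 ^ n))"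
    by (rule mult_left_mono) (use assms(1) in auto)
  then show ?thesis
    using assms(1) by (simp add: dyadic_quotient_def)
qed

lemma dyadic_index_coarsen:
  fixes T t :: real
  assumes "T > 0" "t \<ge> 0"
  shows "nat \<lfloor>t / (T / 2 ^ n)\<rfloor> = nat \<lfloor>t / (T / 2 ^ (n + j))\<rfloor> div 2 ^ j"
proof -
  have "t / (T / 2 ^ n) = (t / (T / 2 ^ (n + j))) / of_int (2 ^ j)"
    by (simp add: power_add divide_divide_eq_left divide_divide_eq_right)
  then have "\<lfloor>t / (T / 2 ^ n)\<rfloor> = \<lfloor>t / (T / 2 ^ (n + j))\<rfloor> div 2 ^ j"
    using floor_divide_real_eq_div[of "2 ^ j" "t / (T / 2 ^ (n + j))"] by (simp only:) simp
  moreover have "nat (\<lfloor>t / (T / 2 ^ (n + j))\<rfloor> div 2 ^ j) = nat \<lfloor>t / (T / 2 ^ (n + j))\<rfloor> div nat (2 ^ j)"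
    by (rule nat_div_distrib) (use assms in simp)
  ultimately show ?thesis by (simp only: nat_power_eq) (simp add: nat_power_eq)
qed

lemma sum_double: "(\<Sum>k<2 * n. f k) = (\<Sum>k<n. f (2 * k) + f (2 * k + 1))" for f :: "nat \<Rightarrow> 'a::comm_monoid_add"
  by (induction n) (auto simp: algebra_simps)

text \<open>The squared L2 norm of the level \<open>n\<close> slope over [0,T]. It increases with
  \<open>n\<close> and stays bounded for a Lipschitz curve.\<close>

definition dyadic_energy :: "(real \<Rightarrow> 'a::real_normed_vector) \<Rightarrow> real \<Rightarrow> nat \<Rightarrow> real" where
  "dyadic_energy z T n = (\<Sum>k<2 ^ n. T / 2 ^ n * (norm (dyadic_quotient z T n k))\<^sup>2)"

text \<open>The dyadic slopes form a martingale: refinements are orthogonal to coarser levels, so the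
  squared \<open>L\<^sup>2\<close>-distance of two levels is the difference of their energies.\<close>

lemma dyadic_energy_difference:
  fixes z :: "real \<Rightarrow> 'a::real_inner"
  assumes T: "T > 0"
  shows "(\<Sum>k<2 ^ (n + j). T / 2 ^ (n + j) *
      (norm (dyadic_quotient z T (n + j) k - dyadic_quotient z T n (k div 2 ^ j)))\<^sup>2)
    = dyadic_energy z T (n + j) - dyadic_energy z T n"
proof (induction j)
  case 0
  then show ?case by simp
next
  case (Suc j)
  let ?G = "dyadic_quotient z T"
  let ?h = "T / 2 ^ (n + j)"
  \<comment> \<open>Parallelogram law for \<open>p - c\<close>, \<open>q - c\<close> and for
    \<open>p\<close>, \<open>q\<close>: the contributions of \<open>p - q\<close> agree and cancel
    in the difference.\<close>
  have par: "T / 2 ^ (n + Suc j) * (norm (p - c))\<^sup>2 + T / 2 ^ (n + Suc j) * (norm (q - c))\<^sup>2 =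
      ?h * (norm ((1 / 2) *\<^sub>R (p + q) - c))\<^sup>2
      + (T / 2 ^ (n + Suc j) * (norm p)\<^sup>2 + T / 2 ^ (n + Suc j) * (norm q)\<^sup>2)
      - ?h * (norm ((1 / 2) *\<^sub>R (p + q)))\<^sup>2" for p q c :: 'a
  proof -
    have *: "u * (norm (p - c))\<^sup>2 + u * (norm (q - c))\<^sup>2 =
      2 * u * (norm ((1 / 2) *\<^sub>R (p + q) - c))\<^sup>2 + (u * (norm p)\<^sup>2 + u * (norm q)\<^sup>2)
      - 2 * u * (norm ((1 / 2) *\<^sub>R (p + q)))\<^sup>2" for u
      by (simp add: power2_norm_eq_inner inner_add_left inner_add_right inner_diff_left
          inner_diff_right inner_commute algebra_simps)
    have "?h = 2 * (T / 2 ^ (n + Suc j))" by simp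
    then show ?thesis using *[of "T / 2 ^ (n + Suc j)"] by (simp only:)
  qed
  have dv: "(2 * k) div 2 ^ Suc j = k div 2 ^ j" "(2 * k + 1) div 2 ^ Suc j = k div 2 ^ j" for k :: nat
    by (simp_all add: div_mult2_eq)
  have "(\<Sum>k<2 ^ (n + Suc j). T / 2 ^ (n + Suc j) * (norm (?G (n + Suc j) k - ?G n (k div 2 ^ Suc j)))\<^sup>2)
     = (\<Sum>k<2 ^ (n + j). T / 2 ^ (n + Suc j) * (norm (?G (n + Suc j) (2 * k) - ?G n (k div 2 ^ j)))\<^sup>2
         + T / 2 ^ (n + Suc j) * (norm (?G (n + Suc j) (2 * k + 1) - ?G n (k div 2 ^ j)))\<^sup>2)"
    using sum_double[of "\<lambda>k. T / 2 ^ (n + Suc j) * (norm (?G (n + Suc j) k - ?G n (k div 2 ^ Suc j)))\<^sup>2" "2 ^ (n + j)"]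
    by (simp only: dv) simp
  also have "\<dots> = (\<Sum>k<2 ^ (n + j). ?h * (norm (?G (n + j) k - ?G n (k div 2 ^ j)))\<^sup>2
      + (T / 2 ^ (n + Suc j) * (norm (?G (n + Suc j) (2 * k)))\<^sup>2 + T / 2 ^ (n + Suc j) * (norm (?G (n + Suc j) (2 * k + 1)))\<^sup>2)
      - ?h * (norm (?G (n + j) k))\<^sup>2)"
    by (rule sum.cong[OF refl], subst par)
      (simp add: dyadic_quotient_midpoint[OF T, of z "n + j"])
  also have "\<dots> = (dyadic_energy z T (n + j) - dyadic_energy z T n)
      + (\<Sum>k<2 ^ (n + j). T / 2 ^ (n + Suc j) * (norm (?G (n + Suc j) (2 * k)))\<^sup>2 + T / 2 ^ (n + Suc j) * (norm (?G (n + Suc j) (2 * k + 1)))\<^sup>2)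
      - dyadic_energy z T (n + j)"
    by (simp only: sum.distrib sum_subtractf Suc.IH) (simp add: dyadic_energy_def)
  also have "(\<Sum>k<2 ^ (n + j). T / 2 ^ (n + Suc j) * (norm (?G (n + Suc j) (2 * k)))\<^sup>2 + T / 2 ^ (n + Suc j) * (norm (?G (n + Suc j) (2 * k + 1)))\<^sup>2)
     = dyadic_energy z T (n + Suc j)"
    unfolding dyadic_energy_def
    using sum_double[of "\<lambda>k. T / 2 ^ (n + Suc j) * (norm (?G (n + Suc j) k))\<^sup>2" "2 ^ (n + j)"] by simp
  finally show ?case by simp
qed

lemma dyadic_energy_le:
  assumes "T > 0" "\<Lambda>-lipschitz_on UNIV z"
  shows "dyadic_energy z T n \<le> T * \<Lambda>\<^sup>2"
proof -
  have "dyadic_energy z T n \<le> (\<Sum>k<(2::nat) ^ n. T / 2 ^ n * \<Lambda>\<^sup>2)"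
    unfolding dyadic_energy_def
    by (intro sum_mono mult_left_mono power_mono norm_dyadic_quotient_le assms) (use assms(1) in auto)
  then show ?thesis by simp
qed

text \<open>Both slopes are constant on a cell of level \<open>n + j\<close>. The function \<phi>
  will be the squared norm for the martingale estimate and the norm for L1 convergence.\<close>

lemma has_integral_dyadic_slope_diff:
  fixes \<phi> :: "'a::real_normed_vector \<Rightarrow> real"
  assumes T: "T > 0"
  shows "((\<lambda>t. \<phi> (dyadic_slope z T (n + j) t - dyadic_slope z T n t)) has_integral
     (\<Sum>k<2 ^ (n + j). T / 2 ^ (n + j) * \<phi> (dyadic_quotient z T (n + j) k - dyadic_quotient z T n (k div 2 ^ j)))) {0..T}"
proof -
  let ?F = "\<lambda>k. \<phi> (dyadic_quotient z T (n + j) k - dyadic_quotient z T n (k div 2 ^ j))"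
  have "((\<lambda>t. ?F (nat \<lfloor>t / (T / 2 ^ (n + j))\<rfloor>)) has_integral (\<Sum>k<2 ^ (n + j). (T / 2 ^ (n + j)) *\<^sub>R ?F k)
      + (T - real (2 ^ (n + j)) * (T / 2 ^ (n + j))) *\<^sub>R ?F (2 ^ (n + j))) {0..T}"
  proof (rule has_integral_step[where F = ?F])
    have "real (2 ^ (n + j)) * (T / 2 ^ (n + j)) = T" by simp
    moreover have "real (2 ^ (n + j)) * (T / 2 ^ (n + j)) \<le> real (Suc (2 ^ (n + j))) * (T / 2 ^ (n + j))"
      by (rule mult_right_mono) (use T in auto)
    ultimately show "real (2 ^ (n + j)) * (T / 2 ^ (n + j)) \<le> T"
      "T \<le> real (Suc (2 ^ (n + j))) * (T / 2 ^ (n + j))" by linarith+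
  qed (use T in simp)
  moreover have "T - real (2 ^ (n + j)) * (T / 2 ^ (n + j)) = 0" by simp
  ultimately have "((\<lambda>t. ?F (nat \<lfloor>t / (T / 2 ^ (n + j))\<rfloor>)) has_integral (\<Sum>k<2 ^ (n + j). T / 2 ^ (n + j) * ?F k)) {0..T}"
    by (simp only: scaleR_zero_left add_0_right real_scaleR_def mult_zero_left)
  then show ?thesis
    by (rule has_integral_eq[rotated])
      (simp only: dyadic_slope_def dyadic_index_coarsen[OF T, of _ n j] atLeastAtMost_iff)
qed

lemma nat_floor_divide_bounds:
  fixes t h :: real
  assumes "h > 0" "t \<ge> 0"
  shows "real (nat \<lfloor>t / h\<rfloor>) * h \<le> t" "t < real (Suc (nat \<lfloor>t / h\<rfloor>)) * h"
proof -
  have "t / h \<ge> 0" using assms by simp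
  then have "real (nat \<lfloor>t / h\<rfloor>) \<le> t / h" "t / h < real (Suc (nat \<lfloor>t / h\<rfloor>))"
    by linarith+
  then show "real (nat \<lfloor>t / h\<rfloor>) * h \<le> t" "t < real (Suc (nat \<lfloor>t / h\<rfloor>)) * h"
    by (simp_all only: pos_le_divide_eq[OF assms(1)] pos_divide_less_eq[OF assms(1)])
qed

lemma dyadic_cell:
  fixes T t :: real
  assumes T: "T > 0" and t: "t \<in> {0..<T}"
  shows "real (Suc (nat \<lfloor>t / (T / 2 ^ n)\<rfloor>)) * (T / 2 ^ n) \<le> T"
proof -
  let ?k = "nat \<lfloor>t / (T / 2 ^ n)\<rfloor>"
  have h: "T / 2 ^ n > 0" using T by simp
  have "real ?k * (T / 2 ^ n) \<le> t"
    by (rule nat_floor_divide_bounds) (use h t in auto)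
  also have "\<dots> < T" using t by simp
  also have "T = 2 ^ n * (T / 2 ^ n)" by simp
  finally have "real ?k < 2 ^ n"
    using h by (simp only: mult_less_cancel_right_pos)
  then have "Suc ?k \<le> 2 ^ n"
    by (metis Suc_leI of_nat_less_iff of_nat_numeral of_nat_power)
  then have "real (Suc ?k) \<le> 2 ^ n" by (metis of_nat_le_iff of_nat_numeral of_nat_power)
  then have "real (Suc ?k) * (T / 2 ^ n) \<le> 2 ^ n * (T / 2 ^ n)"
    by (rule mult_right_mono) (use T in auto)
  then show ?thesis by simp
qed

text \<open>Over full cells the slopes integrate to exact increments. In the cell of
  \<open>t\<close> both the remaining integral and the missing increment of \<open>z\<close> are at
  most \<Lambda> times the cell length.\<close>

lemma has_integral_dyadic_slope:
  fixes z :: "real \<Rightarrow> 'a::banach"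
  assumes T: "T > 0" and lip: "\<Lambda>-lipschitz_on UNIV z" and t: "t \<in> {0..T}"
  shows "\<exists>I. (dyadic_slope z T n has_integral I) {0..t} \<and> norm (I - (z t - z 0)) \<le> 2 * \<Lambda> * (T / 2 ^ n)"
proof -
  define h where "h = T / 2 ^ n"
  define k where "k = nat \<lfloor>t / h\<rfloor>"
  have h: "h > 0" using T by (simp add: h_def)
  have \<Lambda>: "\<Lambda> \<ge> 0" using lip lipschitz_on_nonneg by blast
  have k: "real k * h \<le> t" "t \<le> real (Suc k) * h"
    using nat_floor_divide_bounds[OF h, of t] t unfolding k_def by auto
  have tel: "(\<Sum>i<m. h *\<^sub>R dyadic_quotient z T n i) = z (real m * h) - z 0" for m
  proof (induction m)
    case (Suc m)
    have "h *\<^sub>R dyadic_quotient z T n m = z (real (Suc m) * h) - z (real m * h)"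
      using T by (simp add: dyadic_quotient_def h_def)
    then show ?case using Suc by simp
  qed simp
  have "(dyadic_slope z T n has_integral (z (real k * h) - z 0) + (t - real k * h) *\<^sub>R dyadic_quotient z T n k) {0..t}"
    using has_integral_step[OF h k, of "dyadic_quotient z T n"]
    unfolding tel dyadic_slope_def[abs_def] h_def[symmetric] .
  moreover have "norm ((z (real k * h) - z 0) + (t - real k * h) *\<^sub>R dyadic_quotient z T n k - (z t - z 0)) \<le> 2 * \<Lambda> * h"
  proof -
    have A: "norm (z (real k * h) - z t) \<le> \<Lambda> * h"
    proof -
      have "norm (z (real k * h) - z t) \<le> \<Lambda> * \<bar>real k * h - t\<bar>"
        using lipschitz_onD[OF lip, of "real k * h" t] by (simp add: dist_norm)
      also have "\<dots> \<le> \<Lambda> * h" by (rule mult_left_mono) (use k \<Lambda> in \<open>auto simp: algebra_simps\<close>)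
      finally show ?thesis .
    qed
    have B: "norm ((t - real k * h) *\<^sub>R dyadic_quotient z T n k) \<le> \<Lambda> * h"
      unfolding norm_scaleR mult.commute[of \<Lambda>]
      by (rule mult_mono) (use k h norm_dyadic_quotient_le[OF T lip] in \<open>auto simp: algebra_simps\<close>)
    have C: "(z (real k * h) - z 0) + (t - real k * h) *\<^sub>R dyadic_quotient z T n k - (z t - z 0)
        = (z (real k * h) - z t) + (t - real k * h) *\<^sub>R dyadic_quotient z T n k" by simp
    show ?thesis
      using norm_triangle_ineq[of "z (real k * h) - z t" "(t - real k * h) *\<^sub>R dyadic_quotient z T n k"] A B
      unfolding C by linarith
  qed
  ultimately show ?thesis unfolding h_def by blast
qed

text \<open>Serves strong measurability: the slopes themselves are the simple functions that
  approximate the derivative.\<close>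

lemma simple_function_dyadic_slope:
  assumes T: "T > 0"
  shows "simple_function (lebesgue_on {0..T}) (dyadic_slope z T n)"
proof -
  define p where "p t = nat \<lfloor>t / (T / 2 ^ n)\<rfloor>" for t
  have p: "p \<in> measurable (lebesgue_on {0..T}) (count_space UNIV)"
  proof -
    have "(\<lambda>t. \<lfloor>t / (T / 2 ^ n)\<rfloor>) \<in> measurable borel (count_space UNIV)"
      by (rule measurable_compose[OF _ measurable_real_floor]) simp
    then have "p \<in> measurable borel (count_space UNIV)"
      unfolding p_def[abs_def] by (rule measurable_compose) simp
    then have "p \<in> measurable lebesgue (count_space UNIV)"
      by (simp add: measurable_completion)
    then show ?thesis by (rule measurable_restrict_space1)
  qed
  have fin: "finite (p ` {0..T})"
  proof (rule finite_subset)
    have "p t \<le> p T" if "t \<in> {0..T}" for t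
      unfolding p_def by (intro nat_mono floor_mono divide_right_mono) (use T that in auto)
    then show "p ` {0..T} \<subseteq> {..p T}" by blast
  qed simp
  have "simple_function (lebesgue_on {0..T}) p"
    unfolding simple_function_def
    using fin measurable_sets[OF p] by (auto simp: space_restrict_space)
  then have "simple_function (lebesgue_on {0..T}) (dyadic_quotient z T n \<circ> p)"
    by (rule simple_function_compose)
  then show ?thesis by (simp add: dyadic_slope_def[abs_def] p_def o_def)
qed

lemma norm_dyadic_slope_le:
  assumes "T > 0" "\<Lambda>-lipschitz_on UNIV z"
  shows "norm (dyadic_slope z T n t) \<le> \<Lambda>"
  unfolding dyadic_slope_def by (rule norm_dyadic_quotient_le[OF assms])

lemma dyadic_energy_mono:
  fixes z :: "real \<Rightarrow> 'a::real_inner"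
  assumes "T > 0" "n \<le> m"
  shows "dyadic_energy z T n \<le> dyadic_energy z T m"
proof -
  obtain j where m: "m = n + j" using assms(2) le_Suc_ex by blast
  have "dyadic_energy z T m - dyadic_energy z T n \<ge> 0"
    unfolding m dyadic_energy_difference[OF assms(1), symmetric]
    by (intro sum_nonneg mult_nonneg_nonneg) (use assms(1) in auto)
  then show ?thesis by simp
qed

text \<open>The energies are increasing and bounded, so the slopes are Cauchy in L2. Along \<sigma>
  the squared distances of neighbours are at most \<open>(1 / 4) ^ k\<close>; even after
  multiplication by \<open>2 ^ k\<close> their integrals have a finite sum, so the weighted squares
  are summable almost everywhere.\<close>

lemma dyadic_slope_AE_convergent_subseq:
  fixes z :: "real \<Rightarrow> 'a::{real_inner, banach}"
  assumes T: "T > 0" and lip: "\<Lambda>-lipschitz_on UNIV z"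
  shows "\<exists>\<sigma>. strict_mono \<sigma> \<and> (AE t in lebesgue_on {0..T}. convergent (\<lambda>k. dyadic_slope z T (\<sigma> k) t))"
proof -
  let ?Q = "dyadic_energy z T"
  have "Bseq ?Q"
  proof (rule BseqI'[of _ "T * \<Lambda>\<^sup>2"])
    fix n
    have "?Q n \<ge> 0" unfolding dyadic_energy_def
      by (intro sum_nonneg mult_nonneg_nonneg) (use T in auto)
    then show "norm (?Q n) \<le> T * \<Lambda>\<^sup>2" using dyadic_energy_le[OF T lip, of n] by simp
  qed
  moreover have "monoseq ?Q"
    by (rule monoI1) (use dyadic_energy_mono[OF T] in blast)
  ultimately have "convergent ?Q" by (rule Bseq_monoseq_convergent)
  then have cau: "Cauchy ?Q" by (rule convergent_Cauchy)
  have "\<exists>N. \<forall>m\<ge>N. \<forall>n\<ge>N. \<bar>?Q m - ?Q n\<bar> < (1 / 4) ^ k" for k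
    using CauchyD[OF cau, of "(1 / 4) ^ k"] by simp
  then obtain N where N: "\<And>k m n. m \<ge> N k \<Longrightarrow> n \<ge> N k \<Longrightarrow> \<bar>?Q m - ?Q n\<bar> < (1 / 4) ^ k"
    by metis
  \<comment> \<open>Partial sums make \<sigma> strictly increasing and keep
    \<open>\<sigma> k \<ge> N k\<close>.\<close>
  define \<sigma> where "\<sigma> k = (\<Sum>i\<le>k. Suc (N i))" for k
  have \<sigma>: "strict_mono \<sigma>" by (rule strict_monoI_Suc) (simp add: \<sigma>_def)
  have \<sigma>N: "\<sigma> k \<ge> N k" for k
    by (induction k) (auto simp: \<sigma>_def)
  define f where "f k = dyadic_slope z T (\<sigma> k)" for k
  define c where "c k t = 2 ^ k * (norm (f (Suc k) t - f k t))\<^sup>2" for k t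
  have c_int: "\<exists>I. (c k has_integral I) {0..T} \<and> I \<le> (1 / 2) ^ k" for k
  proof -
    obtain j where j: "\<sigma> (Suc k) = \<sigma> k + j"
      using strict_mono_less_eq[OF \<sigma>, of k "Suc k"] le_Suc_ex[of "\<sigma> k" "\<sigma> (Suc k)"] by auto
    have 1: "((\<lambda>t. (norm (f (Suc k) t - f k t))\<^sup>2) has_integral ?Q (\<sigma> (Suc k)) - ?Q (\<sigma> k)) {0..T}"
      using has_integral_dyadic_slope_diff[OF T, of "\<lambda>v. (norm v)\<^sup>2" z "\<sigma> k" j]
      unfolding f_def j dyadic_energy_difference[OF T] .
    have "(c k has_integral 2 ^ k * (?Q (\<sigma> (Suc k)) - ?Q (\<sigma> k))) {0..T}"
      unfolding c_def[abs_def] by (rule has_integral_mult_right[OF 1])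
    moreover have "?Q (\<sigma> (Suc k)) - ?Q (\<sigma> k) \<le> (1 / 4) ^ k"
      using N[of k "\<sigma> (Suc k)" "\<sigma> k"] \<sigma>N[of k] strict_mono_less_eq[OF \<sigma>, of k "Suc k"] by simp
    then have "2 ^ k * (?Q (\<sigma> (Suc k)) - ?Q (\<sigma> k)) \<le> 2 ^ k * (1 / 4) ^ k"
      by (rule mult_left_mono) simp
    moreover have "2 ^ k * (1 / 4 :: real) ^ k = (1 / 2) ^ k"
      by (simp add: power_mult_distrib[symmetric])
    ultimately show ?thesis by (metis (no_types))
  qed
  have c0: "c k t \<ge> 0" for k t by (simp add: c_def)
  have c_abs: "integrable (lebesgue_on {0..T}) (c k)" for k
  proof -
    have "c k integrable_on {0..T}" using c_int[of k] by blast
    then have "c k absolutely_integrable_on {0..T}"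
      by (rule nonnegative_absolutely_integrable_1) (rule c0)
    then show ?thesis
      by (simp add: set_integrable_def integrable_restrict_space)
  qed
  have c_nn: "(\<integral>\<^sup>+t. ennreal (c k t) \<partial>lebesgue_on {0..T}) \<le> ennreal ((1 / 2) ^ k)" for k
  proof -
    obtain I where I: "(c k has_integral I) {0..T}" "I \<le> (1 / 2) ^ k" using c_int by blast
    have "(\<integral>\<^sup>+t. ennreal (c k t) \<partial>lebesgue_on {0..T}) = ennreal (integral\<^sup>L (lebesgue_on {0..T}) (c k))"
      by (rule nn_integral_eq_integral[OF c_abs]) (use c0 in auto)
    also have "integral\<^sup>L (lebesgue_on {0..T}) (c k) = I"
      using lebesgue_integral_eq_integral[OF c_abs] I(1) by (simp add: integral_unique)
    finally show ?thesis using I(2) by (simp add: ennreal_leI)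
  qed
  have "(\<integral>\<^sup>+t. (\<Sum>k. ennreal (c k t)) \<partial>lebesgue_on {0..T}) = (\<Sum>k. \<integral>\<^sup>+t. ennreal (c k t) \<partial>lebesgue_on {0..T})"
    by (rule nn_integral_suminf) (use borel_measurable_integrable[OF c_abs] in measurable)
  also have "\<dots> \<le> (\<Sum>k. ennreal ((1 / 2) ^ k))"
    by (rule suminf_le) (use c_nn in auto)
  also have "\<dots> = ennreal (\<Sum>k. (1 / 2) ^ k)"
    by (rule suminf_ennreal2) (auto intro: summable_geometric)
  also have "\<dots> < \<infinity>" by simp
  finally have fin: "(\<integral>\<^sup>+t. (\<Sum>k. ennreal (c k t)) \<partial>lebesgue_on {0..T}) \<noteq> \<infinity>" by simp
  have "AE t in lebesgue_on {0..T}. (\<Sum>k. ennreal (c k t)) \<noteq> \<infinity>"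
    by (rule nn_integral_PInf_AE[OF _ fin]) (use borel_measurable_integrable[OF c_abs] in measurable)
  then have "AE t in lebesgue_on {0..T}. convergent (\<lambda>k. f k t)"
  proof (rule eventually_mono)
    fix t assume "(\<Sum>k. ennreal (c k t)) \<noteq> \<infinity>"
    then have sc: "summable (\<lambda>k. c k t)"
      by (intro summable_suminf_not_top) (use c0 in \<open>auto simp: top_ennreal_def\<close>)
    have sg: "summable (\<lambda>k. (1 / 2 :: real) ^ k)" by (rule summable_geometric) simp
    \<comment> \<open>Young's inequality turns the summable weighted squares into a summable bound
      for the norms; this is why \<open>c\<close> carries the factor \<open>2 ^ k\<close>.\<close>
    have "norm (f (Suc k) t - f k t) \<le> (1 / 2) ^ k + c k t" for k
    proof -
      let ?x = "norm (f (Suc k) t - f k t)"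
      have "0 \<le> (1 - 2 ^ k * ?x)\<^sup>2 / 2 ^ k" by simp
      also have "\<dots> = (1 / 2) ^ k - 2 * ?x + 2 ^ k * ?x\<^sup>2"
        by (simp add: power2_eq_square field_simps power_one_over)
      finally show ?thesis unfolding c_def using norm_ge_zero[of "f (Suc k) t - f k t"] by linarith
    qed
    then have "summable (\<lambda>k. f (Suc k) t - f k t)"
      using summable_comparison_test'[OF summable_add[OF sg sc], of 0 "\<lambda>k. f (Suc k) t - f k t"] by simp
    then have "convergent (\<lambda>n. \<Sum>k<n. f (Suc k) t - f k t)"
      by (simp add: summable_iff_convergent)
    then have "convergent (\<lambda>n. f n t - f 0 t)"
      by (simp only: sum_lessThan_telescope[of "\<lambda>k. f k t"])
    then have "convergent (\<lambda>n. (f n t - f 0 t) + f 0 t)"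
      by (intro convergent_add convergent_const)
    then show "convergent (\<lambda>k. f k t)" by simp
  qed
  then show ?thesis using \<sigma> unfolding f_def by blast
qed

text \<open>In place of differentiability at \<open>t\<close>, the difference quotients converge
  along some shrinking intervals around \<open>t\<close>, namely dyadic cells. That is enough to
  pass to the limit in an inequality about increments.\<close>

theorem lipschitz_curve_derivative:
  fixes z :: "real \<Rightarrow> 'a::{real_inner, banach}"
  assumes T: "T > 0" and lip: "\<Lambda>-lipschitz_on UNIV z"
  shows "\<exists>g. W11_with_deriv T z g \<and>
    (AE t in lebesgue_on {0..T}. \<exists>a b. (\<forall>n. 0 \<le> a n \<and> a n \<le> t \<and> t \<le> b n \<and> b n \<le> T \<and> a n < b n) \<and>
       (\<lambda>n. b n - a n) \<longlonglongrightarrow> 0 \<and> (\<lambda>n. (1 / (b n - a n)) *\<^sub>R (z (b n) - z (a n))) \<longlonglongrightarrow> g t)"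
proof -
  obtain \<sigma> where \<sigma>: "strict_mono \<sigma>"
    and conv: "AE t in lebesgue_on {0..T}. convergent (\<lambda>k. dyadic_slope z T (\<sigma> k) t)"
    using dyadic_slope_AE_convergent_subseq[OF assms] by blast
  have \<Lambda>: "\<Lambda> \<ge> 0" using lip lipschitz_on_nonneg by blast
  define f where "f k = dyadic_slope z T (\<sigma> k)" for k
  define g where "g t = (if convergent (\<lambda>k. f k t) then lim (\<lambda>k. f k t) else 0)" for t
  define N where "N = {t \<in> {0..T}. \<not> convergent (\<lambda>k. f k t)}"
  have "AE t in lebesgue. t \<in> {0..T} \<longrightarrow> convergent (\<lambda>k. f k t)"
    using conv unfolding f_def[symmetric] by (subst (asm) AE_restrict_space_iff) auto
  then obtain M where M: "M \<in> null_sets lebesgue" "{t \<in> space lebesgue. \<not> (t \<in> {0..T} \<longrightarrow> convergent (\<lambda>k. f k t))} \<subseteq> M"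
    unfolding eventually_ae_filter by (elim bexE)
  have N: "negligible N"
    by (rule negligible_subset[of M]) (use M in \<open>auto simp: negligible_iff_null_sets N_def\<close>)
  have fg: "(\<lambda>k. f k t) \<longlonglongrightarrow> g t" if "t \<in> {0..T} - N" for t
    using that by (auto simp: g_def N_def convergent_LIMSEQ_iff)
  have AE_fg: "AE t in lebesgue_on {0..T}. (\<lambda>k. f k t) \<longlonglongrightarrow> g t"
    using conv unfolding f_def[symmetric]
    by (rule eventually_mono) (simp add: g_def convergent_LIMSEQ_iff)
  have f_le: "norm (f k t) \<le> \<Lambda>" for k t
    unfolding f_def by (rule norm_dyadic_slope_le[OF assms])
  have g_le: "norm (g t) \<le> \<Lambda>" for t
  proof (cases "convergent (\<lambda>k. f k t)")
    case True
    then have "(\<lambda>k. f k t) \<longlonglongrightarrow> g t" by (simp add: g_def convergent_LIMSEQ_iff)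
    then show ?thesis by (rule Lim_bounded[OF tendsto_norm]) (use f_le in auto)
  qed (use \<Lambda> in \<open>simp add: g_def\<close>)
  \<comment> \<open>\<open>norm (g - f k)\<close> is the limit of the step functions
    \<open>norm (f (k + j) - f k)\<close> as \<open>j\<close> grows, all bounded by
    \<open>2 * \<Lambda>\<close>, so the distance is integrable before \<open>g\<close> is known to
    be. The value 0 on \<open>N\<close> makes the convergence hold at every point.\<close>
  define dd where "dd k t = (if t \<in> N then 0 else norm (g t - f k t))" for k t
  have dd_int: "dd k integrable_on {0..T}" for k
  proof (rule dominated_convergence(1)[where f = "\<lambda>j t. if t \<in> N then 0 else norm (f (k + j) t - f k t)"
        and h = "\<lambda>_. 2 * \<Lambda>"])
    show "(\<lambda>t. if t \<in> N then 0 else norm (f (k + j) t - f k t)) integrable_on {0..T}" for j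
    proof -
      obtain i where i: "\<sigma> (k + j) = \<sigma> k + i"
        using strict_mono_less_eq[OF \<sigma>, of k "k + j"] le_Suc_ex[of "\<sigma> k" "\<sigma> (k + j)"] by auto
      have "(\<lambda>t. norm (f (k + j) t - f k t)) integrable_on {0..T}"
        using has_integral_dyadic_slope_diff[OF T, of norm z "\<sigma> k" i]
        unfolding f_def i by (rule has_integral_integrable)
      then show ?thesis
        by (rule integrable_spike[OF _ N]) auto
    qed
    show "(\<lambda>_. 2 * \<Lambda>) integrable_on {0..T}" by (rule integrable_const_ivl)
    show "norm (if t \<in> N then 0 else norm (f (k + j) t - f k t)) \<le> 2 * \<Lambda>" for j t
      using norm_triangle_ineq4[of "f (k + j) t" "f k t"] f_le[of "k + j" t] f_le[of k t] \<Lambda> by auto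
    show "(\<lambda>j. if t \<in> N then 0 else norm (f (k + j) t - f k t)) \<longlonglongrightarrow> dd k t" if "t \<in> {0..T}" for t
    proof (cases "t \<in> N")
      case False
      then have "(\<lambda>j. f (j + k) t) \<longlonglongrightarrow> g t"
        using fg[of t] that by (intro LIMSEQ_ignore_initial_segment) auto
      then show ?thesis using False
        by (auto simp: dd_def add.commute intro!: tendsto_intros)
    qed (simp add: dd_def)
  qed
  have dd_lim: "(\<lambda>k. integral {0..T} (dd k)) \<longlonglongrightarrow> integral {0..T} (\<lambda>_. 0::real)"
  proof (rule dominated_convergence(2)[where h = "\<lambda>_. 2 * \<Lambda>"])
    show "(\<lambda>_. 2 * \<Lambda>) integrable_on {0..T}" by (rule integrable_const_ivl)
    show "norm (dd k t) \<le> 2 * \<Lambda>" for k t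
      using norm_triangle_ineq4[of "g t" "f k t"] f_le[of k t] g_le[of t] \<Lambda> by (auto simp: dd_def)
    show "(\<lambda>k. dd k t) \<longlonglongrightarrow> 0" if "t \<in> {0..T}" for t
    proof (cases "t \<in> N")
      case False
      then have "(\<lambda>k. norm (g t - f k t)) \<longlonglongrightarrow> norm (g t - g t)"
        using fg[of t] that by (intro tendsto_intros) auto
      then show ?thesis using False by (simp add: dd_def)
    qed (simp add: dd_def)
  qed (rule dd_int)
  have g_int: "(g has_integral (z t - z 0)) {0..t}" if t: "t \<in> {0..T}" for t
  proof -
    obtain I where I: "\<And>k. (f k has_integral I k) {0..t}"
      "\<And>k. norm (I k - (z t - z 0)) \<le> 2 * \<Lambda> * (T / 2 ^ \<sigma> k)"
      using choice[OF allI[OF has_integral_dyadic_slope[OF T lip t]], of \<sigma>] unfolding f_def by blast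
    have I_lim: "I \<longlonglongrightarrow> z t - z 0"
    proof -
      have "(\<lambda>n. (1 / 2 :: real) ^ n) \<longlonglongrightarrow> 0" by (rule LIMSEQ_power_zero) simp
      then have "(\<lambda>k. (1 / 2 :: real) ^ \<sigma> k) \<longlonglongrightarrow> 0"
        using LIMSEQ_subseq_LIMSEQ[OF _ \<sigma>] by (fastforce simp: o_def)
      then have "(\<lambda>k. 2 * \<Lambda> * T * (1 / 2 :: real) ^ \<sigma> k) \<longlonglongrightarrow> 2 * \<Lambda> * T * 0"
        by (intro tendsto_mult_left)
      then have "(\<lambda>k. 2 * \<Lambda> * (T / 2 ^ \<sigma> k)) \<longlonglongrightarrow> 0"
        by (simp add: power_one_over field_simps)
      then have "(\<lambda>k. I k - (z t - z 0)) \<longlonglongrightarrow> 0"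
        by (rule Lim_null_comparison[rotated]) (use I(2) in auto)
      then show ?thesis by (rule LIM_zero_cancel)
    qed
    have ddt: "dd k integrable_on {0..t}" for k
      using dd_int integrable_on_subinterval[of "dd k" "{0..T}" 0 t] t by auto
    have 1: "((\<lambda>s. norm (g s - f k s)) has_integral integral {0..t} (dd k)) {0..t}" for k
      by (rule has_integral_spike[OF N _ integrable_integral[OF ddt]]) (auto simp: dd_def)
    have le: "integral {0..t} (dd k) \<le> integral {0..T} (dd k)" for k
      by (rule integral_subset_le) (use t ddt dd_int in \<open>auto simp: dd_def\<close>)
    have ge: "integral {0..t} (dd k) \<ge> 0" for k
      by (rule integral_nonneg[OF ddt]) (auto simp: dd_def)
    have "(\<lambda>k. integral {0..t} (dd k)) \<longlonglongrightarrow> 0"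
      by (rule tendsto_sandwich[of "\<lambda>_. 0" _ _ "\<lambda>k. integral {0..T} (dd k)"])
        (use le ge dd_lim in auto)
    then show ?thesis
      by (rule has_integral_L1_limit[OF I(1) I_lim 1])
  qed
  have "(\<lambda>t. norm (g t)) integrable_on {0..T}"
  proof (rule integrable_spike[OF _ N])
    show "(\<lambda>t. if t \<in> N then 0 else norm (g t)) integrable_on {0..T}"
    proof (rule dominated_convergence(1)[where f = "\<lambda>k t. if t \<in> N then 0 else norm (f k t)" and h = "\<lambda>_. \<Lambda>"])
      show "(\<lambda>t. if t \<in> N then 0 else norm (f k t)) integrable_on {0..T}" for k
      proof (rule integrable_spike[OF _ N])
        let ?F = "\<lambda>i. norm (dyadic_quotient z T (\<sigma> k) i)"
        have "\<exists>I. ((\<lambda>t. ?F (nat \<lfloor>t / (T / 2 ^ \<sigma> k)\<rfloor>)) has_integral I) {0..T}"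
        proof (rule exI, rule has_integral_step[where F = ?F and n = "2 ^ \<sigma> k"])
          have "real (2 ^ \<sigma> k) * (T / 2 ^ \<sigma> k) = T" by simp
          moreover have "real (2 ^ \<sigma> k) * (T / 2 ^ \<sigma> k) \<le> real (Suc (2 ^ \<sigma> k)) * (T / 2 ^ \<sigma> k)"
            by (rule mult_right_mono) (use T in auto)
          ultimately show "real (2 ^ \<sigma> k) * (T / 2 ^ \<sigma> k) \<le> T" "T \<le> real (Suc (2 ^ \<sigma> k)) * (T / 2 ^ \<sigma> k)"
            by linarith+
        qed (use T in simp)
        then show "(\<lambda>t. norm (f k t)) integrable_on {0..T}"
          unfolding f_def dyadic_slope_def by (rule integrable_on_def[THEN iffD2])
      qed auto
      show "(\<lambda>_. \<Lambda>) integrable_on {0..T}" by (rule integrable_const_ivl)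
      show "norm (if t \<in> N then 0 else norm (f k t)) \<le> \<Lambda>" for k t using f_le \<Lambda> by auto
      show "(\<lambda>k. if t \<in> N then 0 else norm (f k t)) \<longlonglongrightarrow> (if t \<in> N then 0 else norm (g t))"
        if "t \<in> {0..T}" for t
        using fg[of t] that by (auto intro!: tendsto_intros)
    qed
  qed auto
  then have "(\<lambda>t. norm (g t)) absolutely_integrable_on {0..T}"
    by (rule nonnegative_absolutely_integrable_1) simp
  then have "integrable (lebesgue_on {0..T}) (\<lambda>t. norm (g t))"
    by (simp add: set_integrable_def integrable_restrict_space)
  then have "bochner_integrable_on g {0..T}"
    unfolding bochner_integrable_on_def
    using simple_function_dyadic_slope[OF T] AE_fg unfolding f_def by (intro conjI exI[of _ f]) (auto simp: f_def)
  then have W: "W11_with_deriv T z g"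
    unfolding W11_with_deriv_def using g_int by blast
  \<comment> \<open>The cell of the end point leaves [0,T].\<close>
  have "AE t in lebesgue_on {0..T}. t \<noteq> T"
  proof -
    have "{T} \<in> null_sets lebesgue" unfolding negligible_iff_null_sets[symmetric] by simp
    then have "AE t in lebesgue. t \<notin> {T}" by (rule AE_not_in)
    then show ?thesis by (subst AE_restrict_space_iff) (auto elim: eventually_mono)
  qed
  with AE_fg have "AE t in lebesgue_on {0..T}. \<exists>a b. (\<forall>n. 0 \<le> a n \<and> a n \<le> t \<and> t \<le> b n \<and> b n \<le> T \<and> a n < b n) \<and>
       (\<lambda>n. b n - a n) \<longlonglongrightarrow> 0 \<and> (\<lambda>n. (1 / (b n - a n)) *\<^sub>R (z (b n) - z (a n))) \<longlonglongrightarrow> g t"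
    using AE_space
  proof eventually_elim
    case (elim t)
    then have t: "t \<in> {0..<T}" by (auto simp: space_restrict_space)
    define h where "h n = T / 2 ^ \<sigma> n" for n
    define k where "k n = nat \<lfloor>t / h n\<rfloor>" for n
    have h: "h n > 0" for n using T by (simp add: h_def)
    have ba: "real (Suc (k n)) * h n - real (k n) * h n = h n" for n by (simp add: algebra_simps)
    show ?case
    proof (rule exI[of _ "\<lambda>n. real (k n) * h n"], rule exI[of _ "\<lambda>n. real (Suc (k n)) * h n"], intro conjI allI)
      show "0 \<le> real (k n) * h n" for n using h[of n] by simp
      show "real (k n) * h n \<le> t" "t \<le> real (Suc (k n)) * h n" for n
        using nat_floor_divide_bounds[OF h, of t] t unfolding k_def by (auto intro: less_imp_le)
      show "real (Suc (k n)) * h n \<le> T" for n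
        using dyadic_cell[OF T t] unfolding k_def h_def .
      show "real (k n) * h n < real (Suc (k n)) * h n" for n using ba[of n] h[of n] by linarith
      have "(\<lambda>n. (1 / 2 :: real) ^ n) \<longlonglongrightarrow> 0" by (rule LIMSEQ_power_zero) simp
      then have "(\<lambda>k. (1 / 2 :: real) ^ \<sigma> k) \<longlonglongrightarrow> 0"
        using LIMSEQ_subseq_LIMSEQ[OF _ \<sigma>] by (fastforce simp: o_def)
      then have "(\<lambda>k. T * (1 / 2 :: real) ^ \<sigma> k) \<longlonglongrightarrow> T * 0"
        by (intro tendsto_mult_left)
      then show "(\<lambda>n. real (Suc (k n)) * h n - real (k n) * h n) \<longlonglongrightarrow> 0"
        unfolding ba h_def by (simp add: power_one_over field_simps)
      have "f n t = (1 / (real (Suc (k n)) * h n - real (k n) * h n)) *\<^sub>R (z (real (Suc (k n)) * h n) - z (real (k n) * h n))" for n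
        unfolding ba by (simp add: f_def dyadic_slope_def dyadic_quotient_def h_def k_def)
      then show "(\<lambda>n. (1 / (real (Suc (k n)) * h n - real (k n) * h n)) *\<^sub>R (z (real (Suc (k n)) * h n) - z (real (k n) * h n))) \<longlonglongrightarrow> g t"
        using elim(1) by (simp only:)
    qed
  qed
  with W show ?thesis by blast
qed

section \<open>Second derivatives\<close>

text \<open>The second difference of \<open>E\<close> over the parallelogram with sides
  \<open>s *\<^sub>R v\<close> and \<open>s *\<^sub>R w\<close> does not change when
  \<open>v\<close> and \<open>w\<close> are exchanged, and it equals
  \<open>s\<^sup>2 * Hx v w\<close> up to a smaller order.\<close>

lemma second_derivative_symmetric:
  fixes E :: "'a::real_normed_vector \<Rightarrow> real" and DE :: "'a \<Rightarrow> ('a \<Rightarrow>\<^sub>L real)"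
    and Hx :: "'a \<Rightarrow>\<^sub>L ('a \<Rightarrow>\<^sub>L real)"
  assumes E: "\<And>y. (E has_derivative blinfun_apply (DE y)) (at y)"
    and DE: "(DE has_derivative blinfun_apply Hx) (at x)"
  shows "Hx v w = Hx w v"
proof -
  have key: "\<exists>d>0. \<forall>s. 0 < s \<longrightarrow> s < d \<longrightarrow>
      \<bar>E (x + s *\<^sub>R v + s *\<^sub>R w) - E (x + s *\<^sub>R v) - E (x + s *\<^sub>R w) + E x - s\<^sup>2 * Hx v w\<bar> \<le> e * s\<^sup>2"
    if e: "e > 0" for e v w
  proof -
    \<comment> \<open>\<open>s * n\<close> bounds both displacements \<open>k1\<close> and
      \<open>k2\<close> below; the summands 1 in \<open>e'\<close> and in \<open>d / (n + 1)\<close>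
      guard against vanishing vectors.\<close>
    define n where "n = norm v + norm w"
    define e' where "e' = e / (2 * n * norm w + 1)"
    have n: "n \<ge> 0" "norm v \<le> n" "norm w \<le> n" by (auto simp: n_def)
    have nw: "2 * n * norm w + 1 > 0" using n by (intro add_nonneg_pos mult_nonneg_nonneg) auto
    then have e': "e' > 0" using e by (simp add: e'_def)
    have ee: "e' * (2 * n * norm w) \<le> e"
    proof -
      have "e' * (2 * n * norm w) \<le> e' * (2 * n * norm w + 1)" using e' by (intro mult_left_mono) auto
      also have "\<dots> = e" using nw by (simp add: e'_def)
      finally show ?thesis .
    qed
    obtain d where d: "d > 0" "\<And>y. norm (y - x) < d \<Longrightarrow> norm (DE y - DE x - Hx (y - x)) \<le> e' * norm (y - x)"
      using DE e' unfolding has_derivative_at_alt by blast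
    show ?thesis
    proof (intro exI[of _ "d / (n + 1)"] conjI allI impI)
      show "d / (n + 1) > 0" using d n by simp
      fix s assume s: "0 < s" "s < d / (n + 1)"
      have sn: "s * n < d"
      proof -
        have "s * (n + 1) < d" using s n by (simp add: pos_less_divide_eq)
        then show ?thesis using s by (simp add: algebra_simps)
      qed
      \<comment> \<open>The difference in direction \<open>v\<close>, moved along \<open>w\<close>:
        \<open>\<phi> 1 - \<phi> 0\<close> is the second difference, and the mean value theorem
        reduces it to values of \<open>DE\<close> near \<open>x\<close>, where \<open>DE\<close> is
        linearized.\<close>
      define \<phi> where "\<phi> \<theta> = E (x + s *\<^sub>R v + \<theta> *\<^sub>R s *\<^sub>R w) - E (x + \<theta> *\<^sub>R s *\<^sub>R w)" for \<theta> :: real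
      define \<phi>' where "\<phi>' \<theta> = DE (x + s *\<^sub>R v + \<theta> *\<^sub>R s *\<^sub>R w) (s *\<^sub>R w) - DE (x + \<theta> *\<^sub>R s *\<^sub>R w) (s *\<^sub>R w)" for \<theta> :: real
      have "(\<phi> has_derivative (\<lambda>h. h * \<phi>' \<theta>)) (at \<theta>)" for \<theta>
        unfolding \<phi>_def[abs_def] \<phi>'_def
        by (rule has_derivative_eq_rhs, (rule derivative_intros has_derivative_compose[OF _ E])+)
          (simp add: fun_eq_iff blinfun.scaleR_right algebra_simps)
      then have "(\<phi> has_real_derivative \<phi>' \<theta>) (at \<theta>)" for \<theta>
        by (rule has_derivative_imp_has_field_derivative) simp
      then obtain \<theta> where \<theta>: "0 < \<theta>" "\<theta> < 1" "\<phi> 1 - \<phi> 0 = (1 - 0) * \<phi>' \<theta>"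
        using MVT2[of 0 1 \<phi> \<phi>'] by auto
      define k1 where "k1 = s *\<^sub>R v + \<theta> *\<^sub>R s *\<^sub>R w"
      define k2 where "k2 = \<theta> *\<^sub>R s *\<^sub>R w"
      have k2n: "norm k2 \<le> s * norm w"
        using \<theta> s by (simp add: k2_def mult_left_le_one_le)
      have k1n: "norm k1 \<le> s * n"
        using norm_triangle_ineq[of "s *\<^sub>R v" k2] k2n s unfolding k1_def n_def k2_def[symmetric]
        by (simp add: algebra_simps)
      have k2n': "norm k2 \<le> s * n"
        using k2n s n by (meson mult_left_mono less_imp_le order_trans)
      have 1: "norm (DE (x + k1) - DE x - Hx k1) \<le> e' * (s * n)"
        using order_trans[OF d(2)[of "x + k1"] mult_left_mono[of _ _ e']] k1n sn e' by simp
      have 2: "norm (DE (x + k2) - DE x - Hx k2) \<le> e' * (s * n)"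
        using order_trans[OF d(2)[of "x + k2"] mult_left_mono[of _ _ e']] k2n' sn e' by simp
      let ?D = "(DE (x + k1) - DE x - Hx k1) - (DE (x + k2) - DE x - Hx k2)"
      have nD: "norm ?D \<le> 2 * (e' * (s * n))"
        using norm_triangle_ineq4[of "DE (x + k1) - DE x - Hx k1" "DE (x + k2) - DE x - Hx k2"] 1 2 by linarith
      have "k1 = s *\<^sub>R v + k2" by (simp add: k1_def k2_def)
      then have "Hx k1 = s *\<^sub>R Hx v + Hx k2" by (simp add: blinfun.add_right blinfun.scaleR_right)
      then have D: "?D (s *\<^sub>R w) = \<phi>' \<theta> - s\<^sup>2 * Hx v w"
        by (simp add: \<phi>'_def k1_def k2_def blinfun.diff_left blinfun.add_left blinfun.scaleR_left
            blinfun.scaleR_right power2_eq_square add.assoc right_diff_distrib)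
      have "\<bar>?D (s *\<^sub>R w)\<bar> \<le> norm ?D * norm (s *\<^sub>R w)"
        using norm_blinfun[of ?D "s *\<^sub>R w"] by simp
      also have "\<dots> \<le> 2 * (e' * (s * n)) * norm (s *\<^sub>R w)"
        by (rule mult_right_mono[OF nD]) simp
      also have "\<dots> = (e' * (2 * n * norm w)) * s\<^sup>2"
        using s by (simp add: power2_eq_square)
      also have "\<dots> \<le> e * s\<^sup>2" by (rule mult_right_mono[OF ee]) simp
      finally have "\<bar>\<phi>' \<theta> - s\<^sup>2 * Hx v w\<bar> \<le> e * s\<^sup>2" unfolding D .
      moreover have "\<phi>' \<theta> = E (x + s *\<^sub>R v + s *\<^sub>R w) - E (x + s *\<^sub>R v) - E (x + s *\<^sub>R w) + E x"
        using \<theta>(3) by (simp add: \<phi>_def)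
      ultimately show "\<bar>E (x + s *\<^sub>R v + s *\<^sub>R w) - E (x + s *\<^sub>R v) - E (x + s *\<^sub>R w) + E x - s\<^sup>2 * Hx v w\<bar> \<le> e * s\<^sup>2"
        by simp
    qed
  qed
  have "\<bar>Hx v w - Hx w v\<bar> \<le> 0 + e" if e: "e > 0" for e
  proof -
    have e2: "e / 2 > 0" using e by simp
    obtain d1 where d1: "d1 > 0" "\<And>s. 0 < s \<Longrightarrow> s < d1 \<Longrightarrow>
      \<bar>E (x + s *\<^sub>R v + s *\<^sub>R w) - E (x + s *\<^sub>R v) - E (x + s *\<^sub>R w) + E x - s\<^sup>2 * Hx v w\<bar> \<le> e / 2 * s\<^sup>2"
      using key[OF e2] by blast
    obtain d2 where d2: "d2 > 0" "\<And>s. 0 < s \<Longrightarrow> s < d2 \<Longrightarrow>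
      \<bar>E (x + s *\<^sub>R w + s *\<^sub>R v) - E (x + s *\<^sub>R w) - E (x + s *\<^sub>R v) + E x - s\<^sup>2 * Hx w v\<bar> \<le> e / 2 * s\<^sup>2"
      using key[OF e2] by blast
    define s where "s = min d1 d2 / 2"
    have s: "0 < s" "s < d1" "s < d2" using d1(1) d2(1) by (auto simp: s_def)
    have c: "x + s *\<^sub>R w + s *\<^sub>R v = x + s *\<^sub>R v + s *\<^sub>R w" by (simp add: add_ac)
    have "\<bar>s\<^sup>2 * Hx v w - s\<^sup>2 * Hx w v\<bar> \<le> e * s\<^sup>2"
      using d1(2)[OF s(1,2)] d2(2)[OF s(1,3)] unfolding c by linarith
    then have "s\<^sup>2 * \<bar>Hx v w - Hx w v\<bar> \<le> s\<^sup>2 * e"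
      by (simp only: right_diff_distrib[symmetric] abs_mult) (simp add: mult.commute)
    then show ?thesis using s by simp
  qed
  then have "\<bar>Hx v w - Hx w v\<bar> \<le> 0" by (rule field_le_epsilon)
  then show ?thesis by simp
qed

text \<open>Polarization and the parallelogram law keep the constant \<open>c\<close>. The
  assumption on the energy bounds only the quadratic form of a difference of second derivatives,
  while the later estimates use its operator norm.\<close>

lemma norm_symmetric_form_le:
  fixes B :: "'a::real_inner \<Rightarrow>\<^sub>L ('a \<Rightarrow>\<^sub>L real)"
  assumes sym: "\<And>v w. B v w = B w v" and q: "\<And>v. \<bar>B v v\<bar> \<le> c * (norm v)\<^sup>2" and c: "c \<ge> 0"
  shows "norm B \<le> c"
proof -
  have unit: "\<bar>B v w\<bar> \<le> c" if "norm v = 1" "norm w = 1" for v w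
  proof -
    have "4 * B v w = B (v + w) (v + w) - B (v - w) (v - w)"
      using sym[of v w] by (simp add: blinfun.add_left blinfun.add_right blinfun.diff_left blinfun.diff_right)
    then have "4 * \<bar>B v w\<bar> \<le> c * (norm (v + w))\<^sup>2 + c * (norm (v - w))\<^sup>2"
      using q[of "v + w"] q[of "v - w"] by linarith
    also have "\<dots> = c * (2 * (norm v)\<^sup>2 + 2 * (norm w)\<^sup>2)"
      by (simp add: power2_norm_eq_inner inner_add_left inner_add_right inner_diff_left inner_diff_right
          inner_commute algebra_simps)
    finally show ?thesis using that by simp
  qed
  have bil: "\<bar>B v w\<bar> \<le> c * norm v * norm w" for v w
  proof (cases "v = 0 \<or> w = 0")
    case False
    have "B v w = (norm v * norm w) * B (v /\<^sub>R norm v) (w /\<^sub>R norm w)"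
      using False by (simp add: blinfun.scaleR_left blinfun.scaleR_right field_simps)
    then have "\<bar>B v w\<bar> = (norm v * norm w) * \<bar>B (v /\<^sub>R norm v) (w /\<^sub>R norm w)\<bar>"
      by (simp add: abs_mult)
    also have "\<dots> \<le> (norm v * norm w) * c"
      by (rule mult_left_mono[OF unit]) (use False in auto)
    finally show ?thesis by (simp add: mult_ac)
  qed auto
  show ?thesis
  proof (rule norm_blinfun_bound[OF c])
    fix v show "norm (B v) \<le> c * norm v"
      by (rule norm_blinfun_bound) (use c bil[of v] in auto)
  qed
qed

section \<open>Approximate solutions of rate-independent systems\<close>

text \<open>The increment inequality contains a term of second order in \<open>M b - M a\<close>. On
  a partition so fine that \<open>M\<close> grows by at most \<eta> per cell, this term is absorbed
  by \<eta>, and \<open>\<gamma> + \<epsilon> + \<eta>\<close> is multiplied by at most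
  \<open>1 + K * \<Delta> \<le> exp (K * \<Delta>)\<close> in each cell.\<close>

lemma gronwall_increments:
  fixes \<gamma> M :: "real \<Rightarrow> real"
  assumes M: "continuous_on {0..T} M" and mono: "\<And>a b. 0 \<le> a \<Longrightarrow> a \<le> b \<Longrightarrow> b \<le> T \<Longrightarrow> M a \<le> M b"
    and step: "\<And>a b. 0 \<le> a \<Longrightarrow> a \<le> b \<Longrightarrow> b \<le> T \<Longrightarrow>
      \<gamma> b \<le> \<gamma> a + K * (M b - M a) * (\<epsilon> + (M b - M a) + \<gamma> a)"
    and \<gamma>0: "\<gamma> 0 = 0" and \<gamma>_nn: "\<And>t. \<gamma> t \<ge> 0" and K: "K \<ge> 0" and \<epsilon>: "\<epsilon> \<ge> 0" and t: "t \<in> {0..T}"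
  shows "\<gamma> t \<le> \<epsilon> * exp (K * (M t - M 0))"
proof (rule field_le_epsilon)
  fix e :: real assume e: "e > 0"
  define X where "X = exp (K * (M t - M 0))"
  have X: "X > 0" by (simp add: X_def)
  \<comment> \<open>The final error is \<open>X * \<eta>\<close>; this choice makes it
    \<open>e\<close>.\<close>
  define \<eta> where "\<eta> = e / X"
  have \<eta>: "\<eta> > 0" using e X by (simp add: \<eta>_def)
  have "uniformly_continuous_on {0..T} M"
    by (rule compact_uniformly_continuous[OF M]) simp
  then obtain d where d: "d > 0" "\<And>x y. x \<in> {0..T} \<Longrightarrow> y \<in> {0..T} \<Longrightarrow> dist y x < d \<Longrightarrow> dist (M y) (M x) < \<eta>"
    using \<eta> unfolding uniformly_continuous_on_def by metis
  obtain n :: nat where n: "real n > t / d" using reals_Archimedean2 by blast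
  have n0: "n > 0" using n t d(1) by (cases n) (auto simp: divide_less_0_iff)
  define s where "s j = real j * (t / real n)" for j
  have td: "t / real n < d" using n n0 d(1) by (simp add: field_simps)
  have s_rng: "s j \<in> {0..T}" if "j \<le> n" for j
  proof -
    have "s j \<le> real n * (t / real n)" unfolding s_def by (rule mult_right_mono) (use that t n0 in auto)
    then have "s j \<le> t" using n0 by simp
    moreover have "s j \<ge> 0" using t by (simp add: s_def)
    ultimately show ?thesis using t by auto
  qed
  have "\<gamma> (s j) + \<epsilon> + \<eta> \<le> exp (K * (M (s j) - M 0)) * (\<epsilon> + \<eta>)" if "j \<le> n" for j
    using that
  proof (induction j)
    case 0
    then show ?case by (simp add: s_def \<gamma>0)
  next
    case (Suc j)
    define \<Delta> where "\<Delta> = M (s (Suc j)) - M (s j)"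
    have ss: "s (Suc j) - s j = t / real n" by (simp add: s_def algebra_simps add_divide_distrib)
    have tn: "t / real n \<ge> 0" using t by simp
    have r: "s j \<in> {0..T}" "s (Suc j) \<in> {0..T}" "s j \<le> s (Suc j)" using s_rng Suc.prems ss tn by auto
    have \<Delta>0: "\<Delta> \<ge> 0" unfolding \<Delta>_def using mono[of "s j" "s (Suc j)"] r by simp
    have "dist (s (Suc j)) (s j) < d" using ss tn td by (simp add: dist_real_def)
    then have \<Delta>\<eta>: "\<Delta> \<le> \<eta>" using d(2)[OF r(1,2)] by (simp add: \<Delta>_def dist_real_def)
    have "\<gamma> (s (Suc j)) \<le> \<gamma> (s j) + K * \<Delta> * (\<epsilon> + \<Delta> + \<gamma> (s j))"
      unfolding \<Delta>_def by (rule step) (use r in auto)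
    also have "\<dots> \<le> \<gamma> (s j) + K * \<Delta> * (\<epsilon> + \<eta> + \<gamma> (s j))"
      using \<Delta>\<eta> by (intro add_left_mono mult_left_mono mult_nonneg_nonneg K \<Delta>0) auto
    finally have "\<gamma> (s (Suc j)) + \<epsilon> + \<eta> \<le> (1 + K * \<Delta>) * (\<gamma> (s j) + \<epsilon> + \<eta>)"
      by (simp add: algebra_simps)
    also have "\<dots> \<le> exp (K * \<Delta>) * (\<gamma> (s j) + \<epsilon> + \<eta>)"
      by (rule mult_right_mono[OF exp_ge_add_one_self]) (use \<gamma>_nn[of "s j"] \<epsilon> \<eta> in auto)
    also have "\<dots> \<le> exp (K * \<Delta>) * (exp (K * (M (s j) - M 0)) * (\<epsilon> + \<eta>))"
      by (rule mult_left_mono) (use Suc in auto)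
    also have "\<dots> = exp (K * (M (s (Suc j)) - M 0)) * (\<epsilon> + \<eta>)"
    proof -
      have "K * (M (s (Suc j)) - M 0) = K * \<Delta> + K * (M (s j) - M 0)" by (simp add: \<Delta>_def algebra_simps)
      then show ?thesis by (simp add: exp_add)
    qed
    finally show ?case .
  qed
  from this[of n] have "\<gamma> t + \<epsilon> + \<eta> \<le> X * (\<epsilon> + \<eta>)" using n0 by (simp add: s_def X_def)
  moreover have "X * \<eta> = e" using X by (simp add: \<eta>_def)
  ultimately show "\<gamma> t \<le> \<epsilon> * exp (K * (M t - M 0)) + e"
    using \<epsilon> \<eta> unfolding X_def[symmetric] by (simp add: algebra_simps)
qed

text \<open>The problem pulled back to Z: \<open>r\<close> is the dissipation after the embedding,
  \<open>l\<close> the load as a functional on Z, and \<open>E\<close> the energy without the load.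
  The force at time \<open>t\<close> in state \<open>z\<close> is \<open>DE z - l t\<close>; the
  second derivative \<open>H\<close> does not depend on time.\<close>

locale rate_independent =
  fixes T L \<kappa> \<rho> :: real
    and r E :: "'z::{real_inner, banach} \<Rightarrow> real"
    and DE :: "'z \<Rightarrow> ('z \<Rightarrow>\<^sub>L real)"
    and H :: "'z \<Rightarrow> ('z \<Rightarrow>\<^sub>L ('z \<Rightarrow>\<^sub>L real))"
    and l :: "real \<Rightarrow> ('z \<Rightarrow>\<^sub>L real)"
    and z0 :: 'z
  assumes T_pos: "T > 0" and L_nonneg: "L \<ge> 0" and \<kappa>_pos: "\<kappa> > 0" and \<rho>_nonneg: "\<rho> \<ge> 0"
    and r_nonneg: "\<And>v. r v \<ge> 0"
    and r_add: "\<And>v w. r (v + w) \<le> r v + r w"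
    and r_scale: "\<And>c v. c > 0 \<Longrightarrow> r (c *\<^sub>R v) = c * r v"
    and r_le: "\<And>v. r v \<le> \<rho> * norm v"
    and E_deriv: "\<And>z. (E has_derivative blinfun_apply (DE z)) (at z)"
    and DE_deriv: "\<And>z. (DE has_derivative blinfun_apply (H z)) (at z)"
    and H_lip: "\<And>R. R > 0 \<Longrightarrow> \<exists>C\<ge>0. \<forall>x\<in>ball 0 R. \<forall>y\<in>ball 0 R. \<forall>v.
      (H x - H y) v v \<le> C * norm (x - y) * (norm v)\<^sup>2"
    and H_convex: "\<And>z v. H z v v \<ge> \<kappa> * (norm v)\<^sup>2"
    and l_lip: "L-lipschitz_on {0..T} l"
    and z0_stable: "\<And>v. r v + (DE z0 - l 0) v \<ge> 0"
begin

lemma r_zero: "r 0 = 0"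
  using r_le[of 0] r_nonneg[of 0] by simp

lemma r_scale_nonneg: "c \<ge> 0 \<Longrightarrow> r (c *\<^sub>R v) = c * r v"
  by (cases "c = 0") (auto simp: r_zero r_scale)

text \<open>Subadditivity, used in both orders, turns the upper bound for \<open>r\<close> into a
  Lipschitz bound; this lets \<open>r\<close> pass to limits in Z.\<close>

lemma r_diff: "\<bar>r v - r w\<bar> \<le> \<rho> * norm (v - w)"
proof -
  have "r v \<le> r (v - w) + r w" using r_add[of "v - w" w] by simp
  moreover have "r w \<le> r (w - v) + r v" using r_add[of "w - v" v] by simp
  ultimately show ?thesis
    using r_le[of "v - w"] r_le[of "w - v"] unfolding norm_minus_commute[of w v] by linarith
qed

lemma r_tendsto: "(f \<longlongrightarrow> v) F \<Longrightarrow> ((\<lambda>n. r (f n)) \<longlongrightarrow> r v) F"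
proof -
  assume f: "(f \<longlongrightarrow> v) F"
  have "((\<lambda>n. \<rho> * norm (f n - v)) \<longlongrightarrow> \<rho> * norm (v - v)) F"
    by (intro tendsto_intros f)
  then have "((\<lambda>n. \<rho> * norm (f n - v)) \<longlongrightarrow> 0) F" by simp
  moreover have "\<forall>\<^sub>F n in F. norm (r (f n) - r v) \<le> \<rho> * norm (f n - v)"
    by (rule always_eventually) (simp add: r_diff)
  ultimately have "((\<lambda>n. r (f n) - r v) \<longlongrightarrow> 0) F"
    by (rule Lim_null_comparison[rotated])
  then show ?thesis by (rule LIM_zero_cancel)
qed

lemma l_diff: "s \<in> {0..T} \<Longrightarrow> t \<in> {0..T} \<Longrightarrow> norm (l s - l t) \<le> L * \<bar>s - t\<bar>"
  using lipschitz_onD[OF l_lip] by (simp add: dist_norm)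

lemma H_sym: "H z v w = H z w v"
  by (rule second_derivative_symmetric[OF E_deriv DE_deriv])

lemma DE_increment:
  obtains \<theta> where "0 < \<theta>" "\<theta> < 1" "(DE y - DE x) v = H (x + \<theta> *\<^sub>R (y - x)) (y - x) v"
proof -
  have "((\<lambda>s. DE (x + s *\<^sub>R (y - x)) v) has_derivative
      (\<lambda>h. h * H (x + s *\<^sub>R (y - x)) (y - x) v)) (at s)" for s
    by (rule has_derivative_eq_rhs, (rule derivative_intros has_derivative_compose[OF _ DE_deriv]
          bounded_linear.has_derivative[OF blinfun.bounded_linear_left])+)
      (simp add: fun_eq_iff blinfun.scaleR_right blinfun.scaleR_left)
  then have "((\<lambda>s. DE (x + s *\<^sub>R (y - x)) v) has_real_derivative H (x + s *\<^sub>R (y - x)) (y - x) v) (at s)" for s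
    by (rule has_derivative_imp_has_field_derivative) simp
  then obtain \<theta> where "0 < \<theta>" "\<theta> < 1"
    "DE (x + 1 *\<^sub>R (y - x)) v - DE (x + 0 *\<^sub>R (y - x)) v = (1 - 0) * H (x + \<theta> *\<^sub>R (y - x)) (y - x) v"
    using MVT2[of 0 1 "\<lambda>s. DE (x + s *\<^sub>R (y - x)) v" "\<lambda>s. H (x + s *\<^sub>R (y - x)) (y - x) v"] by auto
  then show ?thesis using that by (simp add: blinfun.diff_left)
qed

lemma DE_mono: "(DE y - DE x) (y - x) \<ge> \<kappa> * (norm (y - x))\<^sup>2"
  using DE_increment[of y x "y - x"] H_convex by metis

lemma E_convex: "E y \<ge> E x + DE x (y - x) + \<kappa> / 2 * (norm (y - x))\<^sup>2"
proof -
  define d where "d = y - x"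
  \<comment> \<open>With the quadratic part subtracted, the claim becomes
    \<open>\<phi> 1 - \<phi> 0 \<ge> DE x d\<close>, and strong monotonicity of \<open>DE\<close>
    provides it at the intermediate point.\<close>
  define \<phi> where "\<phi> s = E (x + s *\<^sub>R d) - \<kappa> / 2 * s\<^sup>2 * (norm d)\<^sup>2" for s
  define \<phi>' where "\<phi>' s = DE (x + s *\<^sub>R d) d - \<kappa> * s * (norm d)\<^sup>2" for s
  have "(\<phi> has_derivative (\<lambda>h. h * \<phi>' s)) (at s)" for s
    unfolding \<phi>_def[abs_def] \<phi>'_def
    by (rule has_derivative_eq_rhs, (rule derivative_intros has_derivative_compose[OF _ E_deriv])+)
      (simp add: fun_eq_iff blinfun.scaleR_right algebra_simps)
  then have "(\<phi> has_real_derivative \<phi>' s) (at s)" for s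
    by (rule has_derivative_imp_has_field_derivative) simp
  then obtain s where s: "0 < s" "s < 1" "\<phi> 1 - \<phi> 0 = (1 - 0) * \<phi>' s"
    using MVT2[of 0 1 \<phi> \<phi>'] by auto
  have "\<kappa> * (norm (s *\<^sub>R d))\<^sup>2 \<le> (DE (x + s *\<^sub>R d) - DE x) (s *\<^sub>R d)"
    using DE_mono[of "x + s *\<^sub>R d" x] by simp
  then have "s * (\<kappa> * s * (norm d)\<^sup>2) \<le> s * ((DE (x + s *\<^sub>R d) - DE x) d)"
    using s by (simp add: blinfun.scaleR_right power_mult_distrib power2_eq_square mult_ac)
  then have "\<kappa> * s * (norm d)\<^sup>2 \<le> (DE (x + s *\<^sub>R d) - DE x) d"
    using s by simp
  then have "\<phi>' s \<ge> DE x d" by (simp add: \<phi>'_def blinfun.diff_left)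
  then show ?thesis using s(3) by (simp add: \<phi>_def d_def)
qed

lemma H_lipschitz_norm:
  assumes "R > 0"
  obtains C where "C \<ge> 0" "\<And>x y. norm x < R \<Longrightarrow> norm y < R \<Longrightarrow> norm (H x - H y) \<le> C * norm (x - y)"
proof -
  obtain C where C: "C \<ge> 0" "\<And>x y v. norm x < R \<Longrightarrow> norm y < R \<Longrightarrow> (H x - H y) v v \<le> C * norm (x - y) * (norm v)\<^sup>2"
    using H_lip[OF assms] by (auto simp: dist_norm)
  have "norm (H x - H y) \<le> C * norm (x - y)" if "norm x < R" "norm y < R" for x y
  proof (rule norm_symmetric_form_le)
    show "(H x - H y) v w = (H x - H y) w v" for v w
      by (simp add: blinfun.diff_left H_sym[of _ v w])
    show "\<bar>(H x - H y) v v\<bar> \<le> C * norm (x - y) * (norm v)\<^sup>2" for v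
      using C(2)[OF that, of v] C(2)[OF that(2,1), of v] by (simp add: blinfun.diff_left norm_minus_commute)
  qed (use C in auto)
  then show ?thesis using that C(1) by blast
qed

lemma local_bounds:
  assumes R: "R \<ge> 0"
  obtains C where "C \<ge> 0"
    "\<And>x y. norm x \<le> R \<Longrightarrow> norm y \<le> R \<Longrightarrow> norm (DE y - DE x) \<le> C * norm (y - x)"
    "\<And>x y. norm x \<le> R \<Longrightarrow> norm y \<le> R \<Longrightarrow> norm (DE y - DE x - H x (y - x)) \<le> C * (norm (y - x))\<^sup>2"
proof -
  \<comment> \<open>The Lipschitz estimate for \<open>H\<close> is available on open balls of
    positive radius, while \<open>R\<close> may be 0.\<close>
  obtain C where C: "C \<ge> 0" "\<And>x y. norm x < R + 1 \<Longrightarrow> norm y < R + 1 \<Longrightarrow> norm (H x - H y) \<le> C * norm (x - y)"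
    using H_lipschitz_norm[of "R + 1"] R by auto
  have lin: "norm (DE y - DE x - H x (y - x)) \<le> C * (norm (y - x))\<^sup>2" if x: "norm x \<le> R" and y: "norm y \<le> R" for x y
  proof -
    have seg: "norm (x + t *\<^sub>R (y - x)) \<le> R" if "t \<in> {0..1}" for t
    proof -
      have "x + t *\<^sub>R (y - x) = (1 - t) *\<^sub>R x + t *\<^sub>R y" by (simp add: algebra_simps)
      then have "norm (x + t *\<^sub>R (y - x)) \<le> (1 - t) * norm x + t * norm y"
        using norm_triangle_ineq[of "(1 - t) *\<^sub>R x" "t *\<^sub>R y"] that by simp
      also have "\<dots> \<le> (1 - t) * R + t * R"
        by (intro add_mono mult_left_mono x y) (use that in auto)
      finally show ?thesis by (simp add: algebra_simps)
    qed
    have "norm (DE y - DE x - H x (y - x)) \<le> norm (y - x) * (C * norm (y - x))"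
    proof (rule differentiable_bound_linearization[where S = "(\<lambda>t. x + t *\<^sub>R (y - x)) ` {0..1}"])
      show "(DE has_derivative blinfun_apply (H w)) (at w within (\<lambda>t. x + t *\<^sub>R (y - x)) ` {0..1})" for w
        by (rule has_derivative_at_withinI[OF DE_deriv])
      fix w assume "w \<in> (\<lambda>t. x + t *\<^sub>R (y - x)) ` {0..1}"
      then obtain t where t: "t \<in> {0..1}" "w = x + t *\<^sub>R (y - x)" by blast
      have "norm (H w - H x) \<le> C * norm (w - x)"
        by (rule C(2)) (use seg[OF t(1)] t(2) x in auto)
      also have "norm (w - x) \<le> norm (y - x)" using t by (simp add: mult_left_le_one_le)
      finally have "norm (H w - H x) \<le> C * norm (y - x)" using C(1) by (simp add: mult_left_mono)
      then show "onorm (blinfun_apply (H w) - blinfun_apply (H x)) \<le> C * norm (y - x)"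
        by (simp add: norm_blinfun.rep_eq minus_blinfun.rep_eq fun_diff_def)
    next
      show "x \<in> (\<lambda>t. x + t *\<^sub>R (y - x)) ` {0..1}" by (rule image_eqI[of _ _ 0]) auto
    qed auto
    then show ?thesis by (simp add: power2_eq_square mult_ac)
  qed
  \<comment> \<open>On the ball \<open>norm (H x) \<le> norm (H 0) + C * R\<close>, and the
    linearization error is at most \<open>C * (2 * R) * norm (y - x)\<close>. The leading
    \<open>C\<close> is for the quadratic estimate.\<close>
  define B where "B = C + (norm (H 0) + C * R + C * (2 * R))"
  have B: "B \<ge> C" "B \<ge> 0" using C(1) R by (auto simp: B_def)
  show ?thesis
  proof (rule that[OF B(2)])
    fix x y :: 'z assume x: "norm x \<le> R" and y: "norm y \<le> R"
    show "norm (DE y - DE x - H x (y - x)) \<le> B * (norm (y - x))\<^sup>2"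
      by (rule order_trans[OF lin[OF x y] mult_right_mono[OF B(1)]]) simp
    have yx: "norm (y - x) \<le> 2 * R" using norm_triangle_ineq4[of y x] x y by simp
    have "norm (H x) \<le> norm (H x - H 0) + norm (H 0)"
      using norm_triangle_ineq[of "H x - H 0" "H 0"] by simp
    also have "norm (H x - H 0) \<le> C * norm (x - 0)"
      by (rule C(2)) (use x R in auto)
    also have "\<dots> \<le> C * R" using x C(1) by (simp add: mult_left_mono)
    finally have Hx: "norm (H x) \<le> norm (H 0) + C * R" by simp
    have "norm (DE y - DE x) \<le> norm (DE y - DE x - H x (y - x)) + norm (H x (y - x))"
      using norm_triangle_ineq[of "DE y - DE x - H x (y - x)" "H x (y - x)"] by simp
    also have "norm (H x (y - x)) \<le> (norm (H 0) + C * R) * norm (y - x)"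
      by (rule order_trans[OF norm_blinfun mult_right_mono[OF Hx]]) simp
    also have "norm (DE y - DE x - H x (y - x)) \<le> C * (2 * R) * norm (y - x)"
    proof -
      have "C * (norm (y - x))\<^sup>2 \<le> C * (2 * R) * norm (y - x)"
        using mult_right_mono[OF mult_left_mono[OF yx C(1)], of "norm (y - x)"]
        by (simp add: power2_eq_square mult.assoc)
      then show ?thesis using lin[OF x y] by linarith
    qed
    finally have "norm (DE y - DE x) \<le> (norm (H 0) + C * R + C * (2 * R)) * norm (y - x)"
      by (simp add: algebra_simps)
    also have "\<dots> \<le> B * norm (y - x)"
      by (rule mult_right_mono) (use C(1) in \<open>auto simp: B_def\<close>)
    finally show "norm (DE y - DE x) \<le> B * norm (y - x)" .
  qed
qed

text \<open>A derivative-free notion of approximate solution: \<open>M\<close> controls the increments of \<open>u\<close>, the state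
  is stable up to \<open>\<epsilon>\<close>, and the flow rule holds for increments, with the force frozen at the left end
  point, up to \<open>\<epsilon>\<close> and a term of second order.  Differential solutions are the case \<open>\<epsilon> = 0\<close>.\<close>

definition approx_solution :: "real \<Rightarrow> real \<Rightarrow> (real \<Rightarrow> real) \<Rightarrow> (real \<Rightarrow> 'z) \<Rightarrow> bool" where
  "approx_solution \<epsilon> K M u \<longleftrightarrow>
     (\<forall>a b. 0 \<le> a \<longrightarrow> a \<le> b \<longrightarrow> b \<le> T \<longrightarrow> norm (u b - u a) \<le> M b - M a \<and>
        r (u b - u a) + (DE (u a) - l a) (u b - u a) \<le> (M b - M a) * (\<epsilon> + K * (M b - M a))) \<and>
     (\<forall>t\<in>{0..T}. \<forall>v. r v + (DE (u t) - l t) v \<ge> - \<epsilon> * norm v)"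

text \<open>The Gronwall quantity is \<open>\<gamma> = \<langle>DE u1 - DE u2, u1 - u2\<rangle>\<close>.  By symmetry of \<open>H\<close>, both
  parts of its increment agree to first order with \<open>\<langle>DE u1 - DE u2, d1 - d2\<rangle>\<close>, which is small by testing
  each flow rule against the stability of the other solution.\<close>

lemma approx_solution_compare:
  assumes R: "R \<ge> 0" and K: "K \<ge> 0"
  shows "\<exists>K'\<ge>0. \<forall>\<epsilon> M u1 u2. \<epsilon> \<ge> 0 \<longrightarrow> continuous_on {0..T} M \<longrightarrow>
      approx_solution \<epsilon> K M u1 \<longrightarrow> approx_solution \<epsilon> K M u2 \<longrightarrow> u1 0 = u2 0 \<longrightarrow>
      (\<forall>t\<in>{0..T}. norm (u1 t) \<le> R \<and> norm (u2 t) \<le> R) \<longrightarrow>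
      (\<forall>t\<in>{0..T}. \<kappa> * (norm (u1 t - u2 t))\<^sup>2 \<le> \<epsilon> * exp (K' * (M t - M 0)))"
proof -
  obtain C where C: "C \<ge> 0"
    "\<And>x y. norm x \<le> R \<Longrightarrow> norm y \<le> R \<Longrightarrow> norm (DE y - DE x) \<le> C * norm (y - x)"
    "\<And>x y. norm x \<le> R \<Longrightarrow> norm y \<le> R \<Longrightarrow> norm (DE y - DE x - H x (y - x)) \<le> C * (norm (y - x))\<^sup>2"
    using local_bounds[OF R] by blast
  \<comment> \<open>The bound
    \<open>4 * (\<epsilon> * \<Delta>) + 2 * (K * \<Delta>\<^sup>2)\<close> for
    \<open>P d1 - P d2\<close> enters twice and gives \<open>8 + 4 * K\<close>;
    \<open>2 * C / \<kappa>\<close> comes from linearization errors quadratic in \<open>e\<close>,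
    and \<open>(4 * R + 4) * C\<close> from the remainders of second order in \<Delta>.\<close>
  define K' where "K' = 8 + 4 * K + 2 * C / \<kappa> + (4 * R + 4) * C"
  have Ck: "2 * C / \<kappa> \<ge> 0" using C(1) \<kappa>_pos by simp
  have RC: "(4 * R + 4) * C \<ge> 0" using C(1) R by simp
  have K': "K' \<ge> 0" unfolding K'_def using Ck RC K by linarith
  show ?thesis
  proof (intro exI[of _ K'] conjI allI impI ballI)
    show "K' \<ge> 0" by (rule K')
    fix \<epsilon> M u1 u2 t
    assume \<epsilon>: "\<epsilon> \<ge> 0" and M: "continuous_on {0..T} M"
      and s1: "approx_solution \<epsilon> K M u1" and s2: "approx_solution \<epsilon> K M u2"
      and init: "u1 0 = u2 0" and rng: "\<forall>t\<in>{0..T}. norm (u1 t) \<le> R \<and> norm (u2 t) \<le> R"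
      and t: "t \<in> {0..T}"
    define \<gamma> where "\<gamma> t = (DE (u1 t) - DE (u2 t)) (u1 t - u2 t)" for t
    have \<gamma>\<kappa>: "\<kappa> * (norm (u1 t - u2 t))\<^sup>2 \<le> \<gamma> t" for t
      unfolding \<gamma>_def by (rule DE_mono)
    have \<gamma>_nn: "\<gamma> t \<ge> 0" for t
      by (rule order_trans[OF _ \<gamma>\<kappa>]) (use \<kappa>_pos in simp)
    have "\<gamma> t \<le> \<epsilon> * exp (K' * (M t - M 0))"
    proof (rule gronwall_increments[OF M _ _ _ \<gamma>_nn K' \<epsilon> t])
      show "M a \<le> M b" if "0 \<le> a" "a \<le> b" "b \<le> T" for a b
        using s1 that norm_ge_zero[of "u1 b - u1 a"] unfolding approx_solution_def
        by (meson diff_ge_0_iff_ge order_trans)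
      show "\<gamma> 0 = 0" by (simp add: \<gamma>_def init)
      fix a b :: real assume ab: "0 \<le> a" "a \<le> b" "b \<le> T"
      define \<Delta> where "\<Delta> = M b - M a"
      define d1 where "d1 = u1 b - u1 a"
      define d2 where "d2 = u2 b - u2 a"
      define e where "e = u1 a - u2 a"
      have d1\<Delta>: "norm d1 \<le> \<Delta>" and d2\<Delta>: "norm d2 \<le> \<Delta>"
        and f1: "r d1 + (DE (u1 a) - l a) d1 \<le> \<Delta> * (\<epsilon> + K * \<Delta>)"
        and f2: "r d2 + (DE (u2 a) - l a) d2 \<le> \<Delta> * (\<epsilon> + K * \<Delta>)"
        using s1 s2 ab unfolding approx_solution_def d1_def d2_def \<Delta>_def by auto
      have \<Delta>: "\<Delta> \<ge> 0" using d1\<Delta> norm_ge_zero order_trans by blast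
      have g1: "r d1 + (DE (u2 a) - l a) d1 \<ge> - \<epsilon> * norm d1" and g2: "r d2 + (DE (u1 a) - l a) d2 \<ge> - \<epsilon> * norm d2"
        using s1 s2 ab unfolding approx_solution_def by auto
      have h1: "\<epsilon> * norm d1 \<le> \<epsilon> * \<Delta>" and h2: "\<epsilon> * norm d2 \<le> \<epsilon> * \<Delta>"
        using d1\<Delta> d2\<Delta> \<epsilon> by (auto intro: mult_left_mono)
      have na: "norm (u1 a) \<le> R" "norm (u2 a) \<le> R" and nb: "norm (u1 b) \<le> R" "norm (u2 b) \<le> R"
        using rng ab by auto
      have e2R: "norm e \<le> 2 * R" using norm_triangle_ineq4[of "u1 a" "u2 a"] na by (simp add: e_def)
      define P where "P = DE (u1 a) - DE (u2 a)"
      define D1 where "D1 = DE (u1 b) - DE (u1 a)"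
      define D2 where "D2 = DE (u2 b) - DE (u2 a)"
      \<comment> \<open>Both flow rules minus both stability conditions, where the stability of each
        curve is tested with the increment of the other: the terms with \<open>r\<close> and
        \<open>l\<close> cancel.\<close>
      have P: "P d1 - P d2 \<le> 4 * (\<epsilon> * \<Delta>) + 2 * (K * \<Delta>\<^sup>2)"
        using f1 f2 g1 g2 h1 h2
        by (simp add: P_def blinfun.diff_left power2_eq_square algebra_simps)
      have \<gamma>b: "\<gamma> b = \<gamma> a + (P d1 - P d2) + (D1 e - D2 e) + (D1 - D2) (d1 - d2)"
        by (simp add: \<gamma>_def P_def D1_def D2_def d1_def d2_def e_def blinfun.diff_left blinfun.diff_right)
      have app: "\<bar>f v\<bar> \<le> p * q" if "norm f \<le> p" "norm v \<le> q" for f :: "'z \<Rightarrow>\<^sub>L real" and v p q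
      proof -
        have "\<bar>f v\<bar> \<le> norm f * norm v" using norm_blinfun[of f v] by simp
        also have "\<dots> \<le> p * q"
          by (rule mult_mono[OF that order_trans[OF norm_ge_zero that(1)] norm_ge_zero])
        finally show ?thesis .
      qed
      have D1n: "norm D1 \<le> C * \<Delta>" and D2n: "norm D2 \<le> C * \<Delta>"
        unfolding D1_def D2_def
        using order_trans[OF C(2)[OF na(1) nb(1)] mult_left_mono[OF d1\<Delta>[unfolded d1_def] C(1)]]
          order_trans[OF C(2)[OF na(2) nb(2)] mult_left_mono[OF d2\<Delta>[unfolded d2_def] C(1)]] by auto
      have D12: "(D1 - D2) (d1 - d2) \<le> 4 * (C * \<Delta>\<^sup>2)"
      proof -
        have "norm (D1 - D2) \<le> 2 * (C * \<Delta>)" using norm_triangle_ineq4[of D1 D2] D1n D2n by linarith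
        moreover have "norm (d1 - d2) \<le> 2 * \<Delta>" using norm_triangle_ineq4[of d1 d2] d1\<Delta> d2\<Delta> by linarith
        ultimately have "\<bar>(D1 - D2) (d1 - d2)\<bar> \<le> 2 * (C * \<Delta>) * (2 * \<Delta>)" by (rule app)
        then show ?thesis by (simp add: power2_eq_square)
      qed
      have sq: "C * (norm d1)\<^sup>2 \<le> C * \<Delta>\<^sup>2" "C * (norm d2)\<^sup>2 \<le> C * \<Delta>\<^sup>2"
        using d1\<Delta> d2\<Delta> C(1) by (auto intro!: mult_left_mono power_mono)
      have r1: "\<bar>(D1 - H (u1 a) d1) e\<bar> \<le> C * \<Delta>\<^sup>2 * (2 * R)"
        by (rule app[OF _ e2R]) (use C(3)[OF na(1) nb(1)] sq in \<open>simp add: D1_def d1_def\<close>)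
      have r2: "\<bar>(D2 - H (u2 a) d2) e\<bar> \<le> C * \<Delta>\<^sup>2 * (2 * R)"
        by (rule app[OF _ e2R]) (use C(3)[OF na(2) nb(2)] sq in \<open>simp add: D2_def d2_def\<close>)
      \<comment> \<open>\<open>P\<close> is linearized at \<open>u1 a\<close> here and at
        \<open>u2 a\<close> in \<open>q2\<close>, so that each increment meets the second derivative
        along its own curve. The error is quadratic in \<open>e\<close>, hence bounded by a multiple
        of \<gamma>.\<close>
      have q1: "\<bar>(H (u1 a) e - P) d1\<bar> \<le> C * (norm e)\<^sup>2 * \<Delta>"
      proof (rule app[OF _ d1\<Delta>])
        have "DE (u2 a) - DE (u1 a) - H (u1 a) (u2 a - u1 a) = H (u1 a) e - P"
          by (simp add: P_def e_def blinfun.diff_right)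
        then show "norm (H (u1 a) e - P) \<le> C * (norm e)\<^sup>2"
          using C(3)[OF na] by (simp add: e_def norm_minus_commute)
      qed
      have q2: "\<bar>(P - H (u2 a) e) d2\<bar> \<le> C * (norm e)\<^sup>2 * \<Delta>"
        by (rule app[OF _ d2\<Delta>]) (use C(3)[OF na(2,1)] in \<open>simp add: P_def e_def\<close>)
      \<comment> \<open>By symmetry \<open>H (u1 a) d1 e = H (u1 a) e d1\<close>, so the change of
        the forces tested with \<open>e\<close> becomes, up to remainders, the force difference
        \<open>P\<close> tested with the increments.\<close>
      have "D1 e - D2 e = (P d1 - P d2) + (D1 - H (u1 a) d1) e - (D2 - H (u2 a) d2) e
          + (H (u1 a) e - P) d1 + (P - H (u2 a) e) d2"
        using H_sym[of "u1 a" d1 e] H_sym[of "u2 a" d2 e] by (simp add: blinfun.diff_left)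
      then have De: "D1 e - D2 e \<le> (P d1 - P d2) + 2 * (C * \<Delta>\<^sup>2 * (2 * R)) + 2 * (C * (norm e)\<^sup>2 * \<Delta>)"
        using r1 r2 q1 q2 by linarith
      have ek: "C * (norm e)\<^sup>2 * \<Delta> \<le> C / \<kappa> * \<gamma> a * \<Delta>"
      proof (rule mult_right_mono[OF _ \<Delta>])
        have "C / \<kappa> * (\<kappa> * (norm e)\<^sup>2) \<le> C / \<kappa> * \<gamma> a"
          by (rule mult_left_mono) (use \<gamma>\<kappa>[of a] C(1) \<kappa>_pos in \<open>auto simp: e_def\<close>)
        then show "C * (norm e)\<^sup>2 \<le> C / \<kappa> * \<gamma> a" using \<kappa>_pos by simp
      qed
      have "\<gamma> b \<le> \<gamma> a + 8 * (\<epsilon> * \<Delta>) + 4 * (K * \<Delta>\<^sup>2) + 2 * (C * \<Delta>\<^sup>2 * (2 * R)) + 2 * (C / \<kappa> * \<gamma> a * \<Delta>) + 4 * (C * \<Delta>\<^sup>2)"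
        using \<gamma>b P De D12 ek by linarith
      also have "\<dots> = \<gamma> a + \<Delta> * (8 * \<epsilon> + (4 * K + (4 * R + 4) * C) * \<Delta> + 2 * C / \<kappa> * \<gamma> a)"
        by (simp add: power2_eq_square algebra_simps)
      also have "\<dots> \<le> \<gamma> a + \<Delta> * (K' * \<epsilon> + K' * \<Delta> + K' * \<gamma> a)"
        by (intro add_left_mono mult_left_mono \<Delta> add_mono mult_right_mono \<epsilon> \<gamma>_nn)
          (use K RC Ck in \<open>auto simp: K'_def\<close>)
      finally show "\<gamma> b \<le> \<gamma> a + K' * (M b - M a) * (\<epsilon> + (M b - M a) + \<gamma> a)"
        unfolding \<Delta>_def[symmetric] by (simp add: algebra_simps)
    qed
    then show "\<kappa> * (norm (u1 t - u2 t))\<^sup>2 \<le> \<epsilon> * exp (K' * (M t - M 0))"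
      using \<gamma>\<kappa>[of t] by linarith
  qed
qed

end

section \<open>Affine interpolation of stable states\<close>

text \<open>An induction principle for statements about intervals that survive concatenation. It
  serves the Lipschitz bound and the flow rule of an interpolant, which are both checked within one
  cell.\<close>

lemma knot_chain:
  fixes s :: "nat \<Rightarrow> real"
  assumes n: "n > 0" and s0: "s 0 = 0"
    and piece: "\<And>j a b. j < n \<Longrightarrow> s j \<le> a \<Longrightarrow> a \<le> b \<Longrightarrow> b \<le> s (Suc j) \<Longrightarrow> Q a b"
    and s_less: "\<And>j. j < n \<Longrightarrow> s j < s (Suc j)"
    and trans: "\<And>a b c. a \<le> b \<Longrightarrow> b \<le> c \<Longrightarrow> Q a b \<Longrightarrow> Q b c \<Longrightarrow> Q a c"
    and ab: "0 \<le> a" "a \<le> b" "b \<le> s n"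
  shows "Q a b"
proof -
  have "Q a b" if "j \<le> n" "0 \<le> a" "a \<le> b" "b \<le> s j" for j a b
    using that
  proof (induction j arbitrary: a b)
    case 0
    then have "a = 0" "b = 0" using s0 by auto
    then show ?case using piece[of 0 0 0] n s0 s_less[of 0] by auto
  next
    case (Suc j)
    consider "b \<le> s j" | "s j \<le> a" | "a \<le> s j" "s j \<le> b" by linarith
    then show ?case
    proof cases
      case 3
      have "Q a (s j)" by (rule Suc.IH) (use Suc.prems 3 in auto)
      moreover have "Q (s j) b" by (rule piece[of j]) (use Suc.prems 3 in auto)
      ultimately show ?thesis by (rule trans[OF 3])
    qed (use Suc piece[of j a b] in auto)
  qed
  then show ?thesis using ab by blast
qed

context rate_independent
begin

lemma DE_tendsto: "(f \<longlongrightarrow> x) F \<Longrightarrow> ((\<lambda>n. DE (f n)) \<longlongrightarrow> DE x) F"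
  using has_derivative_continuous[OF DE_deriv] by (simp add: continuous_at_imp_continuous_at_within isCont_tendsto_compose)

text \<open>The comparison wants the same \<epsilon>, \<open>K\<close> and \<open>M\<close> for both
  curves; this brings them to common values.\<close>

lemma approx_solution_weaken:
  assumes u: "approx_solution \<epsilon> K M u" and le: "\<epsilon> \<le> \<epsilon>'" "K \<le> K'" and K: "\<epsilon> \<ge> 0" "K \<ge> 0"
    and M: "\<And>a b. 0 \<le> a \<Longrightarrow> a \<le> b \<Longrightarrow> b \<le> T \<Longrightarrow> M b - M a \<le> M' b - M' a"
  shows "approx_solution \<epsilon>' K' M' u"
  unfolding approx_solution_def
proof (intro conjI allI impI ballI)
  fix a b :: real assume ab: "0 \<le> a" "a \<le> b" "b \<le> T"
  have 1: "norm (u b - u a) \<le> M b - M a"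
    and 2: "r (u b - u a) + (DE (u a) - l a) (u b - u a) \<le> (M b - M a) * (\<epsilon> + K * (M b - M a))"
    using u ab unfolding approx_solution_def by auto
  have nn: "0 \<le> M b - M a" by (rule order_trans[OF norm_ge_zero 1])
  show "norm (u b - u a) \<le> M' b - M' a" using 1 M[OF ab] by linarith
  have "(M b - M a) * (\<epsilon> + K * (M b - M a)) \<le> (M' b - M' a) * (\<epsilon>' + K' * (M' b - M' a))"
  proof (rule mult_mono[OF M[OF ab]])
    show "\<epsilon> + K * (M b - M a) \<le> \<epsilon>' + K' * (M' b - M' a)"
      by (rule add_mono[OF le(1) mult_mono[OF le(2) M[OF ab]]]) (use K le nn in auto)
  qed (use K nn M[OF ab] in auto)
  then show "r (u b - u a) + (DE (u a) - l a) (u b - u a) \<le> (M' b - M' a) * (\<epsilon>' + K' * (M' b - M' a))"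
    using 2 by linarith
next
  fix t v assume t: "t \<in> {0..T}"
  have "- \<epsilon> * norm v \<le> r v + (DE (u t) - l t) v"
    using u t unfolding approx_solution_def by blast
  moreover have "\<epsilon> * norm v \<le> \<epsilon>' * norm v" by (rule mult_right_mono[OF le(1)]) simp
  ultimately show "- \<epsilon>' * norm v \<le> r v + (DE (u t) - l t) v" by simp
qed

text \<open>Shared by the unconstrained incremental problem, with \<open>c = 0\<close>, and by the
  local scheme. Stability and the flow rule are given at the knots only; along \<open>u\<close> the
  force is \<open>G\<close>-Lipschitz in time, so moving it within a cell costs
  \<open>G * \<tau>\<close>. The summand 1 in \<open>(\<Lambda> + 1) * t\<close> lets the control
  dominate elapsed time even when \<open>\<Lambda> = 0\<close>.\<close>

lemma affine_interpolation_approx_solution: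
  fixes s :: "nat \<Rightarrow> real" and y :: "nat \<Rightarrow> 'z"
  assumes C: "C \<ge> 0" "\<And>x y. norm x \<le> R \<Longrightarrow> norm y \<le> R \<Longrightarrow> norm (DE y - DE x) \<le> C * norm (y - x)"
    and \<Lambda>: "\<Lambda> \<ge> 0" and c: "c \<ge> 0"
    and n: "n > 0" and s0: "s 0 = 0" and sn: "s n = T"
    and s_less: "\<And>j. j < n \<Longrightarrow> s j < s (Suc j)" and s_\<tau>: "\<And>j. j < n \<Longrightarrow> s (Suc j) - s j \<le> \<tau>"
    and lip: "\<And>j. j < n \<Longrightarrow> norm (y (Suc j) - y j) \<le> \<Lambda> * (s (Suc j) - s j)"
    and dis: "\<And>j. j < n \<Longrightarrow> r (y (Suc j) - y j) + (DE (y (Suc j)) - l (s (Suc j))) (y (Suc j) - y j)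
        \<le> c * (s (Suc j) - s j)\<^sup>2"
    and stab: "\<And>j v. j \<le> n \<Longrightarrow> r v + (DE (y j) - l (s j)) v \<ge> 0"
    and rng: "\<And>j. j \<le> n \<Longrightarrow> norm (y j) \<le> R"
    and aff: "\<And>j t. j < n \<Longrightarrow> s j \<le> t \<Longrightarrow> t \<le> s (Suc j) \<Longrightarrow>
        u t = y j + ((t - s j) / (s (Suc j) - s j)) *\<^sub>R (y (Suc j) - y j)"
  defines "G \<equiv> C * \<Lambda> + L"
  shows "approx_solution ((c + G * \<Lambda> + G) * \<tau>) (G * \<Lambda>) (\<lambda>t. (\<Lambda> + 1) * t) u"
    and "t \<in> {0..T} \<Longrightarrow> norm (u t) \<le> R"
proof -
  have G: "G \<ge> 0" using C(1) \<Lambda> L_nonneg by (simp add: G_def)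
  have s_mono: "s i \<le> s j" if "i \<le> j" "j \<le> n" for i j
    using that
  proof (induction j)
    case (Suc j)
    then show ?case using s_less[of j] by (cases "i = Suc j") auto
  qed simp
  have s_in: "s j \<in> {0..T}" if "j \<le> n" for j
    using s_mono[of 0 j] s_mono[of j n] that s0 sn by auto
  have find: "\<exists>j<n. s j \<le> t \<and> t \<le> s (Suc j)" if "t \<in> {0..T}" for t
  proof -
    have "\<exists>j<n. s j \<le> t \<and> t \<le> s (Suc j)" if "0 \<le> t" "t \<le> s m" "m \<le> n" "m > 0" for m
      using that
    proof (induction m)
      case (Suc m)
      show ?case
      proof (cases "t \<le> s m \<and> m > 0")
        case True
        then show ?thesis using Suc by auto
      next
        case False
        then have "s m \<le> t" using Suc.prems s0 by (cases "m = 0") auto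
        then show ?thesis using Suc.prems by (intro exI[of _ m]) auto
      qed
    qed simp
    then show ?thesis using that n sn by auto
  qed
  have u_knot: "u (s j) = y j" "u (s (Suc j)) = y (Suc j)" if "j < n" for j
    using aff[of j "s j"] aff[of j "s (Suc j)"] s_less[of j] that by auto
  have diff: "u b - u a = ((b - a) / (s (Suc j) - s j)) *\<^sub>R (y (Suc j) - y j)"
    if "j < n" "s j \<le> a" "a \<le> b" "b \<le> s (Suc j)" for j a b
  proof -
    have "(b - s j) / (s (Suc j) - s j) - (a - s j) / (s (Suc j) - s j) = (b - a) / (s (Suc j) - s j)"
      by (simp add: diff_divide_distrib)
    then show ?thesis
      using aff[of j a] aff[of j b] that by (simp add: scaleR_diff_left[symmetric])
  qed
  have u_lip: "norm (u b - u a) \<le> \<Lambda> * (b - a)" if ab: "0 \<le> a" "a \<le> b" "b \<le> T" for a b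
  proof (rule knot_chain[where Q = "\<lambda>a b. norm (u b - u a) \<le> \<Lambda> * (b - a)", OF n s0 _ s_less])
    fix j a b assume j: "j < n" "s j \<le> a" "a \<le> b" "b \<le> s (Suc j)"
    have h: "s (Suc j) - s j > 0" using s_less j by simp
    have "norm (u b - u a) = (b - a) / (s (Suc j) - s j) * norm (y (Suc j) - y j)"
      unfolding diff[OF j] using j h by simp
    also have "\<dots> \<le> (b - a) / (s (Suc j) - s j) * (\<Lambda> * (s (Suc j) - s j))"
      by (rule mult_left_mono[OF lip]) (use j h in auto)
    also have "\<dots> = \<Lambda> * (b - a)" using h by simp
    finally show "norm (u b - u a) \<le> \<Lambda> * (b - a)" .
  next
    fix a b c :: real
    assume "norm (u b - u a) \<le> \<Lambda> * (b - a)" "norm (u c - u b) \<le> \<Lambda> * (c - b)"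
    then show "norm (u c - u a) \<le> \<Lambda> * (c - a)"
      using norm_triangle_ineq[of "u c - u b" "u b - u a"] by (simp add: algebra_simps)
  qed (use ab sn in auto)
  show u_rng: "norm (u t) \<le> R" if t: "t \<in> {0..T}" for t
  proof -
    obtain j where j: "j < n" "s j \<le> t" "t \<le> s (Suc j)" using find[OF t] by blast
    define \<theta> where "\<theta> = (t - s j) / (s (Suc j) - s j)"
    have \<theta>: "0 \<le> \<theta>" "\<theta> \<le> 1" using j s_less[OF j(1)] by (auto simp: \<theta>_def)
    have "u t = (1 - \<theta>) *\<^sub>R y j + \<theta> *\<^sub>R y (Suc j)"
      using aff[OF j] by (simp add: \<theta>_def[symmetric] algebra_simps)
    then have "norm (u t) \<le> (1 - \<theta>) * norm (y j) + \<theta> * norm (y (Suc j))"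
      using norm_triangle_ineq[of "(1 - \<theta>) *\<^sub>R y j" "\<theta> *\<^sub>R y (Suc j)"] \<theta> by simp
    also have "\<dots> \<le> (1 - \<theta>) * R + \<theta> * R"
      by (intro add_mono mult_left_mono rng) (use \<theta> j in auto)
    finally show ?thesis by (simp add: algebra_simps)
  qed
  have p_lip: "norm ((DE (u b) - l b) - (DE (u a) - l a)) \<le> G * (b - a)" if ab: "0 \<le> a" "a \<le> b" "b \<le> T" for a b
  proof -
    have "norm (DE (u b) - DE (u a)) \<le> C * norm (u b - u a)"
      by (rule C(2)[OF u_rng u_rng]) (use ab in auto)
    also have "\<dots> \<le> C * (\<Lambda> * (b - a))" by (rule mult_left_mono[OF u_lip[OF ab] C(1)])
    finally have 1: "norm (DE (u b) - DE (u a)) \<le> C * (\<Lambda> * (b - a))" .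
    have 2: "norm (l b - l a) \<le> L * (b - a)" using l_diff[of b a] ab by simp
    have "(DE (u b) - l b) - (DE (u a) - l a) = (DE (u b) - DE (u a)) - (l b - l a)" by simp
    then show ?thesis
      using norm_triangle_ineq4[of "DE (u b) - DE (u a)" "l b - l a"] 1 2
      by (simp only:) (simp add: G_def algebra_simps)
  qed
  have \<tau>: "\<tau> \<ge> 0" using s_\<tau>[OF n] s_less[OF n] by simp
  have u_dis: "r (u b - u a) + (DE (u a) - l a) (u b - u a) \<le> (c * \<tau> + G * \<Lambda> * (\<tau> + (b - a))) * (b - a)"
    if AB: "0 \<le> a" "a \<le> b" "b \<le> T" for a b
  proof -
    \<comment> \<open>The force \<open>p\<close> stays frozen at the left end of the whole interval
      while subintervals vary; the estimates of adjacent pieces then add up by subadditivity of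
      \<open>r\<close>.\<close>
    define A B where "A = a" "B = b"
    define p where "p = DE (u A) - l A"
    define m where "m = c * \<tau> + G * \<Lambda> * (\<tau> + (B - A))"
    have "A \<le> a \<longrightarrow> b \<le> B \<longrightarrow> r (u b - u a) + p (u b - u a) \<le> m * (b - a)"
    proof (rule knot_chain[where Q = "\<lambda>a b. A \<le> a \<longrightarrow> b \<le> B \<longrightarrow> r (u b - u a) + p (u b - u a) \<le> m * (b - a)",
          OF n s0 _ s_less])
      fix j a b assume j: "j < n" "s j \<le> a" "a \<le> b" "b \<le> s (Suc j)"
      show "A \<le> a \<longrightarrow> b \<le> B \<longrightarrow> r (u b - u a) + p (u b - u a) \<le> m * (b - a)"
      proof (intro impI)
        assume w: "A \<le> a" "b \<le> B"
        define h where "h = s (Suc j) - s j"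
        define \<delta> where "\<delta> = y (Suc j) - y j"
        have h: "h > 0" "h \<le> \<tau>" using s_less s_\<tau> j by (auto simp: h_def)
        define q where "q = DE (y (Suc j)) - l (s (Suc j))"
        have As: "0 \<le> A" "A \<le> s (Suc j)" "s (Suc j) \<le> T" using s_in[of "Suc j"] j w AB by (auto simp: A_B_def)
        have "norm (q - p) \<le> G * (s (Suc j) - A)"
          using p_lip[OF As] unfolding u_knot(2)[OF j(1)] q_def p_def .
        \<comment> \<open>The right knot of the cell may lie beyond \<open>B\<close>, by at most
          \<tau>.\<close>
        also have "\<dots> \<le> G * (\<tau> + (B - A))"
          by (rule mult_left_mono[OF _ G]) (use j w h in \<open>auto simp: h_def\<close>)
        finally have qp: "norm (q - p) \<le> G * (\<tau> + (B - A))" .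
        have \<delta>: "norm \<delta> \<le> \<Lambda> * h" using lip[OF j(1)] by (simp add: \<delta>_def h_def)
        have "\<bar>(q - p) \<delta>\<bar> \<le> norm (q - p) * norm \<delta>" using norm_blinfun[of "q - p" \<delta>] by simp
        also have "\<dots> \<le> (G * (\<tau> + (B - A))) * (\<Lambda> * h)"
          by (rule mult_mono[OF qp \<delta> order_trans[OF norm_ge_zero qp] norm_ge_zero])
        finally have "p \<delta> \<le> q \<delta> + (G * (\<tau> + (B - A))) * (\<Lambda> * h)" by (simp add: blinfun.diff_left)
        moreover have "r \<delta> + q \<delta> \<le> c * h\<^sup>2" using dis[OF j(1)] by (simp add: \<delta>_def q_def h_def)
        moreover have "c * h\<^sup>2 \<le> c * \<tau> * h"
          using mult_left_mono[OF mult_right_mono[OF h(2), of h] c] h by (simp add: power2_eq_square mult.assoc)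
        ultimately have "r \<delta> + p \<delta> \<le> m * h" by (simp add: m_def algebra_simps)
        then have "(b - a) / h * (r \<delta> + p \<delta>) \<le> (b - a) / h * (m * h)"
          by (rule mult_left_mono) (use j h in auto)
        moreover have "u b - u a = ((b - a) / h) *\<^sub>R \<delta>" using diff[OF j] by (simp add: h_def \<delta>_def)
        then have "r (u b - u a) + p (u b - u a) = (b - a) / h * (r \<delta> + p \<delta>)"
          using j h by (simp add: r_scale_nonneg blinfun.scaleR_right distrib_left)
        ultimately show "r (u b - u a) + p (u b - u a) \<le> m * (b - a)"
          using h by (simp add: mult.commute)
      qed
    next
      fix a b c :: real
      assume "a \<le> b" "b \<le> c"
        "A \<le> a \<longrightarrow> b \<le> B \<longrightarrow> r (u b - u a) + p (u b - u a) \<le> m * (b - a)"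
        "A \<le> b \<longrightarrow> c \<le> B \<longrightarrow> r (u c - u b) + p (u c - u b) \<le> m * (c - b)"
      then show "A \<le> a \<longrightarrow> c \<le> B \<longrightarrow> r (u c - u a) + p (u c - u a) \<le> m * (c - a)"
        using r_add[of "u c - u b" "u b - u a"] by (auto simp: blinfun.diff_right algebra_simps)
    qed (use AB sn in auto)
    then show ?thesis by (simp add: A_B_def p_def m_def)
  qed
  show "approx_solution ((c + G * \<Lambda> + G) * \<tau>) (G * \<Lambda>) (\<lambda>t. (\<Lambda> + 1) * t) u"
    unfolding approx_solution_def
  proof (intro conjI allI impI ballI)
    fix a b :: real assume ab: "0 \<le> a" "a \<le> b" "b \<le> T"
    have e: "(\<Lambda> + 1) * b - (\<Lambda> + 1) * a = (\<Lambda> + 1) * (b - a)" by (simp add: algebra_simps)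
    have le: "b - a \<le> (\<Lambda> + 1) * (b - a)" using ab \<Lambda> by (simp add: algebra_simps mult_left_mono)
    show "norm (u b - u a) \<le> (\<Lambda> + 1) * b - (\<Lambda> + 1) * a"
      using u_lip[OF ab] ab unfolding e by (simp add: algebra_simps)
    have "(c * \<tau> + G * \<Lambda> * (\<tau> + (b - a))) * (b - a)
        \<le> ((c + G * \<Lambda> + G) * \<tau> + G * \<Lambda> * ((\<Lambda> + 1) * (b - a))) * ((\<Lambda> + 1) * (b - a))"
    proof (rule mult_mono[OF _ le])
      have "G * \<Lambda> * (b - a) \<le> G * \<Lambda> * ((\<Lambda> + 1) * (b - a))" by (rule mult_left_mono[OF le]) (use G \<Lambda> in auto)
      moreover have "G * \<tau> \<ge> 0" using G \<tau> by simp
      ultimately show "c * \<tau> + G * \<Lambda> * (\<tau> + (b - a)) \<le> (c + G * \<Lambda> + G) * \<tau> + G * \<Lambda> * ((\<Lambda> + 1) * (b - a))"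
        by (simp add: distrib_right distrib_left)
    qed (use G \<Lambda> c \<tau> ab in auto)
    then show "r (u b - u a) + (DE (u a) - l a) (u b - u a)
        \<le> ((\<Lambda> + 1) * b - (\<Lambda> + 1) * a) * ((c + G * \<Lambda> + G) * \<tau> + G * \<Lambda> * ((\<Lambda> + 1) * b - (\<Lambda> + 1) * a))"
      using u_dis[OF ab] unfolding e by (simp add: mult.commute)
  next
    fix t v assume t: "t \<in> {0..T}"
    obtain j where j: "j < n" "s j \<le> t" "t \<le> s (Suc j)" using find[OF t] by blast
    define p where "p = DE (u t) - l t"
    define q where "q = DE (y j) - l (s j)"
    have "norm (p - q) \<le> G * (t - s j)"
      using p_lip[of "s j" t] s_in[of j] j t unfolding u_knot(1)[OF j(1)] p_def q_def by simp
    also have "\<dots> \<le> G * \<tau>" by (rule mult_left_mono[OF _ G]) (use j s_\<tau>[OF j(1)] in auto)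
    also have "\<dots> \<le> (c + G * \<Lambda> + G) * \<tau>" by (rule mult_right_mono[OF _ \<tau>]) (use c G \<Lambda> in auto)
    finally have pq: "norm (p - q) \<le> (c + G * \<Lambda> + G) * \<tau>" .
    have "\<bar>(p - q) v\<bar> \<le> norm (p - q) * norm v" using norm_blinfun[of "p - q" v] by simp
    also have "\<dots> \<le> (c + G * \<Lambda> + G) * \<tau> * norm v" by (rule mult_right_mono[OF pq]) simp
    finally have "q v - (c + G * \<Lambda> + G) * \<tau> * norm v \<le> p v" by (simp add: blinfun.diff_left)
    moreover have "r v + q v \<ge> 0" using stab[of j v] j by (simp add: q_def)
    ultimately show "- ((c + G * \<Lambda> + G) * \<tau>) * norm v \<le> r v + (DE (u t) - l t) v"
      unfolding p_def[symmetric] by simp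
  qed
qed

section \<open>Existence and uniqueness of solutions\<close>

text \<open>Convexity of \<open>r\<close> bounds its change along the segment, convexity of
  \<open>E\<close> bounds the difference quotient by \<open>DE (z + s *\<^sub>R d) d\<close>, and
  \<open>s\<close> tends to 0. Minimality is asked for on the segment only, so minimizers under a
  convex constraint are covered as well.\<close>

lemma segment_minimizer_variation:
  fixes p :: "'z \<Rightarrow>\<^sub>L real"
  assumes min: "\<And>s. 0 < s \<Longrightarrow> s \<le> 1 \<Longrightarrow>
      E z - p z + r (z - x) \<le> E (z + s *\<^sub>R d) - p (z + s *\<^sub>R d) + r (z + s *\<^sub>R d - x)"
  shows "0 \<le> (DE z - p) d + r (z + d - x) - r (z - x)"
proof -
  define c where "c = p d + r (z - x) - r (z + d - x)"
  have ge: "c \<le> DE (z + s *\<^sub>R d) d" if s: "0 < s" "s \<le> 1" for s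
  proof -
    have "z + s *\<^sub>R d - x = (1 - s) *\<^sub>R (z - x) + s *\<^sub>R (z + d - x)" by (simp add: algebra_simps)
    then have "r (z + s *\<^sub>R d - x) \<le> (1 - s) * r (z - x) + s * r (z + d - x)"
      using r_add[of "(1 - s) *\<^sub>R (z - x)" "s *\<^sub>R (z + d - x)"] s by (simp add: r_scale_nonneg)
    then have "s * c \<le> E (z + s *\<^sub>R d) - E z"
      using min[OF s] by (simp add: c_def blinfun.add_right blinfun.scaleR_right algebra_simps)
    also have "\<dots> \<le> s * DE (z + s *\<^sub>R d) d"
    proof -
      have "E (z + s *\<^sub>R d) + DE (z + s *\<^sub>R d) (- (s *\<^sub>R d)) + \<kappa> / 2 * (norm (s *\<^sub>R d))\<^sup>2 \<le> E z"
        using E_convex[of "z + s *\<^sub>R d" z] by simp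
      moreover have "\<kappa> / 2 * (norm (s *\<^sub>R d))\<^sup>2 \<ge> 0" using \<kappa>_pos by simp
      moreover have "DE (z + s *\<^sub>R d) (- (s *\<^sub>R d)) = - (s * DE (z + s *\<^sub>R d) d)"
        by (simp add: blinfun.minus_right blinfun.scaleR_right)
      ultimately show ?thesis by linarith
    qed
    finally show ?thesis using s by simp
  qed
  have "(\<lambda>n. DE (z + (1 / real (Suc n)) *\<^sub>R d) d) \<longlonglongrightarrow> DE (z + 0 *\<^sub>R d) d"
    by (intro blinfun.tendsto DE_tendsto tendsto_intros LIMSEQ_Suc[OF lim_1_over_n])
  then have "c \<le> DE (z + 0 *\<^sub>R d) d"
    by (rule LIMSEQ_le_const) (auto intro!: exI[of _ 0] ge)
  then show ?thesis by (simp add: c_def blinfun.diff_left)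
qed

text \<open>Uniform convexity makes minimizing sequences Cauchy, so no weak compactness is needed.\<close>

lemma incremental_minimizer_exists:
  fixes p :: "'z \<Rightarrow>\<^sub>L real"
  obtains z where "\<And>v. E z - p z + r (z - x) \<le> E v - p v + r (v - x)"
proof -
  define J where "J v = E v - p v + r (v - x)" for v
  define m where "m = Inf (range J)"
  have J_bdd: "bdd_below (range J)"
  proof (rule bdd_belowI)
    fix a assume "a \<in> range J"
    then obtain v where a: "a = J v" by blast
    define q where "q = DE x - p"
    define t where "t = norm (v - x)"
    have "\<bar>q (v - x)\<bar> \<le> norm q * t" using norm_blinfun[of q "v - x"] by (simp add: t_def)
    moreover have "E x - p x + q (v - x) + \<kappa> / 2 * t\<^sup>2 \<le> J v"
      using E_convex[of x v] r_nonneg[of "v - x"]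
      by (simp add: J_def q_def t_def blinfun.diff_left blinfun.diff_right)
    \<comment> \<open>Young's inequality with the weight that uniform convexity can pay for.\<close>
    moreover have "norm q * t \<le> \<kappa> / 2 * t\<^sup>2 + (norm q)\<^sup>2 / (2 * \<kappa>)"
    proof -
      have "0 \<le> (\<kappa> * t - norm q)\<^sup>2 / (2 * \<kappa>)" using \<kappa>_pos by simp
      also have "\<dots> = \<kappa> / 2 * t\<^sup>2 + (norm q)\<^sup>2 / (2 * \<kappa>) - norm q * t"
        using \<kappa>_pos by (simp add: power2_eq_square field_simps)
      finally show ?thesis by simp
    qed
    ultimately show "E x - p x - (norm q)\<^sup>2 / (2 * \<kappa>) \<le> a" unfolding a by linarith
  qed
  have m_le: "m \<le> J v" for v unfolding m_def by (rule cInf_lower[OF _ J_bdd]) simp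
  have near: "\<exists>v. J v < m + e" if "e > 0" for e
    using cInf_lessD[of "range J" "m + e"] that unfolding m_def by auto
  \<comment> \<open>The midpoint gains \<open>\<kappa> * (norm e)\<^sup>2\<close> by uniform
    convexity, so two states with almost minimal value are close.\<close>
  have mid: "\<kappa> / 8 * (norm (a - b))\<^sup>2 \<le> (J a + J b) / 2 - m" for a b
  proof -
    define c where "c = (1 / 2) *\<^sub>R (a + b)"
    define e where "e = (1 / 2) *\<^sub>R (a - b)"
    have ab: "a - c = e" "b - c = - e"
      by (simp_all add: c_def e_def algebra_simps scaleR_left_distrib[symmetric]
        flip: scaleR_half_double)
    have "E c + DE c e + \<kappa> / 2 * (norm e)\<^sup>2 \<le> E a" "E c - DE c e + \<kappa> / 2 * (norm e)\<^sup>2 \<le> E b"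
      using E_convex[of c a] E_convex[of c b] unfolding ab by (simp_all add: blinfun.minus_right)
    then have "2 * E c + \<kappa> * (norm e)\<^sup>2 \<le> E a + E b" by simp
    moreover have "2 * p c = p a + p b" by (simp add: c_def blinfun.scaleR_right blinfun.add_right)
    moreover have "2 * r (c - x) \<le> r (a - x) + r (b - x)"
    proof -
      have "2 *\<^sub>R (c - x) = (a - x) + (b - x)" by (simp add: c_def algebra_simps scaleR_2)
      then have "r (2 *\<^sub>R (c - x)) \<le> r (a - x) + r (b - x)" using r_add[of "a - x" "b - x"] by simp
      then show ?thesis by (simp add: r_scale)
    qed
    ultimately have "2 * J c + \<kappa> * (norm e)\<^sup>2 \<le> J a + J b" by (simp add: J_def)
    moreover have "(norm e)\<^sup>2 = (norm (a - b))\<^sup>2 / 4" by (simp add: e_def power_mult_distrib power2_eq_square)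
    ultimately have "2 * J c + \<kappa> * ((norm (a - b))\<^sup>2 / 4) \<le> J a + J b" by (simp only:)
    then show ?thesis using m_le[of c] by (simp add: field_simps)
  qed
  obtain f where f: "\<And>n. J (f n) < m + 1 / real (Suc n)"
    using choice[of "\<lambda>n v. J v < m + 1 / real (Suc n)"] near by auto
  have "Cauchy f"
  proof (rule metric_CauchyI)
    fix e :: real assume e: "e > 0"
    obtain N where N: "1 / real (Suc N) < \<kappa> / 8 * e\<^sup>2"
      using nat_approx_posE[of "\<kappa> / 8 * e\<^sup>2"] e \<kappa>_pos by auto
    show "\<exists>N. \<forall>m\<ge>N. \<forall>n\<ge>N. dist (f m) (f n) < e"
    proof (intro exI allI impI)
      fix i j assume ij: "N \<le> i" "N \<le> j"
      have "1 / real (Suc i) \<le> 1 / real (Suc N)" "1 / real (Suc j) \<le> 1 / real (Suc N)"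
        using ij by (auto intro!: divide_left_mono)
      then have "J (f i) < m + 1 / real (Suc N)" "J (f j) < m + 1 / real (Suc N)"
        using f[of i] f[of j] by linarith+
      then have "(J (f i) + J (f j)) / 2 - m < 1 / real (Suc N)"
        by argo
      then have "\<kappa> / 8 * (norm (f i - f j))\<^sup>2 < \<kappa> / 8 * e\<^sup>2"
        using mid[of "f i" "f j"] N by (meson le_less_trans less_trans)
      then have "(norm (f i - f j))\<^sup>2 < e\<^sup>2" using \<kappa>_pos by simp
      then show "dist (f i) (f j) < e" using e by (simp add: dist_norm power_less_imp_less_base)
    qed
  qed
  then obtain z where z: "f \<longlonglongrightarrow> z" using Cauchy_convergent_iff convergent_def by blast
  have E_cont: "(\<lambda>n. E (f n)) \<longlonglongrightarrow> E z"
    by (rule isCont_tendsto_compose[OF has_derivative_continuous[OF E_deriv] z])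
  have "(\<lambda>n. J (f n)) \<longlonglongrightarrow> J z"
    unfolding J_def by (intro tendsto_intros E_cont r_tendsto z)
  moreover have "(\<lambda>n. m + 1 / real (Suc n)) \<longlonglongrightarrow> m + 0"
    by (intro tendsto_intros LIMSEQ_Suc[OF lim_1_over_n])
  ultimately have "J z \<le> m + 0"
    by (rule LIMSEQ_le) (use f less_imp_le in blast)
  then have "J z \<le> J v" for v using m_le[of v] by simp
  then show ?thesis using that unfolding J_def by blast
qed

text \<open>Variation by \<open>v\<close> and subadditivity give stability; variation back to the
  old state \<open>x\<close> gives the flow rule.\<close>

lemma incremental_problem:
  "\<exists>z. (\<forall>v. r v + (DE z - p) v \<ge> 0) \<and> r (z - x) + (DE z - p) (z - x) \<le> 0"
proof -
  obtain z where z: "\<And>v. E z - p z + r (z - x) \<le> E v - p v + r (v - x)"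
    using incremental_minimizer_exists[of p x] by blast
  have var: "0 \<le> (DE z - p) d + r (z + d - x) - r (z - x)" for d
    by (rule segment_minimizer_variation) (rule z)
  show ?thesis
  proof (intro exI[of _ z] conjI allI)
    fix v
    have "r (z + v - x) \<le> r (z - x) + r v" using r_add[of "z - x" v] by (simp add: algebra_simps)
    then show "r v + (DE z - p) v \<ge> 0" using var[of v] by linarith
    have "(DE z - p) (x - z) = - (DE z - p) (z - x)" by (simp add: blinfun.diff_right)
    then show "r (z - x) + (DE z - p) (z - x) \<le> 0" using var[of "x - z"] by (simp add: r_zero)
  qed
qed

section \<open>Time discretization without constraint and its limit\<close>

definition incremental :: "real \<Rightarrow> nat \<Rightarrow> 'z" where
  "incremental h = rec_nat z0 (\<lambda>j y. SOME z. (\<forall>v. r v + (DE z - l (real (Suc j) * h)) v \<ge> 0) \<and>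
     r (z - y) + (DE z - l (real (Suc j) * h)) (z - y) \<le> 0)"

lemma incremental_0: "incremental h 0 = z0"
  by (simp add: incremental_def)

lemma incremental_Suc:
  "r v + (DE (incremental h (Suc j)) - l (real (Suc j) * h)) v \<ge> 0"
  "r (incremental h (Suc j) - incremental h j)
     + (DE (incremental h (Suc j)) - l (real (Suc j) * h)) (incremental h (Suc j) - incremental h j) \<le> 0"
  using someI_ex[OF incremental_problem[of "l (real (Suc j) * h)" "incremental h j"]]
  unfolding incremental_def by auto

lemma incremental_stable:
  "r v + (DE (incremental h j) - l (real j * h)) v \<ge> 0"
  by (cases j) (use z0_stable incremental_Suc in \<open>auto simp: incremental_0\<close>)

text \<open>Stability of \<open>x\<close> and the flow rule of \<open>y\<close>, both tested with
  the step, leave only the change of the load; uniform convexity bounds the step by it.\<close>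

lemma stable_step_bound:
  assumes st: "r (y - x) + (DE x - p) (y - x) \<ge> 0" and fl: "r (y - x) + (DE y - q) (y - x) \<le> 0"
    and pq: "norm (q - p) \<le> d"
  shows "norm (y - x) \<le> d / \<kappa>"
proof -
  have "\<kappa> * (norm (y - x))\<^sup>2 \<le> (DE y - DE x) (y - x)" by (rule DE_mono)
  also have "\<dots> \<le> (q - p) (y - x)" using st fl by (simp add: blinfun.diff_left)
  also have "\<dots> \<le> norm (q - p) * norm (y - x)" using norm_blinfun[of "q - p" "y - x"] by simp
  also have "\<dots> \<le> d * norm (y - x)" by (rule mult_right_mono[OF pq]) simp
  finally have "(\<kappa> * norm (y - x)) * norm (y - x) \<le> d * norm (y - x)" by (simp add: power2_eq_square mult.assoc)
  then have "\<kappa> * norm (y - x) \<le> d"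
    using order_trans[OF norm_ge_zero pq] mult_right_le_imp_le[of "\<kappa> * norm (y - x)" "norm (y - x)" d]
    by (cases "y = x") simp_all
  then show ?thesis using \<kappa>_pos by (simp add: field_simps)
qed

text \<open>Steps of size at most \<open>L / \<kappa>\<close> times the time increment cannot leave
  this ball, and the iterates of the local scheme obey the same bound through their total variation.
  One set of local constants thus serves all step sizes.\<close>

definition radius :: real where "radius = norm z0 + L / \<kappa> * T"

lemma radius_nonneg: "radius \<ge> 0"
  using L_nonneg \<kappa>_pos T_pos by (simp add: radius_def)

text \<open>The Lipschitz constant \<open>L / \<kappa>\<close> of the interpolants, plus the 1 that
  the interpolation lemma adds to the control.\<close>

definition speed :: real where "speed = L / \<kappa> + 1"

lemma approx_solutions_exist:
  "\<exists>K. K \<ge> 0 \<and> (\<forall>n>0. \<exists>u. approx_solution (K * (T / real n)) K (\<lambda>t. speed * t) u \<and>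
     u 0 = z0 \<and> (\<forall>t\<in>{0..T}. norm (u t) \<le> radius))"
proof -
  obtain C where C: "C \<ge> 0"
    "\<And>x y. norm x \<le> radius \<Longrightarrow> norm y \<le> radius \<Longrightarrow> norm (DE y - DE x) \<le> C * norm (y - x)"
    "\<And>x y. norm x \<le> radius \<Longrightarrow> norm y \<le> radius \<Longrightarrow> norm (DE y - DE x - H x (y - x)) \<le> C * (norm (y - x))\<^sup>2"
    using local_bounds[OF radius_nonneg] by blast
  define \<Lambda> where "\<Lambda> = L / \<kappa>"
  have \<Lambda>: "\<Lambda> \<ge> 0" using L_nonneg \<kappa>_pos by (simp add: \<Lambda>_def)
  define G where "G = C * \<Lambda> + L"
  have G: "G \<ge> 0" using C(1) \<Lambda> L_nonneg by (simp add: G_def)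
  define K where "K = G * \<Lambda> + G"
  have K: "K \<ge> 0" using G \<Lambda> by (simp add: K_def)
  have "\<exists>u. approx_solution (K * (T / real n)) K (\<lambda>t. speed * t) u \<and>
     u 0 = z0 \<and> (\<forall>t\<in>{0..T}. norm (u t) \<le> radius)" if n: "n > 0" for n :: nat
  proof -
    define h where "h = T / real n"
    have h: "h > 0" using T_pos n by (simp add: h_def)
    have nh: "real n * h = T" using n by (simp add: h_def)
    define y where "y = incremental h"
    have step: "real (Suc j) * h - real j * h = h" for j by (simp add: algebra_simps)
    have knot: "real j * h \<in> {0..T}" if "j \<le> n" for j
      using mult_right_mono[of "real j" "real n" h] that h nh by simp
    have lip: "norm (y (Suc j) - y j) \<le> \<Lambda> * h" if j: "j < n" for j
    proof -
      have "norm (y (Suc j) - y j) \<le> (L * h) / \<kappa>"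
      proof (rule stable_step_bound)
        show "r (y (Suc j) - y j) + (DE (y j) - l (real j * h)) (y (Suc j) - y j) \<ge> 0"
          unfolding y_def by (rule incremental_stable)
        show "r (y (Suc j) - y j) + (DE (y (Suc j)) - l (real (Suc j) * h)) (y (Suc j) - y j) \<le> 0"
          unfolding y_def by (rule incremental_Suc)
        show "norm (l (real (Suc j) * h) - l (real j * h)) \<le> L * h"
          using l_diff[of "real (Suc j) * h" "real j * h"] knot[of j] knot[of "Suc j"] j h
          unfolding step by auto
      qed
      then show ?thesis by (simp add: \<Lambda>_def)
    qed
    have rng: "norm (y j) \<le> radius" if "j \<le> n" for j
    proof -
      have "norm (y j) \<le> norm z0 + \<Lambda> * (real j * h)"
        using that
      proof (induction j)
        case (Suc j)
        then show ?case
          using norm_triangle_ineq[of "y (Suc j) - y j" "y j"] lip[of j] by (simp add: algebra_simps)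
      qed (simp add: y_def incremental_0)
      also have "\<dots> \<le> norm z0 + \<Lambda> * T"
        using knot[OF that] \<Lambda> by (simp add: mult_left_mono)
      finally show ?thesis by (simp add: radius_def \<Lambda>_def)
    qed
    define u where "u t = (let j = nat \<lfloor>t / h\<rfloor> in y j + (t / h - real j) *\<^sub>R (y (Suc j) - y j))" for t
    have aff: "u t = y j + ((t - real j * h) / (real (Suc j) * h - real j * h)) *\<^sub>R (y (Suc j) - y j)"
      if t: "real j * h \<le> t" "t \<le> real (Suc j) * h" for j t
    proof (cases "t = real (Suc j) * h")
      case True
      then have e: "t / h = real (Suc j)" using h by simp
      have "nat \<lfloor>t / h\<rfloor> = Suc j" unfolding e by simp
      then have "u t = y (Suc j)" by (simp add: u_def e Let_def del: of_nat_Suc)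
      moreover have "(t - real j * h) / (real (Suc j) * h - real j * h) = 1"
        using h unfolding True step by simp
      ultimately show ?thesis by (simp only: scaleR_one) simp
    next
      case False
      then have "real j \<le> t / h" "t / h < real j + 1"
        using t h by (auto simp: pos_le_divide_eq pos_divide_less_eq algebra_simps)
      then have "nat \<lfloor>t / h\<rfloor> = j" by linarith
      then show ?thesis using h unfolding step by (simp add: u_def diff_divide_distrib)
    qed
    have s_less: "real j * h < real (Suc j) * h" and s_le: "real (Suc j) * h - real j * h \<le> h" for j
      using step[of j] h by linarith+
    have lip': "norm (y (Suc j) - y j) \<le> \<Lambda> * (real (Suc j) * h - real j * h)" if "j < n" for j
      unfolding step by (rule lip[OF that])
    \<comment> \<open>The flow rule is exact for unconstrained minimizers, so the interpolation
      lemma is used with the constant 0.\<close>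
    have dis: "r (y (Suc j) - y j) + (DE (y (Suc j)) - l (real (Suc j) * h)) (y (Suc j) - y j)
        \<le> 0 * (real (Suc j) * h - real j * h)\<^sup>2" for j
      using incremental_Suc(2)[of h j] unfolding y_def by simp
    have stab: "r v + (DE (y j) - l (real j * h)) v \<ge> 0" for j v
      unfolding y_def by (rule incremental_stable)
    have zero: "real 0 * h = 0" by simp
    note a = affine_interpolation_approx_solution[where s = "\<lambda>j. real j * h" and u = u,
        OF C(1,2) \<Lambda> order_refl n zero nh s_less s_le lip' dis stab rng aff]
    have a1: "approx_solution (K * (T / real n)) (G * \<Lambda>) (\<lambda>t. speed * t) u"
      unfolding speed_def K_def h_def[symmetric] \<Lambda>_def[symmetric] G_def using a(1) by simp
    have a2: "norm (u t) \<le> radius" if "t \<in> {0..T}" for t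
      using a(2) that by simp
    have "G * \<Lambda> \<le> K" "0 \<le> G * \<Lambda>" "0 \<le> K * (T / real n)"
      using G \<Lambda> K T_pos by (auto simp: K_def)
    then have "approx_solution (K * (T / real n)) K (\<lambda>t. speed * t) u"
      by (intro approx_solution_weaken[OF a1]) auto
    moreover have "u 0 = z0" using aff[of 0 0] h by (simp add: y_def incremental_0)
    ultimately show ?thesis using a2 by blast
  qed
  then show ?thesis using K by blast
qed


lemma speed_pos: "speed > 0"
  using L_nonneg \<kappa>_pos by (simp add: speed_def add_nonneg_pos)

text \<open>Every clause of the notion concerns at most two points of time, so pointwise convergence
  suffices and no derivative has to converge.\<close>

lemma approx_solution_limit:
  assumes u: "\<And>n. approx_solution (\<epsilon> n) K M (u n)" and \<epsilon>: "\<epsilon> \<longlonglongrightarrow> 0"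
    and z: "\<And>t. t \<in> {0..T} \<Longrightarrow> (\<lambda>n. u n t) \<longlonglongrightarrow> z t"
  shows "approx_solution 0 K M z"
  unfolding approx_solution_def
proof (intro conjI allI impI ballI)
  fix a b :: real assume ab: "0 \<le> a" "a \<le> b" "b \<le> T"
  have za: "(\<lambda>n. u n a) \<longlonglongrightarrow> z a" and zb: "(\<lambda>n. u n b) \<longlonglongrightarrow> z b" using z ab by auto
  have 1: "norm (u n b - u n a) \<le> M b - M a"
    and 2: "r (u n b - u n a) + (DE (u n a) - l a) (u n b - u n a) \<le> (M b - M a) * (\<epsilon> n + K * (M b - M a))" for n
    using u[of n] ab unfolding approx_solution_def by auto
  show "norm (z b - z a) \<le> M b - M a"
    by (rule LIMSEQ_le_const2[OF tendsto_norm[OF tendsto_diff[OF zb za]]]) (use 1 in auto)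
  have "(\<lambda>n. r (u n b - u n a) + (DE (u n a) - l a) (u n b - u n a)) \<longlonglongrightarrow> r (z b - z a) + (DE (z a) - l a) (z b - z a)"
    by (intro tendsto_intros r_tendsto blinfun.tendsto DE_tendsto za zb)
  moreover have "(\<lambda>n. (M b - M a) * (\<epsilon> n + K * (M b - M a))) \<longlonglongrightarrow> (M b - M a) * (0 + K * (M b - M a))"
    by (intro tendsto_intros \<epsilon>)
  ultimately show "r (z b - z a) + (DE (z a) - l a) (z b - z a) \<le> (M b - M a) * (0 + K * (M b - M a))"
    by (rule LIMSEQ_le) (use 2 in auto)
next
  fix t v assume t: "t \<in> {0..T}"
  have "(\<lambda>n. r v + (DE (u n t) - l t) v) \<longlonglongrightarrow> r v + (DE (z t) - l t) v"
    by (intro tendsto_intros blinfun.tendsto DE_tendsto z t)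
  moreover have "(\<lambda>n. - \<epsilon> n * norm v) \<longlonglongrightarrow> - 0 * norm v"
    by (intro tendsto_intros \<epsilon>)
  moreover have "- \<epsilon> n * norm v \<le> r v + (DE (u n t) - l t) v" for n
    using u[of n] t unfolding approx_solution_def by auto
  ultimately show "- 0 * norm v \<le> r v + (DE (z t) - l t) v"
    by (intro LIMSEQ_le) auto
qed

lemma exact_solution_exists:
  "\<exists>K z. K \<ge> 0 \<and> approx_solution 0 K (\<lambda>t. speed * t) z \<and> z 0 = z0 \<and> (\<forall>t\<in>{0..T}. norm (z t) \<le> radius)"
proof -
  obtain K where K: "K \<ge> 0" and ex: "\<forall>n>0. \<exists>u. approx_solution (K * (T / real n)) K (\<lambda>t. speed * t) u \<and>
     u 0 = z0 \<and> (\<forall>t\<in>{0..T}. norm (u t) \<le> radius)"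
    using approx_solutions_exist by (elim exE conjE)
  define \<epsilon> where "\<epsilon> n = K * (T / real (Suc n))" for n
  have "\<forall>n. \<exists>u. approx_solution (\<epsilon> n) K (\<lambda>t. speed * t) u \<and> u 0 = z0 \<and> (\<forall>t\<in>{0..T}. norm (u t) \<le> radius)"
    using ex unfolding \<epsilon>_def by (intro allI) (rule ex[rule_format], simp)
  from choice[OF this] obtain u where u: "\<forall>n. approx_solution (\<epsilon> n) K (\<lambda>t. speed * t) (u n) \<and> u n 0 = z0 \<and> (\<forall>t\<in>{0..T}. norm (u n t) \<le> radius)"
    by (elim exE)
  have \<epsilon>_nn: "\<epsilon> n \<ge> 0" for n using K T_pos by (simp add: \<epsilon>_def)
  have \<epsilon>_lim: "\<epsilon> \<longlonglongrightarrow> 0"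
  proof -
    have "(\<lambda>n. K * (T * (1 / real (Suc n)))) \<longlonglongrightarrow> K * (T * 0)"
      by (intro tendsto_intros LIMSEQ_Suc[OF lim_1_over_n])
    then show ?thesis by (simp add: \<epsilon>_def[abs_def])
  qed
  obtain K' where K': "K' \<ge> 0" and cmp:
    "\<forall>\<epsilon> M u1 u2. \<epsilon> \<ge> 0 \<longrightarrow> continuous_on {0..T} M \<longrightarrow>
      approx_solution \<epsilon> K M u1 \<longrightarrow> approx_solution \<epsilon> K M u2 \<longrightarrow> u1 0 = u2 0 \<longrightarrow>
      (\<forall>t\<in>{0..T}. norm (u1 t) \<le> radius \<and> norm (u2 t) \<le> radius) \<longrightarrow>
      (\<forall>t\<in>{0..T}. \<kappa> * (norm (u1 t - u2 t))\<^sup>2 \<le> \<epsilon> * exp (K' * (M t - M 0)))"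
    using approx_solution_compare[OF radius_nonneg K] by (elim exE conjE)
  \<comment> \<open>Interpolants of index beyond \<open>N\<close> are all approximate solutions for
    the larger error \<open>\<epsilon> N\<close>, and the comparison bounds their mutual
    distance.\<close>
  have "Cauchy (\<lambda>n. u n t)" if t: "t \<in> {0..T}" for t
  proof (rule metric_CauchyI)
    fix e :: real assume e: "e > 0"
    define X where "X = exp (K' * (speed * t - speed * 0))"
    have X: "X > 0" by (simp add: X_def)
    have "\<kappa> * e\<^sup>2 / X > 0" using \<kappa>_pos e X by simp
    from order_tendstoD(2)[OF \<epsilon>_lim this] obtain N where N: "\<And>n. n \<ge> N \<Longrightarrow> \<epsilon> n < \<kappa> * e\<^sup>2 / X"
      unfolding eventually_sequentially by (elim exE) auto
    have "dist (u i t) (u j t) < e" if ij: "N \<le> i" "N \<le> j" for i j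
    proof -
      have le: "\<epsilon> i \<le> \<epsilon> N" "\<epsilon> j \<le> \<epsilon> N"
        using ij K T_pos unfolding \<epsilon>_def by (auto intro!: mult_left_mono divide_left_mono)
      have wk: "approx_solution (\<epsilon> N) K (\<lambda>t. speed * t) (u k)" if "\<epsilon> k \<le> \<epsilon> N" for k
        by (rule approx_solution_weaken[OF u[THEN spec, THEN conjunct1] that]) (use \<epsilon>_nn K in auto)
      have "\<kappa> * (norm (u i t - u j t))\<^sup>2 \<le> \<epsilon> N * X"
        unfolding X_def
        by (rule cmp[rule_format, OF \<epsilon>_nn _ wk[OF le(1)] wk[OF le(2)] _ _ t]) (use u in \<open>auto intro!: continuous_intros\<close>)
      also have "\<dots> < \<kappa> * e\<^sup>2" using N[of N] X by (simp add: pos_less_divide_eq)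
      finally have "(norm (u i t - u j t))\<^sup>2 < e\<^sup>2" using \<kappa>_pos by simp
      then show ?thesis using e by (simp add: dist_norm power_less_imp_less_base)
    qed
    then show "\<exists>N. \<forall>i\<ge>N. \<forall>j\<ge>N. dist (u i t) (u j t) < e" by blast
  qed
  then have lim: "(\<lambda>n. u n t) \<longlonglongrightarrow> lim (\<lambda>n. u n t)" if "t \<in> {0..T}" for t
    using that by (simp add: Cauchy_convergent_iff convergent_LIMSEQ_iff)
  define z where "z t = lim (\<lambda>n. u n t)" for t
  have z: "(\<lambda>n. u n t) \<longlonglongrightarrow> z t" if "t \<in> {0..T}" for t
    using lim[OF that] by (simp add: z_def)
  have "approx_solution 0 K (\<lambda>t. speed * t) z"
    by (rule approx_solution_limit[OF _ \<epsilon>_lim z]) (use u in auto)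
  moreover have "z 0 = z0"
    using LIMSEQ_unique[OF z[of 0], of z0] u T_pos by simp
  moreover have "norm (z t) \<le> radius" if t: "t \<in> {0..T}" for t
    by (rule LIMSEQ_le_const2[OF tendsto_norm[OF z[OF t]]]) (use u t in auto)
  ultimately show ?thesis using K by blast
qed

lemma approx_solution_lipschitz:
  assumes "approx_solution \<epsilon> K (\<lambda>t. speed * t) z"
  shows "speed-lipschitz_on {0..T} z"
proof (rule lipschitz_onI)
  fix a b assume ab: "a \<in> {0..T}" "b \<in> {0..T}"
  have *: "norm (z b - z a) \<le> speed * (b - a)" if "0 \<le> a" "a \<le> b" "b \<le> T" for a b
    using assms that unfolding approx_solution_def by (auto simp: right_diff_distrib)
  show "dist (z a) (z b) \<le> speed * dist a b"
    using *[of a b] *[of b a] ab by (cases "a \<le> b") (auto simp: dist_norm norm_minus_commute)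
qed (use speed_pos in simp)

text \<open>The flow rule for increments passes to difference quotients, hence to their limits.\<close>

lemma exact_solution_derivative:
  assumes z: "approx_solution 0 K (\<lambda>t. speed * t) z"
  shows "\<exists>g. W11_with_deriv T z g \<and>
    (AE t in lebesgue_on {0..T}. \<forall>v. r v \<ge> r (g t) - (DE (z t) - l t) (v - g t))"
proof -
  \<comment> \<open>The clamped curve is constant outside [0,T], which extends the Lipschitz bound
    to the whole line.\<close>
  define clamp where "clamp t = max 0 (min T t)" for t :: real
  have clamp: "clamp t \<in> {0..T}" "t \<in> {0..T} \<Longrightarrow> clamp t = t" "\<bar>clamp s - clamp t\<bar> \<le> \<bar>s - t\<bar>" for s t
    using T_pos by (auto simp: clamp_def)
  have z_lip: "speed-lipschitz_on {0..T} z" by (rule approx_solution_lipschitz[OF z])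
  have "speed-lipschitz_on UNIV (\<lambda>t. z (clamp t))"
  proof (rule lipschitz_onI)
    fix s t
    have "dist (z (clamp s)) (z (clamp t)) \<le> speed * dist (clamp s) (clamp t)"
      by (rule lipschitz_onD[OF z_lip clamp(1) clamp(1)])
    also have "\<dots> \<le> speed * dist s t"
      by (rule mult_left_mono) (use clamp(3) speed_pos in \<open>auto simp: dist_real_def\<close>)
    finally show "dist (z (clamp s)) (z (clamp t)) \<le> speed * dist s t" .
  qed (use speed_pos in simp)
  from lipschitz_curve_derivative[OF T_pos this] obtain g where
    W: "W11_with_deriv T (\<lambda>t. z (clamp t)) g" and
    AE: "AE t in lebesgue_on {0..T}. \<exists>a b. (\<forall>n. 0 \<le> a n \<and> a n \<le> t \<and> t \<le> b n \<and> b n \<le> T \<and> a n < b n) \<and>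
       (\<lambda>n. b n - a n) \<longlonglongrightarrow> 0 \<and> (\<lambda>n. (1 / (b n - a n)) *\<^sub>R (z (clamp (b n)) - z (clamp (a n)))) \<longlonglongrightarrow> g t"
    by (elim exE conjE)
  have "W11_with_deriv T z g"
    using W clamp(2) T_pos unfolding W11_with_deriv_def by auto
  moreover from AE have "AE t in lebesgue_on {0..T}. \<forall>v. r v \<ge> r (g t) - (DE (z t) - l t) (v - g t)"
  proof eventually_elim
    case (elim t)
    then obtain a b where ab: "\<And>n. 0 \<le> a n" "\<And>n. a n \<le> t" "\<And>n. t \<le> b n" "\<And>n. b n \<le> T" "\<And>n. a n < b n"
      and h0: "(\<lambda>n. b n - a n) \<longlonglongrightarrow> 0"
      and "(\<lambda>n. (1 / (b n - a n)) *\<^sub>R (z (clamp (b n)) - z (clamp (a n)))) \<longlonglongrightarrow> g t"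
      by (elim exE conjE) auto
    moreover have "clamp (a n) = a n" "clamp (b n) = b n" for n
      using ab[of n] by (auto simp: clamp_def)
    ultimately have q: "(\<lambda>n. (1 / (b n - a n)) *\<^sub>R (z (b n) - z (a n))) \<longlonglongrightarrow> g t" by simp
    define q where "q n = (1 / (b n - a n)) *\<^sub>R (z (b n) - z (a n))" for n
    have t: "t \<in> {0..T}" using ab[of 0] by simp
    have a_in: "a n \<in> {0..T}" for n using ab[of n] by simp
    have q_lim: "q \<longlonglongrightarrow> g t" using q by (simp add: q_def[abs_def])
    have za: "(\<lambda>n. z (a n)) \<longlonglongrightarrow> z t"
    proof (rule LIM_zero_cancel, rule Lim_null_comparison)
      show "\<forall>\<^sub>F n in sequentially. norm (z (a n) - z t) \<le> speed * (b n - a n)"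
      proof (rule always_eventually, rule allI)
        fix n
        have "norm (z (a n) - z t) \<le> speed * \<bar>a n - t\<bar>"
          using lipschitz_onD[OF z_lip a_in t] by (simp add: dist_norm)
        also have "\<dots> \<le> speed * (b n - a n)"
          by (rule mult_left_mono) (use ab[of n] speed_pos in auto)
        finally show "norm (z (a n) - z t) \<le> speed * (b n - a n)" .
      qed
      show "(\<lambda>n. speed * (b n - a n)) \<longlonglongrightarrow> 0" using tendsto_mult_left[OF h0, of speed] by simp
    qed
    have la: "(\<lambda>n. l (a n)) \<longlonglongrightarrow> l t"
    proof (rule LIM_zero_cancel, rule Lim_null_comparison)
      show "\<forall>\<^sub>F n in sequentially. norm (l (a n) - l t) \<le> L * (b n - a n)"
      proof (rule always_eventually, rule allI)
        fix n
        have "norm (l (a n) - l t) \<le> L * \<bar>a n - t\<bar>" by (rule l_diff[OF a_in t])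
        also have "\<dots> \<le> L * (b n - a n)"
          by (rule mult_left_mono) (use ab[of n] L_nonneg in auto)
        finally show "norm (l (a n) - l t) \<le> L * (b n - a n)" .
      qed
      show "(\<lambda>n. L * (b n - a n)) \<longlonglongrightarrow> 0" using tendsto_mult_left[OF h0, of L] by simp
    qed
    \<comment> \<open>Division of the flow rule by the length of the interval leaves a slack
      proportional to this length, with the force frozen at \<open>a n\<close>.\<close>
    have le: "r (q n) + (DE (z (a n)) - l (a n)) (q n) \<le> speed * (K * speed) * (b n - a n)" for n
    proof -
      define h where "h = b n - a n"
      define d where "d = z (b n) - z (a n)"
      define p where "p = DE (z (a n)) - l (a n)"
      have h: "h > 0" using ab(5)[of n] by (simp add: h_def)
      have "r d + p d \<le> (speed * b n - speed * a n) * (0 + K * (speed * b n - speed * a n))"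
        using z ab(1,4)[of n] less_imp_le[OF ab(5)[of n]] unfolding approx_solution_def d_def p_def by auto
      also have "\<dots> = h * (speed * (K * speed) * h)" by (simp add: h_def algebra_simps)
      finally have "(1 / h) * (r d + p d) \<le> (1 / h) * (h * (speed * (K * speed) * h))"
        by (rule mult_left_mono) (use h in simp)
      moreover have "r ((1 / h) *\<^sub>R d) + p ((1 / h) *\<^sub>R d) = (1 / h) * (r d + p d)"
        using h by (simp add: r_scale blinfun.scaleR_right add_divide_distrib)
      ultimately show ?thesis
        using h unfolding q_def p_def[symmetric] h_def[symmetric] d_def[symmetric] by simp
    qed
    have "(\<lambda>n. r (q n) + (DE (z (a n)) - l (a n)) (q n)) \<longlonglongrightarrow> r (g t) + (DE (z t) - l t) (g t)"
      by (intro tendsto_intros r_tendsto blinfun.tendsto DE_tendsto za la q_lim)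
    moreover have "(\<lambda>n. speed * (K * speed) * (b n - a n)) \<longlonglongrightarrow> speed * (K * speed) * 0"
      by (intro tendsto_mult_left h0)
    ultimately have fl: "r (g t) + (DE (z t) - l t) (g t) \<le> speed * (K * speed) * 0"
      by (rule LIMSEQ_le) (use le in auto)
    \<comment> \<open>Stability tested with \<open>v\<close>, minus the limiting flow rule, is the
      inclusion.\<close>
    show ?case
    proof
      fix v
      have "- 0 * norm v \<le> r v + (DE (z t) - l t) v"
        using z t unfolding approx_solution_def by blast
      then show "r v \<ge> r (g t) - (DE (z t) - l t) (v - g t)"
        using fl by (simp add: blinfun.diff_right)
    qed
  qed
  ultimately show ?thesis by blast
qed

text \<open>Brings an arbitrary W11 solution into increment form. The inclusion yields flow rule and
  stability almost everywhere; stability extends to all times by continuity, and the flow rule is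
  integrated with the force frozen at \<open>a\<close>, through the sublinear functional
  \<open>r w + P a w\<close>.\<close>

lemma differential_solution_exact:
  assumes W: "W11_with_deriv T y g"
    and incl: "AE t in lebesgue_on {0..T}. \<forall>v. r v \<ge> r (g t) - (DE (y t) - l t) (v - g t)"
  shows "\<exists>K M. K \<ge> 0 \<and> continuous_on {0..T} M \<and> approx_solution 0 K M y"
proof -
  have "AE t in lebesgue. t \<in> {0..T} \<longrightarrow> (\<forall>v. r v \<ge> r (g t) - (DE (y t) - l t) (v - g t))"
    using incl by (subst (asm) AE_restrict_space_iff) auto
  then obtain N where N: "N \<in> null_sets lebesgue"
    "{t \<in> space lebesgue. \<not> (t \<in> {0..T} \<longrightarrow> (\<forall>v. r v \<ge> r (g t) - (DE (y t) - l t) (v - g t)))} \<subseteq> N"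
    unfolding eventually_ae_filter by (elim bexE)
  have negl: "negligible N" using N(1) by (simp add: negligible_iff_null_sets)
  have inc: "r v \<ge> r (g t) - (DE (y t) - l t) (v - g t)" if "t \<in> {0..T} - N" for t v
    using that N(2) by auto
  \<comment> \<open>The inclusion is tested with 0 for the flow rule, and with
    \<open>g t + v\<close> for stability.\<close>
  have flow: "r (g t) + (DE (y t) - l t) (g t) \<le> 0" if "t \<in> {0..T} - N" for t
    using inc[OF that, of 0] by (simp add: r_zero blinfun.minus_right)
  have stab: "r v + (DE (y t) - l t) v \<ge> 0" if "t \<in> {0..T} - N" for t v
    using inc[OF that, of "g t + v"] r_add[of "g t" v] by simp
  define m where "m t = norm (g t)" for t
  have m_int: "m integrable_on {0..T}"
    using W integrable_on_lebesgue_on[of "{0..T}" "\<lambda>t. norm (g t)"]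
    unfolding W11_with_deriv_def bochner_integrable_on_def m_def[abs_def] by simp
  \<comment> \<open>The integral controls the increments of \<open>y\<close>, the summand
    \<open>t\<close> those of the load.\<close>
  define M where "M t = integral {0..t} m + t" for t
  have M_cont: "continuous_on {0..T} M"
    unfolding M_def by (intro continuous_intros indefinite_integral_continuous_1[OF m_int])
  have m_sub: "m integrable_on {a..b}" if "0 \<le> a" "b \<le> T" for a b
    by (rule integrable_on_subinterval[OF m_int]) (use that in auto)
  have M_diff: "M b - M a = integral {a..b} m + (b - a)" if "0 \<le> a" "a \<le> b" "b \<le> T" for a b
    using Henstock_Kurzweil_Integration.integral_combine[OF that(1,2) m_sub[of 0 b]] that by (simp add: M_def)
  have m_nn: "integral {a..b} m \<ge> 0" if "0 \<le> a" "b \<le> T" for a b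
    by (rule integral_nonneg[OF m_sub[OF that]]) (simp add: m_def)
  have g_int: "(g has_integral (y b - y a)) {a..b}" if ab: "0 \<le> a" "a \<le> b" "b \<le> T" for a b
  proof -
    have 1: "(g has_integral (y a - y 0)) {0..a}" and 2: "(g has_integral (y b - y 0)) {0..b}"
      using W ab unfolding W11_with_deriv_def by auto
    have "g integrable_on {a..b}"
      by (rule integrable_on_subinterval[OF has_integral_integrable[OF 2]]) (use ab in auto)
    then have 3: "(g has_integral integral {a..b} g) {a..b}" by (rule integrable_integral)
    have "(y a - y 0) + integral {a..b} g = y b - y 0"
      by (rule has_integral_unique[OF has_integral_combine[OF ab(1,2) 1 3] 2])
    then have "integral {a..b} g = y b - y a" by (simp add: algebra_simps)
    then show ?thesis using 3 by simp
  qed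
  have y_le: "norm (y b - y a) \<le> integral {a..b} m" if ab: "0 \<le> a" "a \<le> b" "b \<le> T" for a b
    by (rule sublinear_integral_le[of norm 1, OF _ _ _ g_int[OF ab] integrable_integral[OF m_sub] negligible_empty])
      (use ab in \<open>auto simp: m_def intro: norm_triangle_ineq\<close>)
  have y_M: "norm (y b - y a) \<le> M b - M a" if ab: "0 \<le> a" "a \<le> b" "b \<le> T" for a b
    using y_le[OF ab] M_diff[OF ab] ab by simp
  define R where "R = norm (y 0) + (M T - M 0)"
  have "M T - M 0 \<ge> 0" using M_diff[of 0 T] m_nn[of 0 T] T_pos by simp
  then have R: "R \<ge> 0" by (simp add: R_def)
  have y_R: "norm (y t) \<le> R" if t: "t \<in> {0..T}" for t
  proof -
    have "norm (y t) \<le> norm (y 0) + norm (y t - y 0)"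
      using norm_triangle_ineq[of "y 0" "y t - y 0"] by simp
    also have "norm (y t - y 0) \<le> M t - M 0" using y_M[of 0 t] t by simp
    also have "M t \<le> M T" using M_diff[of t T] m_nn[of t T] t by simp
    finally show ?thesis by (simp add: R_def)
  qed
  obtain C where C: "C \<ge> 0"
    "\<And>x y. norm x \<le> R \<Longrightarrow> norm y \<le> R \<Longrightarrow> norm (DE y - DE x) \<le> C * norm (y - x)"
    "\<And>x y. norm x \<le> R \<Longrightarrow> norm y \<le> R \<Longrightarrow> norm (DE y - DE x - H x (y - x)) \<le> C * (norm (y - x))\<^sup>2"
    using local_bounds[OF R] by blast
  define P where "P t = DE (y t) - l t" for t
  have P_lip: "norm (P t - P a) \<le> (C + L) * (M t - M a)" if at: "0 \<le> a" "a \<le> t" "t \<le> T" for a t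
  proof -
    have "norm (DE (y t) - DE (y a)) \<le> C * norm (y t - y a)"
      by (rule C(2)) (use y_R at in auto)
    also have "\<dots> \<le> C * (M t - M a)" by (rule mult_left_mono[OF y_M[OF at] C(1)])
    finally have 1: "norm (DE (y t) - DE (y a)) \<le> C * (M t - M a)" .
    have "norm (l t - l a) \<le> L * (t - a)" using l_diff[of t a] at by simp
    also have "\<dots> \<le> L * (M t - M a)"
      by (rule mult_left_mono[OF _ L_nonneg]) (use M_diff[OF at] m_nn[of a t] at in auto)
    finally have 2: "norm (l t - l a) \<le> L * (M t - M a)" .
    have "P t - P a = (DE (y t) - DE (y a)) - (l t - l a)" by (simp add: P_def)
    then show ?thesis
      using norm_triangle_ineq4[of "DE (y t) - DE (y a)" "l t - l a"] 1 2
      by (simp only:) (simp add: algebra_simps)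
  qed
  have P_cont: "continuous_on {0..T} P"
    unfolding continuous_on_def
  proof
    fix t assume t: "t \<in> {0..T}"
    have "(M \<longlongrightarrow> M t) (at t within {0..T})" using M_cont t unfolding continuous_on_def by blast
    then have "((\<lambda>s. (C + L) * \<bar>M s - M t\<bar>) \<longlongrightarrow> (C + L) * \<bar>M t - M t\<bar>) (at t within {0..T})"
      by (intro tendsto_intros)
    then have 1: "((\<lambda>s. (C + L) * \<bar>M s - M t\<bar>) \<longlongrightarrow> 0) (at t within {0..T})" by simp
    have 2: "\<forall>\<^sub>F s in at t within {0..T}. norm (P s - P t) \<le> (C + L) * \<bar>M s - M t\<bar>"
    proof (unfold eventually_at_filter, rule always_eventually, intro allI impI)
      fix s assume s: "s \<noteq> t" "s \<in> {0..T}"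
      have Ma: "M a \<le> M b" if "0 \<le> a" "a \<le> b" "b \<le> T" for a b
        using M_diff[OF that] m_nn[of a b] that by simp
      show "norm (P s - P t) \<le> (C + L) * \<bar>M s - M t\<bar>"
      proof (cases "s \<le> t")
        case True
        then show ?thesis using P_lip[of s t] Ma[of s t] s t by (simp add: norm_minus_commute)
      next
        case False
        then show ?thesis using P_lip[of t s] Ma[of t s] s t by simp
      qed
    qed
    show "(P \<longlongrightarrow> P t) (at t within {0..T})"
      by (rule LIM_zero_cancel, rule Lim_null_comparison[OF 2 1])
  qed
  have stab_all: "r v + P t v \<ge> 0" if t: "t \<in> {0..T}" for t v
  proof (rule ccontr)
    assume neg: "\<not> r v + P t v \<ge> 0"
    define e where "e = - (r v + P t v)"
    have e: "e > 0" using neg by (simp add: e_def)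
    have "continuous_on {0..T} (\<lambda>s. P s v)"
      by (intro continuous_intros P_cont)
    then obtain d where d: "d > 0" "\<And>s. s \<in> {0..T} \<Longrightarrow> dist s t < d \<Longrightarrow> dist (P s v) (P t v) < e"
      using t e unfolding continuous_on_iff by meson
    \<comment> \<open>A strict violation at \<open>t\<close> would persist on this nonempty open
      interval, which cannot be negligible.\<close>
    let ?U = "{max 0 (t - d)<..<min T (t + d)}"
    have "?U \<subseteq> N"
    proof
      fix s assume s: "s \<in> ?U"
      have "dist (P s v) (P t v) < e" by (rule d(2)) (use s in \<open>auto simp: dist_real_def\<close>)
      then have "r v + P s v < 0" by (simp add: e_def dist_real_def)
      then show "s \<in> N" using stab[of s v] s unfolding P_def by force
    qed
    then have "negligible ?U" by (rule negligible_subset[OF negl])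
    moreover have "?U \<noteq> {}" using t d(1) T_pos by auto
    ultimately show False using open_not_negligible[of ?U] by simp
  qed
  have "approx_solution 0 (C + L) M y"
    unfolding approx_solution_def
  proof (intro conjI allI impI ballI)
    fix a b :: real assume ab: "0 \<le> a" "a \<le> b" "b \<le> T"
    show "norm (y b - y a) \<le> M b - M a" by (rule y_M[OF ab])
    define \<Delta> where "\<Delta> = M b - M a"
    have \<Delta>: "\<Delta> \<ge> 0" using M_diff[OF ab] m_nn[of a b] ab by (simp add: \<Delta>_def)
    have "r (y b - y a) + P a (y b - y a) \<le> (C + L) * \<Delta> * integral {a..b} m"
    proof (rule sublinear_integral_le[where f = g and a = a and b = b and N = N and \<rho> = "\<rho> + norm (P a)"
          and \<psi> = "\<lambda>t. (C + L) * \<Delta> * m t" and \<phi> = "\<lambda>w. r w + P a w"])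
      show "r (v + w) + P a (v + w) \<le> r v + P a v + (r w + P a w)" for v w
        using r_add[of v w] by (simp add: blinfun.add_right)
      show "r (c *\<^sub>R w) + P a (c *\<^sub>R w) = c * (r w + P a w)" if "c \<ge> 0" for c w
        using that by (simp add: r_scale_nonneg blinfun.scaleR_right distrib_left)
      show "r w + P a w \<le> (\<rho> + norm (P a)) * norm w" for w
        using r_le[of w] norm_blinfun[of "P a" w] by (simp add: distrib_right)
      show "(g has_integral (y b - y a)) {a..b}" by (rule g_int[OF ab])
      show "((\<lambda>t. (C + L) * \<Delta> * m t) has_integral (C + L) * \<Delta> * integral {a..b} m) {a..b}"
        by (rule has_integral_mult_right[OF integrable_integral[OF m_sub]]) (use ab in auto)
      fix t assume t: "t \<in> {a..b} - N"
      have "norm (P t - P a) \<le> (C + L) * (M t - M a)" by (rule P_lip) (use t ab in auto)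
      also have "\<dots> \<le> (C + L) * \<Delta>"
        by (rule mult_left_mono)
          (use M_diff[of t b] m_nn[of t b] t ab C(1) L_nonneg in \<open>auto simp: \<Delta>_def\<close>)
      finally have "norm (P t - P a) \<le> (C + L) * \<Delta>" .
      then have "norm (P t - P a) * m t \<le> (C + L) * \<Delta> * m t"
        by (rule mult_right_mono) (simp add: m_def)
      moreover have "\<bar>(P t - P a) (g t)\<bar> \<le> norm (P t - P a) * m t"
        using norm_blinfun[of "P t - P a" "g t"] by (simp add: m_def)
      moreover have "r (g t) + P t (g t) \<le> 0" using flow[of t] t ab by (simp add: P_def)
      ultimately show "r (g t) + P a (g t) \<le> (C + L) * \<Delta> * m t" by (simp add: blinfun.diff_left)
    qed (rule negl)
    also have "\<dots> \<le> (C + L) * \<Delta> * \<Delta>"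
      by (rule mult_left_mono) (use M_diff[OF ab] ab C(1) L_nonneg \<Delta> in \<open>auto simp: \<Delta>_def\<close>)
    also have "\<dots> = (M b - M a) * (0 + (C + L) * (M b - M a))" by (simp add: \<Delta>_def)
    finally show "r (y b - y a) + (DE (y a) - l a) (y b - y a) \<le> (M b - M a) * (0 + (C + L) * (M b - M a))"
      by (simp add: P_def)
  next
    fix t v assume "t \<in> {0..T}"
    then show "- 0 * norm v \<le> r v + (DE (y t) - l t) v" using stab_all[of t v] by (simp add: P_def)
  qed
  then show ?thesis using M_cont C(1) L_nonneg by (intro exI[of _ "C + L"] exI[of _ M]) auto
qed

text \<open>With \<open>\<epsilon> = 0\<close> the comparison forces equality;
  \<open>M1 + M2\<close> and \<open>K1 + K2\<close> are controls valid for both curves.\<close>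

lemma exact_solution_unique:
  assumes K: "K1 \<ge> 0" "K2 \<ge> 0" and M: "continuous_on {0..T} M1" "continuous_on {0..T} M2"
    and u: "approx_solution 0 K1 M1 u1" "approx_solution 0 K2 M2 u2"
    and init: "u1 0 = u2 0" and t: "t \<in> {0..T}"
  shows "u1 t = u2 t"
proof -
  have M_mono: "M b - M a \<ge> 0" if "approx_solution 0 K M v" "0 \<le> a" "a \<le> b" "b \<le> T" for K M v a b
    using that norm_ge_zero[of "v b - v a"] unfolding approx_solution_def by (meson order_trans)
  have w1: "approx_solution 0 (K1 + K2) (\<lambda>t. M1 t + M2 t) u1"
    by (rule approx_solution_weaken[OF u(1)]) (use K M_mono[OF u(2)] in auto)
  have w2: "approx_solution 0 (K1 + K2) (\<lambda>t. M1 t + M2 t) u2"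
    by (rule approx_solution_weaken[OF u(2)]) (use K M_mono[OF u(1)] in auto)
  define R where "R = norm (u1 0) + (M1 T + M2 T - (M1 0 + M2 0))"
  have bd: "norm (v t) \<le> R" if v: "approx_solution 0 (K1 + K2) (\<lambda>t. M1 t + M2 t) v" "v 0 = u1 0" and t: "t \<in> {0..T}" for v t
  proof -
    have "norm (v t - v 0) \<le> M1 t + M2 t - (M1 0 + M2 0)"
      using v(1) t unfolding approx_solution_def by auto
    moreover have "M1 T - M1 t \<ge> 0" "M2 T - M2 t \<ge> 0"
      using M_mono[OF u(1), of t T] M_mono[OF u(2), of t T] t by auto
    moreover have "norm (v t) \<le> norm (v 0) + norm (v t - v 0)"
      using norm_triangle_ineq[of "v 0" "v t - v 0"] by simp
    ultimately show ?thesis using v(2) by (simp add: R_def)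
  qed
  have R: "R \<ge> 0" using bd[OF w1 refl t] norm_ge_zero order_trans by blast
  obtain K' where "K' \<ge> 0" and cmp:
    "\<forall>\<epsilon> M u1 u2. \<epsilon> \<ge> 0 \<longrightarrow> continuous_on {0..T} M \<longrightarrow>
      approx_solution \<epsilon> (K1 + K2) M u1 \<longrightarrow> approx_solution \<epsilon> (K1 + K2) M u2 \<longrightarrow> u1 0 = u2 0 \<longrightarrow>
      (\<forall>t\<in>{0..T}. norm (u1 t) \<le> R \<and> norm (u2 t) \<le> R) \<longrightarrow>
      (\<forall>t\<in>{0..T}. \<kappa> * (norm (u1 t - u2 t))\<^sup>2 \<le> \<epsilon> * exp (K' * (M t - M 0)))"
    using approx_solution_compare[OF R add_nonneg_nonneg[OF K]] by (elim exE conjE)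
  have "\<kappa> * (norm (u1 t - u2 t))\<^sup>2 \<le> 0 * exp (K' * ((M1 t + M2 t) - (M1 0 + M2 0)))"
    by (rule cmp[rule_format, OF _ _ w1 w2 init _ t]) (use bd[OF w1] bd[OF w2] init in \<open>auto intro!: continuous_intros M\<close>)
  then have "(norm (u1 t - u2 t))\<^sup>2 \<le> 0" using \<kappa>_pos by (simp add: mult_le_0_iff)
  then show ?thesis by simp
qed

text \<open>The comparison bounds the squared distance by a multiple of \<tau>, which is the origin
  of the square root. \<open>D\<close> is fixed before \<tau> and \<open>u\<close>.\<close>

lemma approx_solution_error:
  assumes z: "approx_solution 0 K (\<lambda>t. speed * t) z" "z 0 = z0" "\<forall>t\<in>{0..T}. norm (z t) \<le> radius"
    and K: "K \<ge> 0" "K' \<ge> 0" "c \<ge> 0"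
  shows "\<exists>D>0. \<forall>\<tau>>0. \<forall>u. approx_solution (c * \<tau>) K' (\<lambda>t. speed * t) u \<longrightarrow> u 0 = z0 \<longrightarrow>
    (\<forall>t\<in>{0..T}. norm (u t) \<le> radius) \<longrightarrow> (\<forall>t\<in>{0..T}. norm (z t - u t) \<le> D * sqrt \<tau>)"
proof -
  obtain B where B: "B \<ge> 0" and cmp: "\<forall>\<epsilon> M u1 u2. \<epsilon> \<ge> 0 \<longrightarrow> continuous_on {0..T} M \<longrightarrow>
      approx_solution \<epsilon> (K + K') M u1 \<longrightarrow> approx_solution \<epsilon> (K + K') M u2 \<longrightarrow> u1 0 = u2 0 \<longrightarrow>
      (\<forall>t\<in>{0..T}. norm (u1 t) \<le> radius \<and> norm (u2 t) \<le> radius) \<longrightarrow>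
      (\<forall>t\<in>{0..T}. \<kappa> * (norm (u1 t - u2 t))\<^sup>2 \<le> \<epsilon> * exp (B * (M t - M 0)))"
    using approx_solution_compare[OF radius_nonneg add_nonneg_nonneg[OF K(1,2)]] by (elim exE conjE)
  define X where "X = exp (B * (speed * T))"
  \<comment> \<open>The summand 1 keeps \<open>D\<close> positive when \<open>c = 0\<close>.\<close>
  define D where "D = sqrt (c * X / \<kappa>) + 1"
  have X: "X > 0" by (simp add: X_def)
  have cX: "c * X / \<kappa> \<ge> 0" using K(3) X \<kappa>_pos by simp
  show ?thesis
  proof (intro exI[of _ D] conjI allI impI ballI)
    show "D > 0" unfolding D_def by (rule add_nonneg_pos[OF real_sqrt_ge_zero[OF cX]]) simp
    fix \<tau> u t
    assume \<tau>: "\<tau> > 0" and u: "approx_solution (c * \<tau>) K' (\<lambda>t. speed * t) u" "u 0 = z0" "\<forall>t\<in>{0..T}. norm (u t) \<le> radius"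
      and t: "t \<in> {0..T}"
    have ct: "c * \<tau> \<ge> 0" using K(3) \<tau> by simp
    have w1: "approx_solution (c * \<tau>) (K + K') (\<lambda>t. speed * t) z"
      by (rule approx_solution_weaken[OF z(1)]) (use ct K in auto)
    have w2: "approx_solution (c * \<tau>) (K + K') (\<lambda>t. speed * t) u"
      by (rule approx_solution_weaken[OF u(1)]) (use ct K in auto)
    have "\<kappa> * (norm (z t - u t))\<^sup>2 \<le> c * \<tau> * exp (B * (speed * t - speed * 0))"
      by (rule cmp[rule_format, OF ct _ w1 w2 _ _ t]) (use z u in \<open>auto intro!: continuous_intros\<close>)
    also have "\<dots> \<le> c * \<tau> * X"
      unfolding X_def by (rule mult_left_mono) (use t B speed_pos ct in \<open>auto intro!: mult_left_mono\<close>)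
    finally have "(norm (z t - u t))\<^sup>2 \<le> c * X / \<kappa> * \<tau>"
      using \<kappa>_pos by (simp add: field_simps)
    then have "norm (z t - u t) \<le> sqrt (c * X / \<kappa> * \<tau>)" by (rule real_le_rsqrt)
    also have "\<dots> = sqrt (c * X / \<kappa>) * sqrt \<tau>" by (rule real_sqrt_mult)
    also have "\<dots> \<le> D * sqrt \<tau>" by (rule mult_right_mono) (use \<tau> in \<open>auto simp: D_def\<close>)
    finally show "norm (z t - u t) \<le> D * sqrt \<tau>" .
  qed
qed

end

section \<open>The local incremental minimization scheme\<close>

text \<open>The load estimate is stated with the V norm of the test vector as well: constraint and
  multipliers are measured in V, and the estimate of a step is divided by that norm.\<close>

locale local_minimization = rate_independent T L \<kappa> \<rho> r E DE H l z0
  for T L \<kappa> \<rho> :: real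
    and r E :: "'z::{real_inner, banach} \<Rightarrow> real"
    and DE :: "'z \<Rightarrow> ('z \<Rightarrow>\<^sub>L real)"
    and H :: "'z \<Rightarrow> ('z \<Rightarrow>\<^sub>L ('z \<Rightarrow>\<^sub>L real))"
    and l :: "real \<Rightarrow> ('z \<Rightarrow>\<^sub>L real)"
    and z0 :: 'z +
  fixes i :: "'z \<Rightarrow>\<^sub>L 'v::real_normed_vector"
    and \<tau> :: real and ts :: "nat \<Rightarrow> real" and zs :: "nat \<Rightarrow> 'z"
  assumes i_le: "\<And>v. norm (i v) \<le> norm v"
    and i_inj: "\<And>v. i v = 0 \<Longrightarrow> v = 0"
    and l_lip_weak: "\<And>s t v. s \<in> {0..T} \<Longrightarrow> t \<in> {0..T} \<Longrightarrow> \<bar>(l s - l t) v\<bar> \<le> L * \<bar>s - t\<bar> * norm (i v)"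
    and \<tau>_pos: "\<tau> > 0"
    and ts_0: "ts 0 = 0" and zs_0: "zs 0 = z0"
    and zs_min: "\<And>k v. norm (i (v - zs k)) \<le> \<tau> \<Longrightarrow>
      E (zs (Suc k)) - l (ts k) (zs (Suc k)) + r (zs (Suc k) - zs k) \<le> E v - l (ts k) v + r (v - zs k)"
    and zs_step: "\<And>k. norm (i (zs (Suc k) - zs k)) \<le> \<tau>"
    and ts_Suc: "\<And>k. ts (Suc k) = min (ts k + \<tau> - norm (i (zs (Suc k) - zs k))) T"
begin

lemma ts_le_T: "ts k \<le> T"
  by (cases k) (use ts_0 T_pos ts_Suc in auto)

lemma ts_Suc_ge: "ts k \<le> ts (Suc k)"
  using ts_le_T[of k] zs_step[of k] by (simp add: ts_Suc)

lemma ts_mono: "a \<le> b \<Longrightarrow> ts a \<le> ts b"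
  using lift_Suc_mono_le[of ts a b] ts_Suc_ge by blast

lemma ts_in: "ts k \<in> {0..T}"
  using ts_mono[of 0 k] ts_0 ts_le_T by simp

section \<open>Multipliers of the step constraint\<close>

definition incr :: "nat \<Rightarrow> 'z" where "incr k = zs (Suc k) - zs k"

definition force :: "nat \<Rightarrow> ('z \<Rightarrow>\<^sub>L real)" where "force k = DE (zs k) - l (ts (k - 1))"

text \<open>\<open>\<mu> k / \<tau>\<close> plays the role of the Lagrange multiplier of the constraint in the \<open>k\<close>-th step.
  The truncated \<open>k - 1\<close> makes \<open>force 0\<close> the force at the stable initial state.\<close>

definition \<mu> :: "nat \<Rightarrow> real" where
  "\<mu> k = (case k of 0 \<Rightarrow> 0 | Suc m \<Rightarrow> - (r (incr m) + force (Suc m) (incr m)) / \<tau>)"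

lemma \<mu>_0: "\<mu> 0 = 0"
  by (simp add: \<mu>_def)

lemma \<mu>_Suc: "r (incr k) + force (Suc k) (incr k) = - \<mu> (Suc k) * \<tau>"
  using \<tau>_pos by (simp add: \<mu>_def)

text \<open>Euler-Lagrange condition of one step: the increment minimizes \<open>r\<close> plus the
  linear force term over the \<tau>-ball of V. The ball is convex, so the segment from the increment
  to \<open>v\<close> is admissible.\<close>

lemma constrained_variation:
  assumes v: "norm (i v) \<le> \<tau>"
  shows "r (incr k) + force (Suc k) (incr k) \<le> r v + force (Suc k) v"
proof -
  have "0 \<le> (DE (zs (Suc k)) - l (ts k)) (v - incr k) + r (zs (Suc k) + (v - incr k) - zs k) - r (zs (Suc k) - zs k)"
  proof (rule segment_minimizer_variation)
    fix s :: real assume s: "0 < s" "s \<le> 1"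
    have "zs (Suc k) + s *\<^sub>R (v - incr k) - zs k = (1 - s) *\<^sub>R incr k + s *\<^sub>R v"
      by (simp add: incr_def algebra_simps)
    then have "norm (i (zs (Suc k) + s *\<^sub>R (v - incr k) - zs k)) \<le> (1 - s) * norm (i (incr k)) + s * norm (i v)"
      using norm_triangle_ineq[of "(1 - s) *\<^sub>R i (incr k)" "s *\<^sub>R i v"] s
      by (simp add: blinfun.add_right blinfun.scaleR_right)
    also have "\<dots> \<le> (1 - s) * \<tau> + s * \<tau>"
      by (intro add_mono mult_left_mono v) (use s zs_step in \<open>auto simp: incr_def\<close>)
    finally show "E (zs (Suc k)) - l (ts k) (zs (Suc k)) + r (zs (Suc k) - zs k)
      \<le> E (zs (Suc k) + s *\<^sub>R (v - incr k)) - l (ts k) (zs (Suc k) + s *\<^sub>R (v - incr k)) + r (zs (Suc k) + s *\<^sub>R (v - incr k) - zs k)"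
      by (intro zs_min) (simp add: algebra_simps)
  qed
  then show ?thesis by (simp add: force_def incr_def blinfun.diff_right)
qed

lemma \<mu>_nonneg: "\<mu> k \<ge> 0"
proof (cases k)
  case (Suc m)
  have "- \<mu> (Suc m) * \<tau> \<le> 0"
    using constrained_variation[of 0 m] \<tau>_pos unfolding \<mu>_Suc by (simp add: r_zero)
  then show ?thesis using \<tau>_pos Suc by (simp add: zero_le_mult_iff)
qed (simp add: \<mu>_0)

text \<open>By homogeneity, with \<open>v\<close> scaled to the boundary of the constraint ball.
  Thus \<open>\<mu> k\<close> bounds the violation of stability, measured in V.\<close>

lemma multiplier_bound: "- \<mu> k * norm (i v) \<le> r v + force k v"
proof (cases k)
  case 0
  then show ?thesis using z0_stable by (simp add: \<mu>_0 force_def ts_0 zs_0)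
next
  case (Suc m)
  show ?thesis
  proof (cases "v = 0")
    case False
    define n where "n = norm (i v)"
    have n: "n > 0" using i_inj[of v] False by (auto simp: n_def)
    have c: "\<tau> / n > 0" using n \<tau>_pos by simp
    have "norm (i ((\<tau> / n) *\<^sub>R v)) \<le> \<tau>"
      using n \<tau>_pos by (simp add: blinfun.scaleR_right n_def)
    then have "- \<mu> (Suc m) * \<tau> \<le> r ((\<tau> / n) *\<^sub>R v) + force (Suc m) ((\<tau> / n) *\<^sub>R v)"
      using constrained_variation[of _ m] unfolding \<mu>_Suc by blast
    also have "\<dots> = (\<tau> / n) * (r v + force (Suc m) v)"
      using c by (simp only: r_scale blinfun.scaleR_right distrib_left real_scaleR_def)
    finally have "(n / \<tau>) * (- \<mu> (Suc m) * \<tau>) \<le> (n / \<tau>) * ((\<tau> / n) * (r v + force (Suc m) v))"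
      by (rule mult_left_mono) (use n \<tau>_pos in simp)
    then show ?thesis using n \<tau>_pos Suc by (simp add: n_def[symmetric] mult.commute)
  qed (simp add: r_zero)
qed

text \<open>Complementarity: tested with the increment itself, the multiplier bound reads
  \<open>\<mu> (Suc k) * (\<tau> - norm (i (incr k))) \<le> 0\<close>.\<close>

lemma \<mu>_inactive: "norm (i (incr k)) < \<tau> \<Longrightarrow> \<mu> (Suc k) = 0"
proof -
  assume lt: "norm (i (incr k)) < \<tau>"
  have "\<mu> (Suc k) * (\<tau> - norm (i (incr k))) \<le> 0"
    using multiplier_bound[of "Suc k" "incr k"] unfolding \<mu>_Suc by (simp add: algebra_simps)
  then have "\<mu> (Suc k) \<le> 0" using lt by (simp add: mult_le_0_iff)
  then show ?thesis using \<mu>_nonneg[of "Suc k"] by simp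
qed

text \<open>Either the constraint is active or the multiplier vanishes, so \<tau> may be replaced by
  the V norm of the increment.\<close>

lemma flow_step: "r (incr k) + force (Suc k) (incr k) = - \<mu> (Suc k) * norm (i (incr k))"
proof (cases "norm (i (incr k)) < \<tau>")
  case False
  then have "norm (i (incr k)) = \<tau>" using zs_step[of k] by (simp add: incr_def)
  then show ?thesis using \<mu>_Suc[of k] by simp
qed (use \<mu>_Suc[of k] in \<open>simp add: \<mu>_inactive\<close>)

text \<open>Testing the flow rule of a step with the multiplier bound of the previous one yields an
  estimate that telescopes; multipliers vanish at every step in which time progresses.\<close>

lemma step_bound: "\<kappa> * norm (incr k) + \<mu> (Suc k) \<le> \<mu> k + L * (ts k - ts (k - 1))"
proof (cases "incr k = 0")
  case True
  have "\<mu> (Suc k) = 0" by (rule \<mu>_inactive) (simp add: True \<tau>_pos)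
  then show ?thesis using True \<mu>_nonneg[of k] L_nonneg ts_mono[of "k - 1" k] by simp
next
  case False
  define n where "n = norm (i (incr k))"
  have n: "n > 0" using i_inj[of "incr k"] False by (auto simp: n_def)
  have "(force (Suc k) - force k) (incr k) \<le> (\<mu> k - \<mu> (Suc k)) * n"
    using flow_step[of k] multiplier_bound[of k "incr k"] by (simp add: n_def blinfun.diff_left algebra_simps)
  moreover have "(force (Suc k) - force k) (incr k) = (DE (zs (Suc k)) - DE (zs k)) (incr k) - (l (ts k) - l (ts (k - 1))) (incr k)"
    by (simp add: force_def blinfun.diff_left)
  moreover have "\<kappa> * (norm (incr k))\<^sup>2 \<le> (DE (zs (Suc k)) - DE (zs k)) (incr k)"
    unfolding incr_def by (rule DE_mono)
  moreover have "(l (ts k) - l (ts (k - 1))) (incr k) \<le> L * (ts k - ts (k - 1)) * n"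
    using l_lip_weak[OF ts_in ts_in, of k "k - 1" "incr k"] ts_mono[of "k - 1" k] by (simp add: n_def)
  \<comment> \<open>The norm bound of the embedding trades one factor \<open>norm (incr k)\<close>
    for the V norm \<open>n\<close>, by which the inequality is divided below.\<close>
  moreover have "\<kappa> * norm (incr k) * n \<le> \<kappa> * (norm (incr k))\<^sup>2"
    using i_le[of "incr k"] \<kappa>_pos by (simp add: n_def power2_eq_square mult_left_mono)
  ultimately have "\<kappa> * norm (incr k) * n \<le> (\<mu> k - \<mu> (Suc k)) * n + L * (ts k - ts (k - 1)) * n" by linarith
  then have "(\<kappa> * norm (incr k)) * n \<le> (\<mu> k - \<mu> (Suc k) + L * (ts k - ts (k - 1))) * n"
    by (simp add: distrib_right)
  then have "\<kappa> * norm (incr k) \<le> \<mu> k - \<mu> (Suc k) + L * (ts k - ts (k - 1))"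
    by (rule mult_right_le_imp_le[OF _ n])
  then show ?thesis by simp
qed

lemma block_bound:
  "a \<le> b \<Longrightarrow> \<kappa> * (\<Sum>k=a..<b. norm (incr k)) + \<mu> b \<le> \<mu> a + L * (ts (b - 1) - ts (a - 1))"
proof (induction b rule: dec_induct)
  case (step m)
  have "(\<Sum>k=a..<Suc m. norm (incr k)) = (\<Sum>k=a..<m. norm (incr k)) + norm (incr m)"
    using step.hyps by simp
  then show ?case using step.IH step_bound[of m] by (simp add: algebra_simps)
qed simp

lemma zs_diff: "a \<le> b \<Longrightarrow> zs b - zs a = (\<Sum>k=a..<b. incr k)"
  unfolding incr_def by (simp add: sum_Suc_diff')

lemma norm_zs_diff_le: "a \<le> b \<Longrightarrow> norm (zs b - zs a) \<le> (\<Sum>k=a..<b. norm (incr k))"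
  unfolding zs_diff by (rule norm_sum)

text \<open>Telescoping from index 0, where the multiplier vanishes because the initial state is
  stable.\<close>

lemma total_variation: "\<kappa> * (\<Sum>k<b. norm (incr k)) \<le> L * T"
proof -
  have "\<kappa> * (\<Sum>k=0..<b. norm (incr k)) + \<mu> b \<le> \<mu> 0 + L * (ts (b - 1) - ts (0 - 1))"
    by (rule block_bound) simp
  moreover have "L * ts (b - 1) \<le> L * T" by (rule mult_left_mono[OF ts_le_T L_nonneg])
  ultimately show ?thesis
    using \<mu>_nonneg[of b] by (simp add: \<mu>_0 ts_0 atLeast0LessThan)
qed

lemma norm_zs_le_radius: "norm (zs k) \<le> radius"
proof -
  have "\<kappa> * norm (zs k - z0) \<le> \<kappa> * (\<Sum>j<k. norm (incr j))"
    using norm_zs_diff_le[of 0 k] \<kappa>_pos by (simp add: zs_0 atLeast0LessThan)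
  also have "\<dots> \<le> L * T" by (rule total_variation)
  finally have "norm (zs k - z0) \<le> L / \<kappa> * T" using \<kappa>_pos by (simp add: field_simps)
  then show ?thesis
    using norm_triangle_ineq[of "zs k - z0" z0] by (simp add: radius_def)
qed

lemma sum_norm_i_incr_le: "(\<Sum>k<b. norm (i (incr k))) \<le> L * T / \<kappa>"
proof -
  have "(\<Sum>k<b. norm (i (incr k))) \<le> (\<Sum>k<b. norm (incr k))" by (rule sum_mono) (rule i_le)
  also have "\<dots> \<le> L * T / \<kappa>" using total_variation[of b] \<kappa>_pos by (simp add: field_simps)
  finally show ?thesis .
qed

text \<open>Before \<open>T\<close> is reached, elapsed time plus the V length of the path equals
  \<open>k * \<tau>\<close>, while the length is bounded.\<close>

lemma reaches_T: "\<exists>k. ts k = T"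
proof (rule ccontr)
  assume "\<not> (\<exists>k. ts k = T)"
  then have ne: "ts k \<noteq> T" for k by blast
  have eq: "ts k = real k * \<tau> - (\<Sum>j<k. norm (i (incr j)))" for k
  proof (induction k)
    case (Suc k)
    have "ts (Suc k) = ts k + \<tau> - norm (i (incr k))"
      using ts_Suc[of k] ne[of "Suc k"] by (auto simp: incr_def min_def split: if_splits)
    then show ?case using Suc by (simp add: algebra_simps)
  qed (simp add: ts_0)
  obtain k :: nat where "(T + L * T / \<kappa>) / \<tau> < real k" using reals_Archimedean2 by blast
  then have "T + L * T / \<kappa> < real k * \<tau>" by (simp only: pos_divide_less_eq[OF \<tau>_pos])
  then show False using eq[of k] ts_le_T[of k] sum_norm_i_incr_le[of k] by linarith
qed

section \<open>Progress indices and their enumeration\<close>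

definition N :: nat where "N = (LEAST k. ts k = T)"

lemma ts_N: "ts N = T"
  unfolding N_def using reaches_T by (rule LeastI_ex)

lemma ts_before_N: "k < N \<Longrightarrow> ts k < T"
  using not_less_Least[of k "\<lambda>k. ts k = T"] ts_le_T[of k] unfolding N_def by simp

lemma ts_after_N: "N \<le> k \<Longrightarrow> ts k = T"
  using ts_mono[of N k] ts_N ts_le_T[of k] by simp

lemma N_pos: "N > 0"
  using ts_N ts_0 T_pos by (cases "N = 0") auto

text \<open>As long as no stable iterate appears after \<open>N\<close>, every step has length
  \<tau> in V, against the bounded total length.\<close>

lemma eventually_stable: "\<exists>k>N. \<forall>v. r v + (DE (zs k) - l T) v \<ge> 0"
proof (rule ccontr)
  assume H: "\<not> ?thesis"
  have big: "norm (i (incr k)) \<ge> \<tau>" if "k \<ge> N" for k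
  proof (rule ccontr)
    assume "\<not> norm (i (incr k)) \<ge> \<tau>"
    then have "\<mu> (Suc k) = 0" by (intro \<mu>_inactive) simp
    then have "\<forall>v. r v + (DE (zs (Suc k)) - l T) v \<ge> 0"
      using multiplier_bound[of "Suc k"] ts_after_N[OF that] by (simp add: force_def)
    then show False using H that by (meson le_imp_less_Suc)
  qed
  obtain m :: nat where "(L * T / \<kappa>) / \<tau> < real m" using reals_Archimedean2 by blast
  then have "L * T / \<kappa> < real m * \<tau>" by (simp only: pos_divide_less_eq[OF \<tau>_pos])
  also have "\<dots> = (\<Sum>k=N..<N + m. \<tau>)" by simp
  also have "\<dots> \<le> (\<Sum>k=N..<N + m. norm (i (incr k)))" by (rule sum_mono) (use big in simp)
  also have "\<dots> \<le> (\<Sum>k<N + m. norm (i (incr k)))" by (rule sum_mono2) auto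
  finally show False using sum_norm_i_incr_le[of "N + m"] by simp
qed

definition N' :: nat where "N' = (LEAST k. N < k \<and> (\<forall>v. r v + (DE (zs k) - l T) v \<ge> 0))"

lemma N': "N < N'" "r v + (DE (zs N') - l T) v \<ge> 0"
  using LeastI_ex[OF eventually_stable] unfolding N'_def by auto

text \<open>\<open>S\<close>, \<open>kk\<close> and \<open>J\<close> repeat the local names in
  \<open>affine_interpolant\<close>, so that the two forms of the interpolant agree by
  unfolding.\<close>

definition S :: "nat set" where "S = progress_indices N N' ts"

definition kk :: "nat \<Rightarrow> nat" where "kk j = sorted_list_of_set S ! j"

definition J :: nat where "J = card S - 1"

lemma S_iff: "m \<in> S \<longleftrightarrow> m = 0 \<or> m = N' \<or> (1 \<le> m \<and> m \<le> N \<and> ts (m - 1) < ts m)"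
  by (auto simp: S_def progress_indices_def)

lemma S_finite: "finite S"
  unfolding S_def progress_indices_def by simp

lemma S_members: "0 \<in> S" "N' \<in> S" "N \<in> S"
proof -
  show "0 \<in> S" "N' \<in> S" by (simp_all add: S_iff)
  have "ts (N - 1) < ts N" using ts_before_N[of "N - 1"] N_pos ts_N by simp
  then show "N \<in> S" using N_pos by (simp add: S_iff)
qed

lemma S_le: "m \<in> S \<Longrightarrow> m = N' \<or> m \<le> N"
  by (auto simp: S_iff)

lemma card_S: "card S = J + 1" "J \<ge> 2"
proof -
  have "card {0, N, N'} \<le> card S" by (rule card_mono[OF S_finite]) (use S_members in auto)
  moreover have "card {0, N, N'} = 3" using N_pos N'(1) by simp
  ultimately show "card S = J + 1" "J \<ge> 2" by (auto simp: J_def)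
qed

lemma kk_less: "j < j' \<Longrightarrow> j' \<le> J \<Longrightarrow> kk j < kk j'"
  unfolding kk_def
  using strict_sorted_iff[of "sorted_list_of_set S"] card_S
  by (intro sorted_wrt_nth_less[OF strict_sorted_list_of_set]) auto

lemma kk_in: "j \<le> J \<Longrightarrow> kk j \<in> S"
  unfolding kk_def using nth_mem[of j "sorted_list_of_set S"] S_finite card_S by simp

lemma kk_surj: "m \<in> S \<Longrightarrow> \<exists>j\<le>J. kk j = m"
  unfolding kk_def using in_set_conv_nth[of m "sorted_list_of_set S"] S_finite card_S
  by (auto simp: less_Suc_eq_le)

lemma kk_less_iff: "j \<le> J \<Longrightarrow> j' \<le> J \<Longrightarrow> kk j < kk j' \<longleftrightarrow> j < j'"
  using kk_less[of j j'] kk_less[of j' j] by (cases j j' rule: linorder_cases) auto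

lemma kk_0: "kk 0 = 0"
proof -
  obtain j where "j \<le> J" "kk j = 0" using kk_surj S_members(1) by blast
  then show ?thesis using kk_less[of 0 j] by (cases j) auto
qed

lemma kk_J: "kk J = N'"
proof -
  obtain j where j: "j \<le> J" "kk j = N'" using kk_surj S_members(2) by blast
  have "kk J \<le> N'" using S_le[OF kk_in[of J]] N'(1) by auto
  then show ?thesis using kk_less[of j J] j by (cases "j = J") auto
qed

lemma kk_N: "kk (J - 1) = N"
proof -
  obtain j where j: "j \<le> J" "kk j = N" using kk_surj S_members(3) by blast
  have "j \<noteq> J" using j kk_J N'(1) by auto
  then have "j \<le> J - 1" using j by simp
  moreover have "kk (J - 1) \<le> N"
    using S_le[OF kk_in[of "J - 1"]] kk_less[of "J - 1" J] card_S(2) kk_J by auto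
  ultimately show ?thesis using kk_less[of j "J - 1"] j card_S(2) by (cases "j = J - 1") auto
qed

text \<open>A positive time increment leaves the step strictly inside the constraint ball, which
  makes the multiplier vanish.\<close>

lemma kk_progress:
  assumes "1 \<le> j" "j \<le> J - 1"
  shows "kk j > 0" "kk j \<le> N" "ts (kk j - 1) < ts (kk j)" "\<mu> (kk j) = 0"
proof -
  have j: "j \<le> J" using assms by simp
  show pos: "kk j > 0" using kk_less[of 0 j] assms j kk_0 by simp
  have "kk j < N'" using kk_less[of j J] assms card_S(2) kk_J by simp
  then show "kk j \<le> N" "ts (kk j - 1) < ts (kk j)"
    using kk_in[OF j] pos by (auto simp: S_iff)
  then obtain m where m: "kk j = Suc m" "ts m < ts (Suc m)"
    using pos by (cases "kk j") auto
  have "norm (i (incr m)) < \<tau>" using ts_Suc[of m] m(2) by (simp add: incr_def)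
  then show "\<mu> (kk j) = 0" using \<mu>_inactive m(1) by simp
qed

text \<open>Indices strictly inside a block are not in \<open>S\<close>, so time stands still there;
  in the last block, from \<open>N\<close> to \<open>N'\<close>, it stays at
  \<open>T\<close>.\<close>

lemma ts_block:
  assumes "j < J" "kk j \<le> m" "m < kk (Suc j)"
  shows "ts m = ts (kk j)"
  using assms(2,3)
proof (induction m rule: dec_induct)
  case (step m)
  have nin: "Suc m \<notin> S"
  proof
    assume "Suc m \<in> S"
    then obtain j' where j': "j' \<le> J" "kk j' = Suc m" using kk_surj by blast
    then have "j < j'" "j' < Suc j"
      using kk_less_iff[of j j'] kk_less_iff[of j' "Suc j"] step assms(1) by auto
    then show False by simp
  qed
  have "ts (Suc m) = ts m"
  proof (cases "Suc m \<le> N")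
    case True
    then show ?thesis using nin ts_Suc_ge[of m] by (auto simp: S_iff)
  qed (use ts_after_N in auto)
  then show ?case using step by simp
qed simp

section \<open>Knots and nodal values of the interpolant\<close>

definition s :: "nat \<Rightarrow> real" where "s j = ts (kk j)"

text \<open>For \<open>j < J - 1\<close> the iterate \<open>zs (kk (Suc j))\<close> has multiplier
  zero and was computed with the load at \<open>ts (kk (Suc j) - 1) = s j\<close>; it is therefore
  paired with \<open>s j\<close> rather than with its own time. The last value \<open>zs N'\<close>
  is stable at \<open>T\<close> by the choice of \<open>N'\<close>.\<close>

definition y :: "nat \<Rightarrow> 'z" where "y j = zs (kk (Suc j))"

lemma ts_block_end: "j < J \<Longrightarrow> ts (kk (Suc j) - 1) = s j"
  unfolding s_def using kk_less[of j "Suc j"] by (intro ts_block) auto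

lemma s_0: "s 0 = 0" and s_end: "s (J - 1) = T"
  unfolding s_def kk_0 kk_N by (rule ts_0, rule ts_N)

lemma s_less: "j < J - 1 \<Longrightarrow> s j < s (Suc j)"
  using kk_progress(3)[of "Suc j"] ts_block_end[of j] by (simp add: s_def)

lemma s_gap: "j < J - 1 \<Longrightarrow> s (Suc j) - s j \<le> \<tau>"
proof -
  assume j: "j < J - 1"
  obtain m where m: "kk (Suc j) = Suc m" using kk_progress(1)[of "Suc j"] j by (cases "kk (Suc j)") auto
  have "ts (Suc m) \<le> ts m + \<tau>" using ts_Suc[of m] norm_ge_zero[of "i (zs (Suc m) - zs m)"] by linarith
  then show ?thesis using ts_block_end[of j] j m by (simp add: s_def)
qed

text \<open>The multiplier vanishes at the start of the block, and the only change of load comes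
  from the time step that enters the block, of length \<open>s (Suc j) - s j\<close>.\<close>

lemma block_variation:
  assumes j: "j < J - 1"
  shows "(\<Sum>k=kk (Suc j)..<kk (Suc (Suc j)). norm (incr k)) \<le> L / \<kappa> * (s (Suc j) - s j)"
proof -
  have "\<kappa> * (\<Sum>k=kk (Suc j)..<kk (Suc (Suc j)). norm (incr k)) + \<mu> (kk (Suc (Suc j)))
      \<le> \<mu> (kk (Suc j)) + L * (ts (kk (Suc (Suc j)) - 1) - ts (kk (Suc j) - 1))"
    by (rule block_bound, rule less_imp_le, rule kk_less) (use j in linarith)+
  then have "\<kappa> * (\<Sum>k=kk (Suc j)..<kk (Suc (Suc j)). norm (incr k)) \<le> L * (s (Suc j) - s j)"
    using \<mu>_nonneg[of "kk (Suc (Suc j))"] kk_progress(4)[of "Suc j"] ts_block_end[of j] ts_block_end[of "Suc j"] j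
    by simp
  then show ?thesis using \<kappa>_pos by (simp add: field_simps)
qed

text \<open>The interpolant starts at the first progress iterate. All steps up to it use the load at
  time 0, for which \<open>z0\<close> is stable, so the scheme has not moved.\<close>

lemma y_0: "y 0 = z0"
proof -
  have "\<kappa> * (\<Sum>k=kk 0..<kk (Suc 0). norm (incr k)) + \<mu> (kk (Suc 0)) \<le> \<mu> (kk 0) + L * (ts (kk (Suc 0) - 1) - ts (kk 0 - 1))"
    by (rule block_bound) (simp add: kk_0)
  then have "\<kappa> * (\<Sum>k=kk 0..<kk (Suc 0). norm (incr k)) \<le> 0"
    using \<mu>_nonneg[of "kk (Suc 0)"] ts_block_end[of 0] card_S(2) by (simp add: kk_0 \<mu>_0 ts_0 s_def)
  then have "(\<Sum>k=0..<kk (Suc 0). norm (incr k)) \<le> 0"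
    using \<kappa>_pos by (simp add: kk_0 mult_le_0_iff)
  then have "norm (zs (kk (Suc 0)) - zs 0) \<le> 0"
    using norm_zs_diff_le[of 0 "kk (Suc 0)"] by linarith
  then show ?thesis by (simp add: y_def zs_0)
qed

lemma y_lipschitz: "j < J - 1 \<Longrightarrow> norm (y (Suc j) - y j) \<le> L / \<kappa> * (s (Suc j) - s j)"
  using order_trans[OF norm_zs_diff_le[OF less_imp_le[OF kk_less]] block_variation, of j] by (simp add: y_def)

lemma y_stable:
  assumes "j \<le> J - 1"
  shows "r v + (DE (y j) - l (s j)) v \<ge> 0"
proof (cases "j = J - 1")
  case True
  then show ?thesis using N'(2)[of v] kk_J card_S(2) s_end by (simp add: y_def)
next
  case False
  then have j: "j < J - 1" using assms by simp
  then show ?thesis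
    using multiplier_bound[of "kk (Suc j)" v] kk_progress(4)[of "Suc j"] ts_block_end[of j]
    by (simp add: y_def force_def)
qed

text \<open>The flow rules of all steps in the block are added. They share the load at
  \<open>s (Suc j)\<close>, hence each force differs from the one at the end of the block through
  \<open>DE\<close> alone, by at most \<open>C * B\<close>. Since \<open>B\<close> also bounds the
  variation, the sum is quadratic in the time increment.\<close>

lemma y_dissipation:
  assumes C: "C \<ge> 0" "\<And>x y. norm x \<le> radius \<Longrightarrow> norm y \<le> radius \<Longrightarrow> norm (DE y - DE x) \<le> C * norm (y - x)"
    and j: "j < J - 1"
  shows "r (y (Suc j) - y j) + (DE (y (Suc j)) - l (s (Suc j))) (y (Suc j) - y j)
      \<le> C * (L / \<kappa>)\<^sup>2 * (s (Suc j) - s j)\<^sup>2"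
proof -
  define a b where "a = kk (Suc j)" and "b = kk (Suc (Suc j))"
  define B where "B = L / \<kappa> * (s (Suc j) - s j)"
  have ab: "a < b" unfolding a_def b_def by (rule kk_less) (use j in linarith)+
  have var: "(\<Sum>k=a..<b. norm (incr k)) \<le> B" using block_variation[OF j] by (simp add: a_def b_def B_def)
  have B: "B \<ge> 0" by (rule order_trans[OF sum_nonneg var]) simp
  define q where "q = DE (zs b) - l (s (Suc j))"
  have r_sum: "r (sum incr A) + q (sum incr A) \<le> (\<Sum>k\<in>A. r (incr k) + q (incr k))" if "finite A" for A
    using that
  proof (induction A rule: finite_induct)
    case (insert x A)
    then show ?case using r_add[of "incr x" "sum incr A"] by (simp add: blinfun.add_right)
  qed (simp add: r_zero)
  have "r (zs b - zs a) + q (zs b - zs a) \<le> (\<Sum>k=a..<b. r (incr k) + q (incr k))"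
    using r_sum[of "{a..<b}"] zs_diff[of a b] ab by simp
  also have "\<dots> \<le> (\<Sum>k=a..<b. C * B * norm (incr k))"
  proof (rule sum_mono)
    fix k assume k: "k \<in> {a..<b}"
    have "ts k = s (Suc j)" unfolding s_def by (rule ts_block) (use k j in \<open>auto simp: a_def b_def\<close>)
    then have qp: "q - force (Suc k) = DE (zs b) - DE (zs (Suc k))" by (simp add: q_def force_def)
    have "norm (zs b - zs (Suc k)) \<le> (\<Sum>k=Suc k..<b. norm (incr k))" by (rule norm_zs_diff_le) (use k in simp)
    also have "\<dots> \<le> (\<Sum>k=a..<b. norm (incr k))" by (rule sum_mono2) (use k in auto)
    finally have zz: "norm (zs b - zs (Suc k)) \<le> B" using var by simp
    have "norm (q - force (Suc k)) \<le> C * norm (zs b - zs (Suc k))"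
      unfolding qp by (rule C(2)[OF norm_zs_le_radius norm_zs_le_radius])
    also have "\<dots> \<le> C * B" by (rule mult_left_mono[OF zz C(1)])
    finally have "norm (q - force (Suc k)) * norm (incr k) \<le> C * B * norm (incr k)" by (rule mult_right_mono) simp
    moreover have "\<bar>(q - force (Suc k)) (incr k)\<bar> \<le> norm (q - force (Suc k)) * norm (incr k)"
      using norm_blinfun[of "q - force (Suc k)" "incr k"] by simp
    moreover have "r (incr k) + force (Suc k) (incr k) \<le> 0"
      using \<mu>_nonneg[of "Suc k"] by (simp add: flow_step)
    ultimately show "r (incr k) + q (incr k) \<le> C * B * norm (incr k)" by (simp add: blinfun.diff_left)
  qed
  also have "\<dots> = C * B * (\<Sum>k=a..<b. norm (incr k))" by (simp add: sum_distrib_left)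
  also have "\<dots> \<le> C * B * B" by (rule mult_left_mono[OF var]) (use C(1) B in simp)
  also have "\<dots> = C * (L / \<kappa>)\<^sup>2 * (s (Suc j) - s j)\<^sup>2" by (simp add: B_def power2_eq_square)
  finally show ?thesis by (simp add: y_def q_def a_def b_def)
qed

definition interpolant :: "real \<Rightarrow> 'z" where
  "interpolant t = (if t = T then zs N'
     else let j = (THE j. 1 \<le> j \<and> j \<le> J - 1 \<and> ts (kk (j - 1)) \<le> t \<and> t < ts (kk j))
       in zs (kk j) + ((t - ts (kk (j - 1))) / (ts (kk j) - ts (kk (j - 1)))) *\<^sub>R (zs (kk (j + 1)) - zs (kk j)))"

lemma s_mono: "a \<le> b \<Longrightarrow> b \<le> J - 1 \<Longrightarrow> s a \<le> s b"
proof (induction b rule: dec_induct)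
  case (step b)
  then show ?case using s_less[of b] by simp
qed simp

lemma interpolant_half_open:
  assumes j: "j < J - 1" and t: "s j \<le> t" "t < s (Suc j)"
  shows "interpolant t = y j + ((t - s j) / (s (Suc j) - s j)) *\<^sub>R (y (Suc j) - y j)"
proof -
  have "(THE j. 1 \<le> j \<and> j \<le> J - 1 \<and> ts (kk (j - 1)) \<le> t \<and> t < ts (kk j)) = Suc j"
  proof (rule the_equality)
    show "1 \<le> Suc j \<and> Suc j \<le> J - 1 \<and> ts (kk (Suc j - 1)) \<le> t \<and> t < ts (kk (Suc j))"
      using j t by (simp add: s_def)
    fix m assume m: "1 \<le> m \<and> m \<le> J - 1 \<and> ts (kk (m - 1)) \<le> t \<and> t < ts (kk m)"
    show "m = Suc j"
    proof (rule linorder_cases[of m "Suc j"])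
      assume "m < Suc j"
      then have "s m \<le> s j" using j by (intro s_mono) auto
      then show ?thesis using m t by (simp add: s_def)
    next
      assume "Suc j < m"
      then have "s (Suc j) \<le> s (m - 1)" using m by (intro s_mono) auto
      then show ?thesis using m t by (simp add: s_def)
    qed
  qed
  moreover have "t \<noteq> T" using s_mono[of "Suc j" "J - 1"] j t s_end by simp
  ultimately show ?thesis by (simp add: interpolant_def s_def y_def)
qed

text \<open>Closes the cells on the right: the value there is that of the next cell, or
  \<open>zs N'\<close> at time \<open>T\<close>.\<close>

lemma interpolant_affine:
  assumes j: "j < J - 1" and t: "s j \<le> t" "t \<le> s (Suc j)"
  shows "interpolant t = y j + ((t - s j) / (s (Suc j) - s j)) *\<^sub>R (y (Suc j) - y j)"
proof (cases "t = s (Suc j)")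
  case True
  have "interpolant t = y (Suc j)"
  proof (cases "Suc j = J - 1")
    case True
    have "kk (Suc (Suc j)) = N'" using True kk_J card_S(2) by simp
    moreover have "t = T" using True s_end \<open>t = s (Suc j)\<close> by simp
    ultimately show ?thesis by (simp add: interpolant_def y_def)
  next
    case False
    then show ?thesis using interpolant_half_open[of "Suc j" t] s_less[of "Suc j"] j True by simp
  qed
  then show ?thesis using s_less[OF j] True by simp
qed (use interpolant_half_open[OF j] t in simp)

lemma interpolant_approx_solution:
  assumes C: "C \<ge> 0" "\<And>x y. norm x \<le> radius \<Longrightarrow> norm y \<le> radius \<Longrightarrow> norm (DE y - DE x) \<le> C * norm (y - x)"
  defines "G \<equiv> C * (L / \<kappa>) + L"
  shows "approx_solution ((C * (L / \<kappa>)\<^sup>2 + G * (L / \<kappa>) + G) * \<tau>) (G * (L / \<kappa>)) (\<lambda>t. speed * t) interpolant"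
    and "t \<in> {0..T} \<Longrightarrow> norm (interpolant t) \<le> radius"
    and "interpolant 0 = z0"
proof -
  have \<Lambda>: "L / \<kappa> \<ge> 0" using L_nonneg \<kappa>_pos by simp
  have c: "C * (L / \<kappa>)\<^sup>2 \<ge> 0" using C(1) by simp
  have n: "J - 1 > 0" using card_S(2) by simp
  have rng: "norm (y j) \<le> radius" for j unfolding y_def by (rule norm_zs_le_radius)
  note a = affine_interpolation_approx_solution[where s = s and u = interpolant and R = radius,
      OF C \<Lambda> c n s_0 s_end s_less s_gap y_lipschitz y_dissipation[OF C] y_stable rng interpolant_affine]
  show "approx_solution ((C * (L / \<kappa>)\<^sup>2 + G * (L / \<kappa>) + G) * \<tau>) (G * (L / \<kappa>)) (\<lambda>t. speed * t) interpolant"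
    unfolding speed_def G_def by (rule a(1))
  show "norm (interpolant t) \<le> radius" if "t \<in> {0..T}" by (rule a(2)) (use that in auto)
  show "interpolant 0 = z0"
    using interpolant_affine[of 0 0] n s_less[of 0] s_0 y_0 by simp
qed

end

section \<open>Reduction of the theorem to the abstract system\<close>

lemma has_derivative_fderiv: "f differentiable (at x) \<Longrightarrow> (f has_derivative blinfun_apply (fderiv f x)) (at x)"
  unfolding fderiv_def
  by (metis bounded_linear_Blinfun_apply frechet_derivative_works has_derivative_bounded_linear)

lemma fderiv_eq: "(f has_derivative blinfun_apply g) (at x) \<Longrightarrow> fderiv f x = g"
  unfolding fderiv_def by (metis blinfun_apply_inverse frechet_derivative_at)

theorem theorem3p20:
  fixes T \<alpha> C_F q \<kappa> \<rho>1 \<rho>2 L_ell :: real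
    and i_ZV :: "'z::{real_inner, banach} \<Rightarrow>\<^sub>L 'v::{real_inner, banach}"
    and i_VX :: "'v \<Rightarrow>\<^sub>L 'x::banach"
    and A :: "'z \<Rightarrow>\<^sub>L ('z \<Rightarrow>\<^sub>L real)"
    and F :: "'z \<Rightarrow> real"
    and DF :: "'z \<Rightarrow> ('v \<Rightarrow>\<^sub>L real)"
    and ell :: "real \<Rightarrow> ('v \<Rightarrow>\<^sub>L real)"
    and I :: "real \<Rightarrow> 'z \<Rightarrow> real"
    and R :: "'v \<Rightarrow> real"
    and z0 :: 'z
  assumes T_pos: "T > 0"
    and emb_ZV: "dense_compact_embedding i_ZV"
    and emb_ZV_const: "\<And>v. norm (i_ZV v) \<le> norm v"
    and emb_VX: "inj (blinfun_apply i_VX)"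
    and I_eq: "I = energy i_ZV A F ell"
    and A_selfadjoint: "\<And>y z. A y z = A z y"
    and \<alpha>_pos: "\<alpha> > 0"
    and A_elliptic: "\<And>z. A z z \<ge> \<alpha> * (norm z)\<^sup>2"
    and ell_lipschitz: "L_ell-lipschitz_on {0..T} ell"
    and F_C2: "C2_map F"
    and F_nonneg: "\<And>z. F z \<ge> 0"
    and DF_eq: "\<And>z. fderiv F z = DF z o\<^sub>L i_ZV"
    and DF_C1: "C1_map DF"
    and q_ge_1: "q \<ge> 1"
    and D2F_growth: "\<And>z v. norm (fderiv DF z v) \<le> C_F * (1 + norm z powr q) * norm v"
    and I_C21_loc: "\<And>r. r > 0 \<Longrightarrow> \<exists>C\<ge>0. \<forall>t\<in>{0..T}. \<forall>z1\<in>ball 0 r. \<forall>z2\<in>ball 0 r. \<forall>v.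
        (fderiv (fderiv (I t)) z1 - fderiv (fderiv (I t)) z2) v v
          \<le> C * norm (z1 - z2) * (norm v)\<^sup>2"
    and R_nonneg: "\<And>v. R v \<ge> 0"
    and R_lsc: "lower_semicont R"
    and R_convex: "convex_on UNIV R"
    and R_homogeneous: "\<And>c v. c > 0 \<Longrightarrow> R (c *\<^sub>R v) = c * R v"
    and \<rho>_pos: "\<rho>1 > 0" "\<rho>2 > 0"
    and R_lower: "\<And>v. \<rho>1 * norm (i_VX v) \<le> R v"
    and R_upper: "\<And>v. R v \<le> \<rho>2 * norm v"
    and z0_stable: "subdiff_incl i_ZV R 0 (fderiv (I 0) z0)"
    and \<kappa>_pos: "\<kappa> > 0"
    and uniformly_convex: "\<And>t z v. t \<in> {0..T} \<Longrightarrow>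
        fderiv (fderiv (I t)) z v v \<ge> \<kappa> * (norm v)\<^sup>2"
  shows "\<exists>z. (\<exists>L. L-lipschitz_on {0..T} z) \<and>
             differential_solution T i_ZV I R z0 z \<and>
             (\<forall>y. differential_solution T i_ZV I R z0 y \<longrightarrow> (\<forall>t\<in>{0..T}. y t = z t)) \<and>
             (\<exists>C>0. \<forall>\<tau>>0. \<forall>ts zs. local_min_scheme T i_ZV I R z0 \<tau> ts zs \<longrightarrow>
                (\<forall>t\<in>{0..T}. norm (z t - affine_interpolant T i_ZV I R ts zs t) \<le> C * sqrt \<tau>))"
proof -
  \<comment> \<open>The load is pulled back to Z and kept apart from \<open>E\<close>, so that
    \<open>DE\<close> and \<open>H\<close> do not depend on time.\<close>
  define l where "l t = ell t o\<^sub>L i_ZV" for t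
  define r where "r v = R (i_ZV v)" for v
  define E where "E z = 1 / 2 * A z z + F z" for z
  define DE where "DE z = A z + (DF z o\<^sub>L i_ZV)" for z
  have I_E: "I t z = E z - l t z" for t z
    by (simp add: I_eq energy_def E_def l_def)
  have F_deriv: "(F has_derivative blinfun_apply (DF z o\<^sub>L i_ZV)) (at z)" for z
    using has_derivative_fderiv[of F z] F_C2 unfolding C2_map_def C1_map_def DF_eq[symmetric] by blast
  have E_deriv: "(E has_derivative blinfun_apply (DE z)) (at z)" for z
  proof -
    have "((\<lambda>z. A z z) has_derivative (\<lambda>h. A z h + A h z)) (at z)"
      by (rule has_derivative_eq_rhs, (rule derivative_intros
            bounded_bilinear.FDERIV[OF bounded_bilinear_blinfun_apply] bounded_linear_imp_has_derivative[OF blinfun.bounded_linear_right])+) simp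
    then have "((\<lambda>z. 1 / 2 * A z z + F z) has_derivative (\<lambda>h. 1 / 2 * (A z h + A h z) + (DF z o\<^sub>L i_ZV) h)) (at z)"
      by (intro has_derivative_add has_derivative_mult_right F_deriv)
    moreover have "(\<lambda>h. 1 / 2 * (A z h + A h z) + (DF z o\<^sub>L i_ZV) h) = blinfun_apply (DE z)"
      by (simp add: fun_eq_iff DE_def blinfun.add_left A_selfadjoint[of _ z])
    ultimately show ?thesis unfolding E_def[abs_def] by simp
  qed
  define H where "H = fderiv DE"
  have DE_deriv: "(DE has_derivative blinfun_apply (H z)) (at z)" for z
  proof -
    have "(DF has_derivative blinfun_apply (fderiv DF z)) (at z)"
      using has_derivative_fderiv[of DF z] DF_C1 unfolding C1_map_def by blast
    then have "((\<lambda>z. DF z o\<^sub>L i_ZV) has_derivative (\<lambda>h. fderiv DF z h o\<^sub>L i_ZV)) (at z)"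
      by (rule bounded_linear.has_derivative[OF bounded_bilinear.bounded_linear_left[OF bounded_bilinear_blinfun_compose]])
    then have "(DE has_derivative (\<lambda>h. A h + (fderiv DF z h o\<^sub>L i_ZV))) (at z)"
      unfolding DE_def[abs_def]
      by (intro has_derivative_add bounded_linear_imp_has_derivative blinfun.bounded_linear_right)
    then have "DE differentiable (at z)" by (rule differentiableI)
    then show ?thesis unfolding H_def by (rule has_derivative_fderiv)
  qed
  have DI: "fderiv (I t) z = DE z - l t" for t z
  proof (rule fderiv_eq)
    have "((\<lambda>z. E z - l t z) has_derivative (\<lambda>h. DE z h - l t h)) (at z)"
      by (intro has_derivative_diff E_deriv bounded_linear_imp_has_derivative blinfun.bounded_linear_right)
    then show "(I t has_derivative blinfun_apply (DE z - l t)) (at z)"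
      unfolding I_E[abs_def] by (simp add: blinfun.diff_left[abs_def] fun_diff_def minus_blinfun.rep_eq)
  qed
  have D2I: "fderiv (fderiv (I t)) z = H z" for t z
  proof (rule fderiv_eq)
    have "((\<lambda>z. DE z - l t) has_derivative (\<lambda>h. H z h - 0)) (at z)"
      by (intro has_derivative_diff DE_deriv has_derivative_const)
    then show "(fderiv (I t) has_derivative blinfun_apply (H z)) (at z)"
      unfolding DI[abs_def] by simp
  qed
  have R0: "R 0 = 0" using R_homogeneous[of 2 0] by simp
  \<comment> \<open>Convexity at the midpoint, combined with homogeneity for the factor 2.\<close>
  have R_add: "R (v + w) \<le> R v + R w" for v w
  proof -
    have "R ((1 - 1 / 2) *\<^sub>R v + (1 / 2) *\<^sub>R w) \<le> (1 - 1 / 2) * R v + (1 / 2) * R w"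
      by (rule convex_onD[OF R_convex]) auto
    moreover have "R (2 *\<^sub>R ((1 - 1 / 2) *\<^sub>R v + (1 / 2) *\<^sub>R w)) = 2 * R ((1 - 1 / 2) *\<^sub>R v + (1 / 2) *\<^sub>R w)"
      by (rule R_homogeneous) simp
    moreover have "2 *\<^sub>R ((1 - 1 / 2) *\<^sub>R v + (1 / 2) *\<^sub>R w) = v + w" by (simp add: scaleR_add_right)
    ultimately show ?thesis by simp
  qed
  have L: "L_ell \<ge> 0" using ell_lipschitz lipschitz_on_nonneg by blast
  \<comment> \<open>The Lipschitz bound in the dual of V keeps the V norm of \<open>v\<close>, as
    the multiplier estimates demand; \<open>l_lip\<close> below is its weaker form in Z.\<close>
  have l_weak: "\<bar>(l s - l t) v\<bar> \<le> L_ell * \<bar>s - t\<bar> * norm (i_ZV v)" if "s \<in> {0..T}" "t \<in> {0..T}" for s t v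
  proof -
    have "\<bar>(l s - l t) v\<bar> = norm ((ell s - ell t) (i_ZV v))" by (simp add: l_def blinfun.diff_left)
    also have "\<dots> \<le> norm (ell s - ell t) * norm (i_ZV v)" by (rule norm_blinfun)
    also have "\<dots> \<le> L_ell * \<bar>s - t\<bar> * norm (i_ZV v)"
      using lipschitz_onD[OF ell_lipschitz that] by (intro mult_right_mono) (auto simp: dist_norm)
    finally show ?thesis .
  qed
  have l_lip: "L_ell-lipschitz_on {0..T} l"
  proof (rule lipschitz_onI)
    fix s t assume st: "s \<in> {0..T}" "t \<in> {0..T}"
    have "norm (l s - l t) \<le> L_ell * \<bar>s - t\<bar>"
    proof (rule norm_blinfun_bound)
      fix v
      have "L_ell * \<bar>s - t\<bar> * norm (i_ZV v) \<le> L_ell * \<bar>s - t\<bar> * norm v"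
        by (rule mult_left_mono[OF emb_ZV_const]) (use L in simp)
      then show "norm ((l s - l t) v) \<le> L_ell * \<bar>s - t\<bar> * norm v" using l_weak[OF st, of v] by simp
    qed (use L in simp)
    then show "dist (l s) (l t) \<le> L_ell * dist s t" by (simp add: dist_norm)
  qed (rule L)
  have incl0: "subdiff_incl i_ZV R 0 (DE z - l t) \<longleftrightarrow> (\<forall>v. r v + (DE z - l t) v \<ge> 0)" for z t
  proof -
    have "- a \<le> b \<longleftrightarrow> 0 \<le> b + a" for a b :: real by linarith
    then show ?thesis by (simp add: subdiff_incl_def r_def R0)
  qed
  interpret rate_independent T L_ell \<kappa> \<rho>2 r E DE H l z0
  proof
    show "r v \<le> \<rho>2 * norm v" for v
      unfolding r_def
      by (rule order_trans[OF R_upper mult_left_mono[OF emb_ZV_const]]) (use \<rho>_pos in simp)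
    show "\<exists>C\<ge>0. \<forall>x\<in>ball 0 R. \<forall>y\<in>ball 0 R. \<forall>v. (H x - H y) v v \<le> C * norm (x - y) * (norm v)\<^sup>2" if "R > 0" for R
      using I_C21_loc[OF that] T_pos unfolding D2I by fastforce
    show "\<kappa> * (norm v)\<^sup>2 \<le> H z v v" for z v
      using uniformly_convex[of 0 v z] T_pos unfolding D2I by simp
    show "0 \<le> r v + (DE z0 - l 0) v" for v
      using z0_stable unfolding DI incl0 by blast
    show "r (v + w) \<le> r v + r w" for v w using R_add by (simp add: r_def blinfun.add_right)
    show "r (c *\<^sub>R v) = c * r v" if "c > 0" for c v
      using R_homogeneous[OF that] by (simp add: r_def blinfun.scaleR_right)
    show "r v \<ge> 0" for v by (simp add: r_def R_nonneg)
  qed (use T_pos L \<kappa>_pos \<rho>_pos E_deriv DE_deriv l_lip in auto)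
  have sol_iff: "differential_solution T i_ZV I R z0 u \<longleftrightarrow> u 0 = z0 \<and> (\<exists>g. W11_with_deriv T u g \<and>
      (AE t in lebesgue_on {0..T}. \<forall>v. r v \<ge> r (g t) - (DE (u t) - l t) (v - g t)))" for u
    unfolding differential_solution_def subdiff_incl_def DI r_def by simp
  obtain K z where K: "K \<ge> 0" and z: "approx_solution 0 K (\<lambda>t. speed * t) z" "z 0 = z0"
    "\<forall>t\<in>{0..T}. norm (z t) \<le> radius"
    using exact_solution_exists by (elim exE conjE)
  \<comment> \<open>The local constants belong to a fixed ball and are chosen before any run of the
    scheme; \<open>c\<close> and \<open>D\<close> are thereby independent of \<tau>.\<close>
  obtain C where C: "C \<ge> 0"
    "\<And>x y. norm x \<le> radius \<Longrightarrow> norm y \<le> radius \<Longrightarrow> norm (DE y - DE x) \<le> C * norm (y - x)"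
    "\<And>x y. norm x \<le> radius \<Longrightarrow> norm y \<le> radius \<Longrightarrow> norm (DE y - DE x - H x (y - x)) \<le> C * (norm (y - x))\<^sup>2"
    using local_bounds[OF radius_nonneg] by blast
  define G where "G = C * (L_ell / \<kappa>) + L_ell"
  have Lk: "L_ell / \<kappa> \<ge> 0" using L \<kappa>_pos by simp
  have G: "G \<ge> 0" unfolding G_def using C(1) Lk L by (intro add_nonneg_nonneg mult_nonneg_nonneg)
  have GL: "G * (L_ell / \<kappa>) \<ge> 0" by (rule mult_nonneg_nonneg[OF G Lk])
  define c where "c = C * (L_ell / \<kappa>)\<^sup>2 + G * (L_ell / \<kappa>) + G"
  have c: "c \<ge> 0" unfolding c_def using C(1) GL G by simp
  obtain D where D: "D > 0" and err: "\<forall>\<tau>>0. \<forall>u. approx_solution (c * \<tau>) (G * (L_ell / \<kappa>)) (\<lambda>t. speed * t) u \<longrightarrow> u 0 = z0 \<longrightarrow>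
    (\<forall>t\<in>{0..T}. norm (u t) \<le> radius) \<longrightarrow> (\<forall>t\<in>{0..T}. norm (z t - u t) \<le> D * sqrt \<tau>)"
    using approx_solution_error[OF z K GL c] by (elim exE conjE)
  show ?thesis
  proof (rule exI[of _ z], intro conjI)
    show "\<exists>L. L-lipschitz_on {0..T} z" using approx_solution_lipschitz[OF z(1)] by blast
    show "differential_solution T i_ZV I R z0 z"
      unfolding sol_iff using z(2) exact_solution_derivative[OF z(1)] by blast
    show "\<forall>u. differential_solution T i_ZV I R z0 u \<longrightarrow> (\<forall>t\<in>{0..T}. u t = z t)"
    proof (intro allI impI ballI)
      fix u t assume u: "differential_solution T i_ZV I R z0 u" and t: "t \<in> {0..T}"
      obtain g where g: "W11_with_deriv T u g"
        "AE t in lebesgue_on {0..T}. \<forall>v. r v \<ge> r (g t) - (DE (u t) - l t) (v - g t)" and u0: "u 0 = z0"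
        using u unfolding sol_iff by (elim exE conjE)
      obtain K' M where K': "K' \<ge> 0" "continuous_on {0..T} M" "approx_solution 0 K' M u"
        using differential_solution_exact[OF g] by (elim exE conjE)
      show "u t = z t"
        by (rule exact_solution_unique[OF K'(1) K K'(2) _ K'(3) z(1) _ t])
          (use u0 z(2) in \<open>auto intro!: continuous_intros\<close>)
    qed
    show "\<exists>C>0. \<forall>\<tau>>0. \<forall>ts zs. local_min_scheme T i_ZV I R z0 \<tau> ts zs \<longrightarrow>
        (\<forall>t\<in>{0..T}. norm (z t - affine_interpolant T i_ZV I R ts zs t) \<le> C * sqrt \<tau>)"
    proof (rule exI[of _ D], intro conjI allI impI ballI)
      show "D > 0" by (rule D)
      fix \<tau> ts zs t
      assume \<tau>: "\<tau> > 0" and run: "local_min_scheme T i_ZV I R z0 \<tau> ts zs" and t: "t \<in> {0..T}"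
      interpret local_minimization T L_ell \<kappa> \<rho>2 r E DE H l z0 i_ZV \<tau> ts zs
      proof
        show "i_ZV v = 0 \<Longrightarrow> v = 0" for v
          using emb_ZV unfolding dense_compact_embedding_def by (metis injD blinfun.zero_right)
        have min: "is_arg_min (\<lambda>z. I (ts k) z + R (i_ZV (z - zs k))) (\<lambda>z. norm (i_ZV (z - zs k)) \<le> \<tau>) (zs (Suc k))" for k
          using run unfolding local_min_scheme_def by blast
        show "norm (i_ZV (zs (Suc k) - zs k)) \<le> \<tau>" for k
          using min[of k] unfolding is_arg_min_def by blast
        show "E (zs (Suc k)) - l (ts k) (zs (Suc k)) + r (zs (Suc k) - zs k) \<le> E v - l (ts k) v + r (v - zs k)"
          if "norm (i_ZV (v - zs k)) \<le> \<tau>" for k v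
          using min[of k] that unfolding is_arg_min_def I_E r_def by (meson not_less)
      qed (use run emb_ZV_const l_weak \<tau> in \<open>auto simp: local_min_scheme_def\<close>)
      have N_eq: "final_index T ts = N" by (simp add: final_index_def N_def)
      have N'_eq: "stable_index T i_ZV I R ts zs = N'"
        by (simp add: stable_index_def N_eq N'_def DI incl0)
      have "affine_interpolant T i_ZV I R ts zs t = interpolant t"
        unfolding affine_interpolant_def interpolant_def N_eq N'_eq Let_def S_def[symmetric] J_def[symmetric] kk_def[symmetric] ..
      moreover have "norm (z t - interpolant t) \<le> D * sqrt \<tau>"
      proof (rule err[rule_format, OF \<tau> _ _ _ t])
        show "approx_solution (c * \<tau>) (G * (L_ell / \<kappa>)) (\<lambda>t. speed * t) interpolant"
          unfolding c_def G_def by (rule interpolant_approx_solution(1)[OF C(1)]) (rule C(2))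
        show "interpolant 0 = z0" by (rule interpolant_approx_solution(3)[OF C(1)]) (rule C(2))
        show "norm (interpolant t) \<le> radius" if "t \<in> {0..T}" for t
          by (rule interpolant_approx_solution(2)[OF C(1)]) (use C(2) that in auto)
      qed
      ultimately show "norm (z t - affine_interpolant T i_ZV I R ts zs t) \<le> D * sqrt \<tau>" by simp
    qed
  qed
qed

end
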